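(* For every positive integer $s$, $$k\otimes_{G(4)}\mathscr{P}_A((P_4)_{2^{s+3}+2^{s+1}-3}^{*})=\begin{cases}\langle[\zeta]\rangle & \text{if } s=1,\\ 0 & \text{if } s=2,\\ \langle[a_2^{(2^{s}-1)}a_3^{(2^{s}-1)}a_4^{(2^{s+3}-1)}]\rangle & \text{if } s\geqslant 3,\end{cases}$$ where $\zeta\in (P_4)^*_{17}$ is the sum $a_1^{(5)}a_2^{(5)}a_3^{(5)}a_4^{(2)}+a_1^{(5)}a_2^{(5)}a_3^{(6)}a_4^{(1)}+a_1^{(3)}a_2^{(5)}a_3^{(8)}a_4^{(1)}+a_1^{(5)}a_2^{(3)}a_3^{(8)}a_4^{(1)}+a_1^{(3)}a_2^{(6)}a_3^{(7)}a_4^{(1)} +a_1^{(5)}a_2^{(7)}a_3^{(4)}a_4^{(1)}+a_1^{(7)}a_2^{(5)}a_3^{(4)}a_4^{(1)}+a_1^{(3)}a_2^{(9)}a_3^{(4)}a_4^{(1)}+a_1^{(9)}a_2^{(3)}a_3^{(4)}a_4^{(1)}+a_1^{(3)}a_2^{(9)}a_3^{(3)}a_4^{(2)} +a_1^{(9)}a_2^{(3)}a_3^{(3)}a_4^{(2)}+a_1^{(5)}a_2^{(9)}a_3^{(2)}a_4^{(1)}+a_1^{(9)}a_2^{(5)}a_3^{(2)}a_4^{(1)}+a_1^{(5)}a_2^{(10)}a_3^{(1)}a_4^{(1)}+a_1^{(9)}a_2^{(6)}a_3^{(1)}a_4^{(1)} +a_1^{(3)}a_2^{(11)}a_3^{(2)}a_4^{(1)}+a_1^{(11)}a_2^{(3)}a_3^{(2)}a_4^{(1)}+a_1^{(5)}a_2^{(5)}a_3^{(3)}a_4^{(4)}+a_1^{(5)}a_2^{(3)}a_3^{(5)}a_4^{(4)}+a_1^{(3)}a_2^{(5)}a_3^{(5)}a_4^{(4)}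 +a_1^{(3)}a_2^{(12)}a_3^{(1)}a_4^{(1)}+a_1^{(11)}a_2^{(4)}a_3^{(1)}a_4^{(1)}+a_1^{(7)}a_2^{(8)}a_3^{(1)}a_4^{(1)}+a_1^{(7)}a_2^{(7)}a_3^{(1)}a_4^{(2)}+a_1^{(13)}a_2^{(2)}a_3^{(1)}a_4^{(1)} +a_1^{(14)}a_2^{(1)}a_3^{(1)}a_4^{(1)}+a_1^{(6)}a_2^{(5)}a_3^{(3)}a_4^{(3)}+a_1^{(5)}a_2^{(3)}a_3^{(6)}a_4^{(3)}+a_1^{(3)}a_2^{(6)}a_3^{(5)}a_4^{(3)}+a_1^{(6)}a_2^{(3)}a_3^{(3)}a_4^{(5)} +a_1^{(3)}a_2^{(3)}a_3^{(6)}a_4^{(5)}+a_1^{(3)}a_2^{(6)}a_3^{(3)}a_4^{(5)}+a_1^{(5)}a_2^{(3)}a_3^{(3)}a_4^{(6)}+a_1^{(3)}a_2^{(5)}a_3^{(3)}a_4^{(6)}+a_1^{(3)}a_2^{(3)}a_3^{(5)}a_4^{(6)} +a_1^{(3)}a_2^{(3)}a_3^{(3)}a_4^{(8)}+a_1^{(3)}a_2^{(3)}a_3^{(4)}a_4^{(7)}+a_1^{(3)}a_2^{(5)}a_3^{(2)}a_4^{(7)}+a_1^{(3)}a_2^{(6)}a_3^{(1)}a_4^{(7)}+a_1^{(3)}a_2^{(3)}a_3^{(9)}a_4^{(2)} +a_1^{(3)}a_2^{(3)}a_3^{(10)}a_4^{(1)}+a_1^{(5)}a_2^{(3)}a_3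^{(7)}a_4^{(2)}+a_1^{(5)}a_2^{(7)}a_3^{(3)}a_4^{(2)}+a_1^{(7)}a_2^{(5)}a_3^{(3)}a_4^{(2)}$.
   Context: $k=\mathbb{Z}/2$, $A$ is the mod 2 Steenrod algebra and $G(4)=GL_4(k)$. $P_4=k[x_1,\dots,x_4]$, $\deg x_i=1$, with the usual $A$-action and $G(4)$ acting by linear substitution. $(P_4)^*$ is the divided power algebra on $a_1^{(1)},\dots,a_4^{(1)}$ (dual to $x_1,\dots,x_4$), with basis $a_1^{(j_1)}\cdots a_4^{(j_4)}$ dual to the monomials $x_1^{j_1}\cdots x_4^{j_4}$ (a factor $a_i^{(0)}$ is $1$ and omitted), with the dual right $A$-action. $\mathscr{P}_A((P_4)_n^* )$ is the subspace of $(P_4)_n^*$ annihilated by all $Sq^i$, $i>0$; $k\otimes_{G(4)}\mathscr{P}_A((P_4)_n^* )$ denotes its $G(4)$-coinvariants and $[\cdot]$ the class of an element there. *)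

theory Defs
  imports Main
begin

text \<open>Conventions. Everything is over k = Z/2.
  Exponent vectors are lists of length 4: e = [j1,j2,j3,j4] stands for the monomial
  x1^j1 x2^j2 x3^j3 x4^j4 of P_4 and, dually, for the divided-power basis element
  a1^(j1) a2^(j2) a3^(j3) a4^(j4) of (P_4)^*.
  A vector over Z/2 (polynomial or dual element) is represented by its finite support,
  a set of exponent vectors; addition is symmetric difference.\<close>

type_synonym expv = "nat list"
type_synonym vec2 = "expv set"

definition Mon :: "nat \<Rightarrow> expv set" where
  "Mon n = {e. length e = 4 \<and> sum_list e = n}"

definition sdiff :: "vec2 \<Rightarrow> vec2 \<Rightarrow> vec2" where
  "sdiff A B = (A - B) \<union> (B - A)"

definition xsum :: "vec2 set \<Rightarrow> vec2" where
  "xsum T = {x. odd (card {A \<in> T. x \<in> A})}"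

definition span2 :: "vec2 set \<Rightarrow> vec2 set" where
  "span2 S = {xsum T | T. finite T \<and> T \<subseteq> S}"

definition pmult :: "vec2 \<Rightarrow> vec2 \<Rightarrow> vec2" where
  "pmult P Q = {m. odd (card {(p, q). p \<in> P \<and> q \<in> Q \<and> map2 (+) p q = m})}"

definition pone :: vec2 where
  "pone = {[0, 0, 0, 0]}"

fun ppow :: "vec2 \<Rightarrow> nat \<Rightarrow> vec2" where
  "ppow P 0 = pone"
| "ppow P (Suc k) = pmult P (ppow P k)"

definition unitv :: "nat \<Rightarrow> expv" where
  "unitv j = map (\<lambda>i. if i = j then 1 else 0) [0, 1, 2, 3]"

text \<open>Steenrod squares on monomials (Cartan formula, Sq^i x = x^2 for i = 1 on degree one):
  Sq^i (x^b) = sum over e with e - b = c >= 0, |c| = i, of prod_j binom(b_j, c_j) x^e.\<close>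
definition sq_mon :: "nat \<Rightarrow> expv \<Rightarrow> vec2" where
  "sq_mon i b = {e \<in> Mon (sum_list b + i).
      list_all2 (\<le>) b e \<and> odd (\<Prod>j<4. (b ! j) choose (e ! j - b ! j))}"

text \<open>Dual right action of Sq^i on an element f of (P_4)^*_n: (f Sq^i)(x^b) = f(Sq^i x^b).\<close>
definition dsq :: "nat \<Rightarrow> vec2 \<Rightarrow> nat \<Rightarrow> vec2" where
  "dsq n f i = {b \<in> Mon (n - i). odd (card (f \<inter> sq_mon i b))}"

definition PA :: "nat \<Rightarrow> vec2 set" where
  "PA n = {f. f \<subseteq> Mon n \<and> (\<forall>i. 0 < i \<and> i \<le> n \<longrightarrow> dsq n f i = {})}"

definition GL4 :: "(nat \<Rightarrow> nat \<Rightarrow> bool) set" where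
  "GL4 = {g. \<exists>h. \<forall>i<4. \<forall>k<4. odd (card {j. j < 4 \<and> g i j \<and> h j k}) = (i = k)}"

text \<open>Linear substitution: x_i maps to the sum over j of g_{j i} x_j; extended multiplicatively.\<close>
definition linf :: "(nat \<Rightarrow> nat \<Rightarrow> bool) \<Rightarrow> nat \<Rightarrow> vec2" where
  "linf g i = {unitv j | j. j < 4 \<and> g j i}"

definition gmon :: "(nat \<Rightarrow> nat \<Rightarrow> bool) \<Rightarrow> expv \<Rightarrow> vec2" where
  "gmon g e = foldr (\<lambda>i acc. pmult (ppow (linf g i) (e ! i)) acc) [0, 1, 2, 3] pone"

text \<open>Induced action on (P_4)^*_n: (f g)(x^e) = f(g x^e).\<close>
definition dact :: "nat \<Rightarrow> (nat \<Rightarrow> nat \<Rightarrow> bool) \<Rightarrow> vec2 \<Rightarrow> vec2" where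
  "dact n g f = {e \<in> Mon n. odd (card (f \<inter> gmon g e))}"

text \<open>Kernel of the projection PA n onto the coinvariants k \<otimes>_{G(4)} PA n.\<close>
definition Rel :: "nat \<Rightarrow> vec2 set" where
  "Rel n = span2 {sdiff (dact n g f) f | f g. f \<in> PA n \<and> g \<in> GL4}"

definition coinv_spanned_by :: "nat \<Rightarrow> vec2 \<Rightarrow> bool" where
  "coinv_spanned_by n z \<longleftrightarrow> z \<in> PA n \<and> z \<notin> Rel n \<and>
     (\<forall>f \<in> PA n. f \<in> Rel n \<or> sdiff f z \<in> Rel n)"

definition coinv_zero :: "nat \<Rightarrow> bool" where
  "coinv_zero n \<longleftrightarrow> (\<forall>f \<in> PA n. f \<in> Rel n)"

definition zeta :: vec2 where
  "zeta = {[5,5,5,2], [5,5,6,1], [3,5,8,1], [5,3,8,1], [3,6,7,1], [5,7,4,1], [7,5,4,1],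
    [3,9,4,1], [9,3,4,1], [3,9,3,2], [9,3,3,2], [5,9,2,1], [9,5,2,1], [5,10,1,1], [9,6,1,1],
    [3,11,2,1], [11,3,2,1], [5,5,3,4], [5,3,5,4], [3,5,5,4], [3,12,1,1], [11,4,1,1], [7,8,1,1],
    [7,7,1,2], [13,2,1,1], [14,1,1,1], [6,5,3,3], [5,3,6,3], [3,6,5,3], [6,3,3,5], [3,3,6,5],
    [3,6,3,5], [5,3,3,6], [3,5,3,6], [3,3,5,6], [3,3,3,8], [3,3,4,7], [3,5,2,7], [3,6,1,7],
    [3,3,9,2], [3,3,10,1], [5,3,7,2], [5,7,3,2], [7,5,3,2]}"

definition wgen :: "nat \<Rightarrow> vec2" where
  "wgen s = {[0, 2^s - 1, 2^s - 1, 2^(s+3) - 1]}"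

definition degN :: "nat \<Rightarrow> nat" where
  "degN s = 2^(s+3) + 2^(s+1) - 3"

end

theory Submission
  imports Defs "HOL-Library.Poly_Mapping" "HOL-Library.Z2" "HOL-Library.Function_Algebras" "HOL-Library.FuncSet"
begin

text \<open>An element of \<^term>\<open>PA n\<close> is a functional of degree \<open>n\<close> on the polynomial ring that is invariant under the
  total square, the ring endomorphism \<open>x \<mapsto> x + x\<^sup>2\<close>. If \<open>d + 2\<close> is not a power of two, an invariant functional of
  degree \<open>2 d + 3\<close> vanishes on monomials unless exactly three exponents are odd; it amounts to four invariant
  functionals \<open>G i\<close> of degree \<open>d\<close> with \<open>\<Sum>i. G i (x\<^sub>i p) = 0\<close>. Starting from degree 7, \<open>s\<close> such halvings lead
  to the degree of the theorem. The exactness of the Koszul complex shows that for \<open>s \<ge> 3\<close> everything is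
  spanned by elements built from a linear form \<open>v\<close> and one invariant functional of degree 7 killed by \<open>v\<close>. In degree 7 such a
  functional is a combination of divided powers of vectors \<open>u\<close> orthogonal to \<open>v\<close> and of a term halving to degree 2.
  The terms from degree 2 are differences \<open>F g - F\<close>, and all flags \<open>(v, u)\<close> are identified by transvections, so at
  most one class remains. For \<open>s \<ge> 3\<close> an explicit functional that is 1 on all flags and 0 on the terms from degree 2
  shows that this class is nonzero. For \<open>s \<le> 2\<close> the flags are differences as well, but for \<open>s = 1\<close> there is one further
  invariant, a single sum of coefficients, and it is 1 on \<^const>\<open>zeta\<close>.\<close>

section \<open>Polynomials and the total square\<close>

declare add_bit_eq_xor [simp del] mult_bit_eq_and [simp del] power_bit_unfold [simp del]

abbreviation "lookup \<equiv> Poly_Mapping.lookup"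
abbreviation "keys \<equiv> Poly_Mapping.keys"

datatype ix = I0 | I1 | I2 | I3

lemma UNIV_ix: "(UNIV :: ix set) = {I0, I1, I2, I3}"
  using ix.exhaust by auto

instance ix :: finite
  by standard (simp add: UNIV_ix)

type_synonym pol = "(ix \<Rightarrow> nat) \<Rightarrow>\<^sub>0 bit"

lemma bit_add_self [simp]: "(a::bit) + a = 0"
  by (cases a) simp_all

lemma bit_add_left_self [simp]: "(a::bit) + (a + b) = b"
  by (simp flip: add.assoc)

lemma bit_add_eq_0_iff: "(a::bit) + b = 0 \<longleftrightarrow> a = b"
  by (cases a; cases b) simp_all

lemma pol_add_self [simp]: "(p::pol) + p = 0"
  by (rule poly_mapping_eqI) (simp only: lookup_add bit_add_self lookup_zero)

lemma pol_double [simp]: "2 * (p::pol) = 0"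
  by (simp only: mult_2 pol_add_self)

lemma pol_add_left_self [simp]: "(p::pol) + (p + q) = q"
  by (simp flip: add.assoc)

lemma pol_square_add: "((p::pol) + q)^2 = p^2 + q^2"
  by (simp add: power2_eq_square algebra_simps)

lemma pol_square_sum: "(\<Sum>i\<in>A. f i :: pol)^2 = (\<Sum>i\<in>A. (f i)^2)"
  by (induction A rule: infinite_finite_induct) (simp_all add: pol_square_add)

definition mon :: "(ix \<Rightarrow> nat) \<Rightarrow> pol" where
  "mon e = Poly_Mapping.single e 1"

definition unit :: "ix \<Rightarrow> ix \<Rightarrow> nat" where
  "unit i = (\<lambda>j. if j = i then 1 else 0)"

definition X :: "ix \<Rightarrow> pol" where
  "X i = mon (unit i)"

definition tot :: "(ix \<Rightarrow> nat) \<Rightarrow> nat" where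
  "tot e = (\<Sum>i\<in>UNIV. e i)"

lemma tot_add [simp]: "tot (e + f) = tot e + tot f"
  by (simp add: tot_def sum.distrib)

lemma tot_unit [simp]: "tot (unit i) = 1"
  by (simp add: tot_def unit_def)

lemma tot_0 [simp]: "tot 0 = 0"
  by (simp add: tot_def)

lemma tot_eq_0_iff [simp]: "tot e = 0 \<longleftrightarrow> e = 0"
  by (simp add: tot_def fun_eq_iff)

lemma mon_0 [simp]: "mon 0 = 1"
  by (simp add: mon_def)

lemma mon_add: "mon (e + f) = mon e * mon f"
  by (simp add: mon_def mult_single)

lemma keys_mon [simp]: "keys (mon e) = {e}"
  by (simp add: mon_def)

lemma lookup_mon: "lookup (mon e) f = of_bool (e = f)"
  by (simp add: mon_def lookup_single when_def)

lemma pol_eq_sum_mon: "(p::pol) = (\<Sum>e\<in>keys p. mon e)"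
proof (rule poly_mapping_eqI)
  fix k
  show "lookup p k = lookup (\<Sum>e\<in>keys p. mon e) k"
    by (simp add: lookup_sum lookup_mon of_bool_def in_keys_iff)
qed

lemma mon_scale: "mon (\<lambda>i. n * e i) = mon e ^ n"
proof (induction n)
  case 0
  have "(\<lambda>i. 0 * e i) = 0" by (simp add: fun_eq_iff)
  then show ?case by (metis mon_0 power_0)
next
  case (Suc n)
  have "(\<lambda>i. Suc n * e i) = e + (\<lambda>i. n * e i)" by (simp add: fun_eq_iff)
  then show ?case using Suc by (simp only: mon_add power_Suc)
qed

lemma mon_sum: "finite A \<Longrightarrow> mon (\<Sum>i\<in>A. f i) = (\<Prod>i\<in>A. mon (f i))"
proof (induction A rule: finite_induct)
  case empty
  show ?case using mon_0 by (simp add: zero_fun_def)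
next
  case (insert x A)
  then show ?case by (metis mon_add sum.insert prod.insert)
qed

lemma sum_fun_apply: "(\<Sum>i\<in>A. f i :: 'a \<Rightarrow> 'b::comm_monoid_add) x = (\<Sum>i\<in>A. f i x)"
  by (induction A rule: infinite_finite_induct) simp_all

lemma mon_eq_prod: "mon e = (\<Prod>i\<in>UNIV. X i ^ e i)"
proof -
  have "e = (\<Sum>i\<in>UNIV. (\<lambda>j. e i * unit i j))"
    by (simp add: fun_eq_iff sum_fun_apply unit_def if_distrib cong: if_cong)
  then have "mon e = (\<Prod>i\<in>UNIV. mon (\<lambda>j. e i * unit i j))"
    using mon_sum[of UNIV "\<lambda>i j. e i * unit i j"] by simp
  then show ?thesis by (simp add: mon_scale X_def)
qed

definition lin :: "('a::ab_group_add \<Rightarrow> 'b::ab_group_add) \<Rightarrow> bool" where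
  "lin F \<longleftrightarrow> (\<forall>p q. F (p + q) = F p + F q)"

lemma linI: "(\<And>p q. F (p + q) = F p + F q) \<Longrightarrow> lin F"
  by (simp add: lin_def)

lemma lin_add: "lin F \<Longrightarrow> F (p + q) = F p + F q"
  by (simp add: lin_def)

lemma lin_0: "lin F \<Longrightarrow> F 0 = 0"
  using lin_add[of F 0 0] by simp

lemma lin_sum: "lin F \<Longrightarrow> F (\<Sum>i\<in>A. f i) = (\<Sum>i\<in>A. F (f i))"
  by (induction A rule: infinite_finite_induct) (simp_all add: lin_0 lin_add)

lemma lin_comp: "lin F \<Longrightarrow> lin G \<Longrightarrow> lin (\<lambda>p. F (G p))"
  by (simp add: lin_def)

lemma lin_plus_fun: "lin F \<Longrightarrow> lin G \<Longrightarrow> lin (F + G)"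
  by (simp add: lin_def algebra_simps)

lemma lin_zero: "lin (\<lambda>p. 0)"
  by (simp add: lin_def)

lemma lin_zero_fun: "lin 0"
  by (simp add: lin_def)

lemma lin_sum_fun: "(\<And>i. i \<in> A \<Longrightarrow> lin (F i)) \<Longrightarrow> lin (\<lambda>p. \<Sum>i\<in>A. F i p)"
  by (simp add: lin_def sum.distrib)

lemma lin_mult: "lin (\<lambda>p::'a::ring. a * p)" "lin (\<lambda>p::'a::ring. p * a)"
  by (simp_all add: lin_def algebra_simps)

lemma lin_square: "lin (\<lambda>p::pol. p^2)"
  by (simp add: lin_def pol_square_add)

lemma lin_ext_mon:
  fixes F G :: "pol \<Rightarrow> 'b::ab_group_add"
  assumes "lin F" "lin G" "\<And>e. F (mon e) = G (mon e)"
  shows "F p = G p"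
proof -
  have "F p = (\<Sum>e\<in>keys p. F (mon e))"
    by (subst pol_eq_sum_mon[of p]) (simp add: lin_sum[OF assms(1)])
  also have "\<dots> = G p"
    by (subst (2) pol_eq_sum_mon[of p]) (simp add: lin_sum[OF assms(2)] assms(3))
  finally show ?thesis .
qed

definition lift :: "((ix \<Rightarrow> nat) \<Rightarrow> 'b::ab_group_add) \<Rightarrow> pol \<Rightarrow> 'b" where
  "lift \<phi> p = (\<Sum>e\<in>keys p. \<phi> e)"

lemma lift_mon [simp]: "lift \<phi> (mon e) = \<phi> e"
  by (simp add: lift_def)

lemma lin_lift:
  fixes \<phi> :: "(ix \<Rightarrow> nat) \<Rightarrow> 'b::ab_group_add"
  assumes "\<And>x::'b. x + x = 0"
  shows "lin (lift \<phi>)"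
proof (rule linI)
  fix p q :: pol
  let ?S = "keys p \<union> keys q"
  have lift_eq: "lift \<phi> r = (\<Sum>e\<in>?S. if lookup r e = 1 then \<phi> e else 0)" if "keys r \<subseteq> ?S" for r
  proof -
    have "lift \<phi> r = (\<Sum>e\<in>keys r. if lookup r e = 1 then \<phi> e else 0)"
      unfolding lift_def by (rule sum.cong) (auto simp: in_keys_iff)
    also have "\<dots> = (\<Sum>e\<in>?S. if lookup r e = 1 then \<phi> e else 0)"
      by (rule sum.mono_neutral_left) (use that in \<open>auto simp: in_keys_iff\<close>)
    finally show ?thesis .
  qed
  have *: "(if a + b = 1 then x else 0) = (if a = 1 then x else 0) + (if b = 1 then x else (0::'b))"
    for a b :: bit and x
    using assms by (cases a; cases b) simp_all
  show "lift \<phi> (p + q) = lift \<phi> p + lift \<phi> q"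
    using keys_add[of p q] by (simp add: lift_eq lookup_add * sum.distrib)
qed

lemma lin_lift_bit: "lin (lift \<phi> :: pol \<Rightarrow> bit)"
  by (rule lin_lift) simp

definition subst :: "(ix \<Rightarrow> pol) \<Rightarrow> pol \<Rightarrow> pol" where
  "subst y = lift (\<lambda>e. \<Prod>i\<in>UNIV. y i ^ e i)"

lemma lin_subst: "lin (subst y)"
  unfolding subst_def by (rule lin_lift) simp

lemma subst_mon: "subst y (mon e) = (\<Prod>i\<in>UNIV. y i ^ e i)"
  by (simp add: subst_def)

lemma subst_X [simp]: "subst y (X i) = y i"
proof -
  have "(\<Prod>j\<in>UNIV. y j ^ unit i j) = (\<Prod>j\<in>UNIV. if i = j then y j else 1)"
    by (rule prod.cong) (auto simp: unit_def)
  then show ?thesis by (simp add: X_def subst_mon)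
qed

lemma subst_add: "subst y (p + q) = subst y p + subst y q"
  by (rule lin_add[OF lin_subst])

lemma subst_sum: "subst y (\<Sum>i\<in>A. f i) = (\<Sum>i\<in>A. subst y (f i))"
  by (rule lin_sum[OF lin_subst])

lemma subst_1 [simp]: "subst y 1 = 1"
  using subst_mon[of y 0] by simp

lemma subst_mult: "subst y (p * q) = subst y p * subst y q"
proof (rule lin_ext_mon[of "\<lambda>p. subst y (p * q)" "\<lambda>p. subst y p * subst y q"])
  fix e
  show "subst y (mon e * q) = subst y (mon e) * subst y q"
  proof (rule lin_ext_mon[of "\<lambda>q. subst y (mon e * q)" "\<lambda>q. subst y (mon e) * subst y q"])
    fix f
    show "subst y (mon e * mon f) = subst y (mon e) * subst y (mon f)"
      by (simp add: subst_mon power_add prod.distrib flip: mon_add)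
  qed (simp_all add: lin_def subst_add algebra_simps)
qed (simp_all add: lin_def subst_add algebra_simps)

lemma subst_power: "subst y (p ^ n) = subst y p ^ n"
  by (induction n) (simp_all add: subst_mult)

lemma subst_prod: "subst y (\<Prod>i\<in>A. f i) = (\<Prod>i\<in>A. subst y (f i))"
  by (induction A rule: infinite_finite_induct) (simp_all add: subst_mult)

lemma subst_subst: "subst y (subst z p) = subst (\<lambda>i. subst y (z i)) p"
  by (rule lin_ext_mon[OF lin_comp[OF lin_subst lin_subst] lin_subst])
    (simp add: subst_mon subst_prod subst_power)

definition Sq :: "pol \<Rightarrow> pol" where
  "Sq = subst (\<lambda>i. X i + X i ^ 2)"

definition lform :: "ix set \<Rightarrow> pol" where
  "lform A = (\<Sum>i\<in>A. X i)"

definition lsub :: "(ix \<Rightarrow> ix set) \<Rightarrow> pol \<Rightarrow> pol" where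
  "lsub M = subst (\<lambda>i. lform (M i))"

lemmas Sq_sum = subst_sum[of "\<lambda>i. X i + X i ^ 2", folded Sq_def]
  and Sq_mult = subst_mult[of "\<lambda>i. X i + X i ^ 2", folded Sq_def]
  and Sq_power = subst_power[of "\<lambda>i. X i + X i ^ 2", folded Sq_def]
  and Sq_prod = subst_prod[of "\<lambda>i. X i + X i ^ 2", folded Sq_def]
  and Sq_1 [simp] = subst_1[of "\<lambda>i. X i + X i ^ 2", folded Sq_def]
  and Sq_X [simp] = subst_X[of "\<lambda>i. X i + X i ^ 2", folded Sq_def]
  and lin_Sq = lin_subst[of "\<lambda>i. X i + X i ^ 2", folded Sq_def]

lemmas lsub_sum = subst_sum[of "\<lambda>i. lform (M i)" for M, folded lsub_def]
  and lsub_mult = subst_mult[of "\<lambda>i. lform (M i)" for M, folded lsub_def]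
  and lsub_power = subst_power[of "\<lambda>i. lform (M i)" for M, folded lsub_def]
  and lsub_prod = subst_prod[of "\<lambda>i. lform (M i)" for M, folded lsub_def]
  and lsub_1 [simp] = subst_1[of "\<lambda>i. lform (M i)" for M, folded lsub_def]
  and lsub_X [simp] = subst_X[of "\<lambda>i. lform (M i)" for M, folded lsub_def]
  and lin_lsub = lin_subst[of "\<lambda>i. lform (M i)" for M, folded lsub_def]

lemma Sq_lform: "Sq (lform A) = lform A + lform A ^ 2"
  by (simp add: lform_def Sq_sum pol_square_sum sum.distrib)

lemma Sq_lsub: "Sq (lsub M p) = lsub M (Sq p)"
  unfolding Sq_def lsub_def subst_subst
  by (simp add: Sq_lform[unfolded Sq_def] subst_add subst_power)

definition supported :: "nat \<Rightarrow> (pol \<Rightarrow> bit) \<Rightarrow> bool" where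
  "supported n F \<longleftrightarrow> (\<forall>e. tot e \<noteq> n \<longrightarrow> F (mon e) = 0)"

lemma supportedD: "supported n F \<Longrightarrow> tot e \<noteq> n \<Longrightarrow> F (mon e) = 0"
  by (simp add: supported_def)

lemma supported_eq_0:
  assumes "lin F" "supported n F" "\<And>e. e \<in> keys p \<Longrightarrow> tot e \<noteq> n"
  shows "F p = 0"
proof -
  have "F p = (\<Sum>e\<in>keys p. F (mon e))"
    by (subst pol_eq_sum_mon[of p]) (simp add: lin_sum[OF assms(1)])
  also have "\<dots> = 0"
    using assms(2,3) by (intro sum.neutral) (auto simp: supported_def)
  finally show ?thesis .
qed

text \<open>The degree-n functionals invariant under the total square are those killed by all positive squares.\<close>

definition pa :: "nat \<Rightarrow> (pol \<Rightarrow> bit) set" where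
  "pa n = {F. lin F \<and> supported n F \<and> (\<forall>p. F (Sq p) = F p)}"

definition highdeg :: "nat \<Rightarrow> pol \<Rightarrow> bool" where
  "highdeg n p \<longleftrightarrow> (\<forall>e\<in>keys p. n < tot e)"

definition lowdeg :: "nat \<Rightarrow> pol \<Rightarrow> bool" where
  "lowdeg n p \<longleftrightarrow> (\<forall>e\<in>keys p. tot e < n)"

lemma highdeg_add: "highdeg n p \<Longrightarrow> highdeg n q \<Longrightarrow> highdeg n (p + q)"
  using keys_add[of p q] by (auto simp: highdeg_def)

lemma lowdeg_add: "lowdeg n p \<Longrightarrow> lowdeg n q \<Longrightarrow> lowdeg n (p + q)"
  using keys_add[of p q] by (auto simp: lowdeg_def)

lemma highdeg_mult: "highdeg n p \<Longrightarrow> highdeg n (p * q)"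
  using keys_mult[of p q] by (fastforce simp: highdeg_def)

lemma highdeg_mon_mult: "highdeg n p \<Longrightarrow> highdeg (tot e + n) (mon e * p)"
  using keys_mult[of "mon e" p] by (fastforce simp: highdeg_def)

lemma lowdeg_mult: "lowdeg n p \<Longrightarrow> lowdeg m q \<Longrightarrow> lowdeg (n + m) (p * q)"
  using keys_mult[of p q] by (fastforce simp: lowdeg_def)

lemma lowdeg_mon_mult: "lowdeg n p \<Longrightarrow> lowdeg (tot e + n) (mon e * p)"
  using keys_mult[of "mon e" p] by (fastforce simp: lowdeg_def)

definition sandwich :: "(ix \<Rightarrow> nat) \<Rightarrow> pol \<Rightarrow> bool" where
  "sandwich e r \<longleftrightarrow> highdeg 0 (r + 1) \<and> lowdeg (tot e) (r + mon e)"

lemma sandwich_0: "sandwich 0 1"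
  by (simp add: sandwich_def highdeg_def lowdeg_def)

lemma sandwich_unit: "sandwich (unit i) (1 + X i)"
proof -
  have "1 + X i + X i = 1" "1 + X i + 1 = X i"
    by (simp_all add: algebra_simps)
  then show ?thesis
    by (simp add: sandwich_def highdeg_def lowdeg_def X_def)
qed

lemma sandwich_mult:
  assumes "sandwich e r" "sandwich f s"
  shows "sandwich (e + f) (r * s)"
proof -
  have "r * s + 1 = (r + 1) * s + (s + 1)" by (simp add: algebra_simps)
  moreover have "highdeg 0 ((r + 1) * s + (s + 1))"
    using assms by (intro highdeg_add[of 0 "(r + 1) * s"] highdeg_mult) (simp_all add: sandwich_def)
  moreover have "r * s + mon (e + f) = (r + mon e) * (s + mon f) + (mon f * (r + mon e) + mon e * (s + mon f))"
    by (simp add: algebra_simps mon_add)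
  moreover have "lowdeg (tot e + tot f) ((r + mon e) * (s + mon f))"
    using assms by (intro lowdeg_mult) (simp_all only: sandwich_def)
  moreover have "lowdeg (tot e + tot f) (mon f * (r + mon e))" "lowdeg (tot e + tot f) (mon e * (s + mon f))"
    using assms lowdeg_mon_mult[of "tot e" "r + mon e" f] lowdeg_mon_mult[of "tot f" "s + mon f" e]
    by (simp_all only: sandwich_def add.commute)
  ultimately show ?thesis by (simp only: sandwich_def tot_add lowdeg_add)
qed

lemma sandwich_scale:
  assumes "sandwich e r"
  shows "sandwich (\<lambda>i. n * e i) (r ^ n)"
proof (induction n)
  case 0
  have "(\<lambda>i. 0 * e i) = 0" by (simp add: fun_eq_iff)
  then show ?case using sandwich_0 by simp
next
  case (Suc n)
  have "(\<lambda>i. Suc n * e i) = e + (\<lambda>i. n * e i)" by (simp add: fun_eq_iff)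
  then show ?case using sandwich_mult[OF assms Suc] by simp
qed

lemma sandwich_sum:
  "finite A \<Longrightarrow> (\<And>i. i \<in> A \<Longrightarrow> sandwich (f i) (r i)) \<Longrightarrow> sandwich (\<Sum>i\<in>A. f i) (\<Prod>i\<in>A. r i)"
  by (induction A rule: finite_induct) (simp_all add: sandwich_0 sandwich_mult del: plus_fun_apply)

lemma Sq_mon: obtains r where "Sq (mon e) = mon e * r" "sandwich e r"
proof
  show "Sq (mon e) = mon e * (\<Prod>i\<in>UNIV. (1 + X i) ^ e i)"
    unfolding mon_eq_prod[of e] Sq_prod Sq_power Sq_X prod.distrib[symmetric] power_mult_distrib[symmetric]
    by (simp add: algebra_simps power2_eq_square)
  have e: "(\<Sum>i\<in>UNIV. (\<lambda>j. e i * unit i j)) = e"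
    by (simp add: fun_eq_iff sum_fun_apply unit_def if_distrib cong: if_cong)
  have "sandwich (\<Sum>i\<in>UNIV. (\<lambda>j. e i * unit i j)) (\<Prod>i\<in>UNIV. (1 + X i) ^ e i)"
    by (intro sandwich_sum sandwich_scale sandwich_unit) simp
  then show "sandwich e (\<Prod>i\<in>UNIV. (1 + X i) ^ e i)" by (simp only: e)
qed

lemma highdeg_Sq_mon: "highdeg (tot e) (Sq (mon e) + mon e)"
proof -
  obtain r where r: "Sq (mon e) = mon e * r" "sandwich e r" by (rule Sq_mon)
  have "Sq (mon e) + mon e = mon e * (r + 1)" by (simp add: r algebra_simps)
  then show ?thesis using highdeg_mon_mult[of 0 "r + 1" e] r(2) by (simp add: sandwich_def)
qed

lemma lowdeg_Sq_mon: "lowdeg (2 * tot e) (Sq (mon e) + mon e ^ 2)"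
proof -
  obtain r where r: "Sq (mon e) = mon e * r" "sandwich e r" by (rule Sq_mon)
  have "Sq (mon e) + mon e ^ 2 = mon e * (r + mon e)" by (simp add: r algebra_simps power2_eq_square)
  then show ?thesis using lowdeg_mon_mult[of "tot e" "r + mon e" e] r(2) by (simp add: sandwich_def mult_2)
qed

lemma Sq_cancel:
  assumes "lin H" "supported n H" "\<And>p. H (Sq p) = 0"
  shows "H p = 0"
proof (rule lin_ext_mon[OF assms(1) lin_zero])
  fix e
  show "H (mon e) = 0"
  proof (cases "tot e = n")
    case True
    have "H (Sq (mon e) + mon e) = 0"
      using highdeg_Sq_mon[of e] True
      by (intro supported_eq_0[OF assms(1,2)]) (auto simp: highdeg_def)
    then show ?thesis using assms(3)[of "mon e"] by (simp add: lin_add[OF assms(1)])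
  qed (rule supportedD[OF assms(2)])
qed

section \<open>Halving the exponents\<close>

definition xs :: "ix set \<Rightarrow> pol" where
  "xs S = (\<Prod>i\<in>S. X i)"

lemma xs_empty [simp]: "xs {} = 1"
  by (simp add: xs_def)

lemma xs_insert: "i \<notin> S \<Longrightarrow> xs (insert i S) = X i * xs S"
  by (simp add: xs_def)

lemma xs_square_mon: "xs S * mon m ^ 2 = mon (\<lambda>j. of_bool (j \<in> S) + 2 * m j)"
proof -
  have "mon (\<lambda>j. of_bool (j \<in> S)) = (\<Prod>j\<in>UNIV. if j \<in> S then X j else 1)"
    unfolding mon_eq_prod by (rule prod.cong) auto
  also have "\<dots> = xs S"
    by (simp add: xs_def prod.If_cases)
  finally have "xs S * mon m ^ 2 = mon ((\<lambda>j. of_bool (j \<in> S)) + (\<lambda>j. 2 * m j))"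
    by (simp only: mon_add mon_scale)
  then show ?thesis by (simp add: plus_fun_def)
qed

lemma mon_eq_xs_square: "mon e = xs {j. odd (e j)} * mon (\<lambda>j. e j div 2) ^ 2"
proof -
  have "(\<lambda>j. of_bool (odd (e j)) + 2 * (e j div 2)) = e"
    by (simp add: fun_eq_iff flip: of_bool_odd_eq_mod_2)
  then show ?thesis by (simp add: xs_square_mon)
qed

lemma tot_xs_square: "tot (\<lambda>j. of_bool (j \<in> S) + 2 * m j) = card S + 2 * tot m"
  by (simp add: tot_def sum.distrib sum_distrib_left of_bool_def sum.If_cases)

lemma lin_ext_xs:
  fixes F G :: "pol \<Rightarrow> 'b::ab_group_add"
  assumes "lin F" "lin G" "\<And>S m. F (xs S * mon m ^ 2) = G (xs S * mon m ^ 2)"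
  shows "F = G"
proof
  fix p
  show "F p = G p"
  proof (rule lin_ext_mon[OF assms(1,2)])
    show "F (mon e) = G (mon e)" for e
      by (subst (1 2) mon_eq_xs_square) (rule assms(3))
  qed
qed

lemma supported_xs_square:
  assumes "lin F" "supported n F" "card S + 2 * tot m \<noteq> n"
  shows "F (xs S * mon m ^ 2) = 0"
  using assms(3) supportedD[OF assms(2)] by (simp add: xs_square_mon tot_xs_square)

lemma card_compl: "card (- {i::ix}) = 3"
  by (cases i) (simp_all add: Compl_eq_Diff_UNIV UNIV_ix card_Diff_singleton_if)

lemma card_3_compl: "card (S::ix set) = 3 \<Longrightarrow> \<exists>i. S = - {i}"
proof -
  assume "card S = 3"
  then have "card (- S) = 1"
    using card_Un_disjoint[of S "- S"] by (simp add: UNIV_ix)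
  then obtain i where "- S = {i}" by (auto simp: card_1_singleton_iff)
  then show ?thesis by (metis double_complement)
qed

text \<open>The functional whose restriction to the part of polynomials divisible by exactly three odd
  powers is given by the four functionals G i, where i is the missing variable.\<close>

definition cons :: "(ix \<Rightarrow> pol \<Rightarrow> bit) \<Rightarrow> pol \<Rightarrow> bit" where
  "cons G = lift (\<lambda>e. \<Sum>i\<in>UNIV. if {j. odd (e j)} = - {i} then G i (mon (\<lambda>j. e j div 2)) else 0)"

lemma lin_cons: "lin (cons G)"
  unfolding cons_def by (rule lin_lift_bit)

lemma cons_xs_square:
  assumes "\<And>i. lin (G i)"
  shows "cons G (xs S * p^2) = (\<Sum>i\<in>UNIV. if S = - {i} then G i p else 0)"
proof (rule lin_ext_mon)
  show "lin (\<lambda>p. cons G (xs S * p^2))"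
    by (intro lin_comp[OF lin_cons] lin_comp[OF lin_mult(1) lin_square])
  show "lin (\<lambda>p. \<Sum>i\<in>UNIV. if S = - {i} then G i p else 0)"
    using assms by (intro lin_sum_fun) (simp add: lin_def)
  fix m :: "ix \<Rightarrow> nat"
  have "{j. odd (of_bool (j \<in> S) + 2 * m j)} = S" "(\<lambda>j. (of_bool (j \<in> S) + 2 * m j) div 2) = m"
    by (auto simp: of_bool_def)
  then show "cons G (xs S * mon m ^ 2) = (\<Sum>i\<in>UNIV. if S = - {i} then G i (mon m) else 0)"
    unfolding xs_square_mon cons_def lift_mon by (simp only:)
qed

lemma cons_xs_compl:
  assumes "\<And>i. lin (G i)"
  shows "cons G (xs (- {i}) * p^2) = G i p"
  using cons_xs_square[of G "- {i}" p, OF assms] by (simp add: eq_commute[of i])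

lemma cons_xs_other:
  assumes "\<And>i. lin (G i)" "card S \<noteq> 3"
  shows "cons G (xs S * p^2) = 0"
proof -
  have "S \<noteq> - {i}" for i using assms(2) card_compl[of i] by metis
  then show ?thesis using cons_xs_square[of G S p, OF assms(1)] by simp
qed

definition comp :: "ix \<Rightarrow> (pol \<Rightarrow> bit) \<Rightarrow> pol \<Rightarrow> bit" where
  "comp i F p = F (xs (- {i}) * p^2)"

lemma comp_cons: "(\<And>i. lin (G i)) \<Longrightarrow> comp i (cons G) = G i"
  by (simp add: fun_eq_iff comp_def cons_xs_compl)

lemma lin_comp_ix: "lin F \<Longrightarrow> lin (comp i F)"
  unfolding comp_def by (rule lin_comp[of F, OF _ lin_comp[OF lin_mult(1) lin_square]])

lemma Sq_xs_square: "Sq (xs S * p^2) = (\<Sum>T\<in>Pow S. xs (S - T) * (xs T * Sq p)^2)"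
proof -
  have "Sq (xs S * p^2) = (\<Prod>i\<in>S. X i ^ 2 + X i) * Sq p ^ 2"
    by (simp add: Sq_mult Sq_power xs_def Sq_prod add.commute)
  also have "(\<Prod>i\<in>S. X i ^ 2 + X i) = (\<Sum>T\<in>Pow S. (\<Prod>i\<in>T. X i ^ 2) * (\<Prod>i\<in>S - T. X i))"
    by (rule prod_add) simp
  finally show ?thesis
    by (simp add: xs_def sum_distrib_right sum_distrib_left power_mult_distrib prod_power_distrib algebra_simps)
qed

lemma cons_Sq:
  assumes "\<And>i. lin (G i)"
  shows "cons G (Sq (xs S * p^2)) = (\<Sum>i\<in>UNIV. if - {i} \<subseteq> S then G i (xs (S \<inter> {i}) * Sq p) else 0)"
proof -
  have "cons G (Sq (xs S * p^2)) = (\<Sum>T\<in>Pow S. \<Sum>i\<in>UNIV. if S - T = - {i} then G i (xs T * Sq p) else 0)"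
    by (simp add: Sq_xs_square lin_sum[OF lin_cons] cons_xs_square[OF assms])
  also have "\<dots> = (\<Sum>i\<in>UNIV. \<Sum>T\<in>Pow S. if S - T = - {i} then G i (xs T * Sq p) else 0)"
    by (rule sum.swap)
  also have "\<dots> = (\<Sum>i\<in>UNIV. \<Sum>T\<in>Pow S. if T = S \<inter> {i} then (if - {i} \<subseteq> S then G i (xs (S \<inter> {i}) * Sq p) else 0) else 0)"
    by (intro sum.cong) (auto split: if_splits)
  also have "\<dots> = (\<Sum>i\<in>UNIV. if - {i} \<subseteq> S then G i (xs (S \<inter> {i}) * Sq p) else 0)"
    by (subst sum.delta) auto
  finally show ?thesis .
qed

lemma cons_Sq_compl:
  assumes "\<And>i. lin (G i)"
  shows "cons G (Sq (xs (- {i}) * p^2)) = G i (Sq p)"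
  by (subst cons_Sq[OF assms]) (simp add: eq_commute[of _ i])

lemma cons_Sq_UNIV:
  assumes "\<And>i. lin (G i)"
  shows "cons G (Sq (xs UNIV * p^2)) = (\<Sum>i\<in>UNIV. G i (X i * Sq p))"
  by (subst cons_Sq[OF assms]) (simp add: xs_insert)

definition step :: "(pol \<Rightarrow> bit) set \<Rightarrow> (pol \<Rightarrow> bit) set" where
  "step B = {cons G | G. (\<forall>i. G i \<in> B) \<and> (\<forall>p. (\<Sum>i\<in>UNIV. G i (X i * p)) = 0)}"

lemma paD: "F \<in> pa n \<Longrightarrow> lin F" "F \<in> pa n \<Longrightarrow> supported n F" "F \<in> pa n \<Longrightarrow> F (Sq p) = F p"
  by (auto simp: pa_def)

lemma step_pa:
  assumes "F \<in> step (pa d)"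
  shows "F \<in> pa (2 * d + 3)"
proof -
  obtain G where F: "F = cons G" and G: "\<And>i. G i \<in> pa d" and rel: "\<And>p. (\<Sum>i\<in>UNIV. G i (X i * p)) = 0"
    using assms by (auto simp: step_def)
  have linG: "lin (G i)" for i using G by (rule paD)
  have "supported (2 * d + 3) (cons G)"
    unfolding supported_def
  proof (intro allI impI)
    fix e :: "ix \<Rightarrow> nat"
    let ?S = "{j. odd (e j)}" and ?m = "\<lambda>j. e j div 2"
    assume e: "tot e \<noteq> 2 * d + 3"
    have e': "(\<lambda>j. of_bool (j \<in> ?S) + 2 * ?m j) = e"
      by (simp add: fun_eq_iff flip: of_bool_odd_eq_mod_2)
    have "cons G (xs ?S * mon ?m ^ 2) = 0"
    proof (cases "card ?S = 3")
      case True
      then have "tot ?m \<noteq> d" using e tot_xs_square[of ?S ?m] unfolding e' by simp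
      then show ?thesis
        by (subst cons_xs_square[OF linG]) (auto intro!: sum.neutral supportedD[OF paD(2)[OF G]])
    qed (rule cons_xs_other[OF linG])
    then show "cons G (mon e) = 0" by (simp add: mon_eq_xs_square[of e])
  qed
  moreover have "(\<lambda>p. cons G (Sq p)) = cons G"
  proof (rule lin_ext_xs[OF lin_comp[OF lin_cons lin_Sq] lin_cons])
    fix S :: "ix set" and m :: "ix \<Rightarrow> nat"
    consider (compl) i where "S = - {i}" | (UNIV) "S = UNIV" | (small) "card S \<noteq> 3" "\<And>i. \<not> - {i} \<subseteq> S"
    proof (cases "\<exists>i. - {i} \<subseteq> S")
      case True
      then obtain i where "- {i} \<subseteq> S" by blast
      then have "S = - {i} \<or> S = UNIV" by (cases "i \<in> S") auto
      then show ?thesis using that by blast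
    next
      case False
      then have "card S \<noteq> 3" using card_3_compl[of S] by (metis order_refl)
      then show ?thesis using that(3) False by blast
    qed
    then show "cons G (Sq (xs S * mon m ^ 2)) = cons G (xs S * mon m ^ 2)"
    proof cases
      case compl
      then show ?thesis by (simp add: cons_Sq_compl[OF linG] cons_xs_compl[OF linG] paD(3)[OF G])
    next
      case UNIV
      have "cons G (xs UNIV * mon m ^ 2) = 0"
        by (rule cons_xs_other[OF linG]) (simp add: UNIV_ix)
      then show ?thesis by (simp add: UNIV cons_Sq_UNIV[OF linG] rel)
    next
      case small
      then show ?thesis by (simp add: cons_xs_other[OF linG] cons_Sq[OF linG])
    qed
  qed
  then have "cons G (Sq p) = cons G p" for p by (rule fun_cong)
  ultimately show ?thesis by (simp add: pa_def F lin_cons)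
qed

lemma pol_frobenius: "((p::pol) + q) ^ (2 ^ k) = p ^ (2 ^ k) + q ^ (2 ^ k)"
  by (induction k) (simp_all add: power_mult pol_square_add mult.commute[of 2])

lemma power_X: "X i ^ n = mon (\<lambda>j. n * unit i j)"
  by (simp add: X_def mon_scale)

lemma tot_scale: "tot (\<lambda>j. n * e j) = n * tot e"
  by (simp add: tot_def sum_distrib_left)

text \<open>Telescoping along x, x^2, x^4, ... moves a square onto a power of x that has the wrong degree.\<close>

lemma pa_X_square_eq_0:
  assumes F: "F \<in> pa (2 * d + 1)" and d: "\<And>k. d + 1 \<noteq> 2 ^ k"
  shows "F (X i * mon m ^ 2) = 0"
proof (cases "tot m = d")
  case False
  have "X i = xs {i}" by (simp add: xs_def)
  then show ?thesis using supported_xs_square[OF paD(1,2)[OF F], of "{i}" m] False by simp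
next
  case True
  define A where "A k = F (X i ^ (2 ^ k) * Sq (mon m))" for k :: nat
  have "A k = A (Suc k)" for k
  proof -
    have "A k + A (Suc k) = F (Sq (X i ^ (2 ^ k) * mon m))"
      by (simp add: A_def Sq_mult Sq_power pol_frobenius lin_add[OF paD(1)[OF F]] algebra_simps flip: power_mult power_add)
    also have "\<dots> = F (X i ^ (2 ^ k) * mon m)" by (rule paD(3)[OF F])
    also have "\<dots> = 0"
    proof -
      have "2 ^ k \<noteq> d + 1" using d[of k] by metis
      then have "tot ((\<lambda>j. 2 ^ k * unit i j) + m) \<noteq> 2 * d + 1"
        unfolding tot_add tot_scale using True by simp
      then show ?thesis
        unfolding power_X mon_add[symmetric] by (rule supportedD[OF paD(2)[OF F]])
    qed
    finally show ?thesis by (simp add: bit_add_eq_0_iff)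
  qed
  then have A: "A 0 = A k" for k by (induction k) simp_all
  have "A (2 * d + 1) = 0"
    unfolding A_def
  proof (rule supported_eq_0[OF paD(1,2)[OF F]])
    fix e assume "e \<in> keys (X i ^ 2 ^ (2 * d + 1) * Sq (mon m))"
    then obtain f where "e = (\<lambda>j. 2 ^ (2 * d + 1) * unit i j) + f"
      using keys_mult[of "X i ^ 2 ^ (2 * d + 1)" "Sq (mon m)"] unfolding power_X by auto
    then have "2 ^ (2 * d + 1) \<le> tot e" by (simp only: tot_add tot_scale tot_unit)
    moreover have "2 * d + 1 < 2 ^ (2 * d + 1)" by (rule less_exp)
    ultimately show "tot e \<noteq> 2 * d + 1" by linarith
  qed
  then have "0 = F (X i * Sq (mon m))" using A[of "2 * d + 1"] by (simp add: A_def)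
  moreover have "F (X i * (Sq (mon m) + mon m ^ 2)) = 0"
    using lowdeg_mon_mult[OF lowdeg_Sq_mon[of m], of "unit i"] True
    by (intro supported_eq_0[OF paD(1,2)[OF F]]) (auto simp: lowdeg_def X_def)
  ultimately show ?thesis by (simp add: lin_add[OF paD(1)[OF F]] distrib_left)
qed

lemma stepI:
  assumes F: "F \<in> pa (2 * d + 3)" and X: "\<And>i m. F (X i * mon m ^ 2) = 0"
  shows "F \<in> step (pa d)"
proof -
  note linF = paD(1)[OF F] and supF = paD(2)[OF F]
  define G where "G i = comp i F" for i
  have linG: "lin (G i)" for i unfolding G_def by (rule lin_comp_ix[OF linF])
  have supp: "supported d (G i)" for i
    unfolding supported_def G_def comp_def
    using card_compl[of i] by (auto intro!: supported_xs_square[OF linF supF])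
  have F_eq: "F = cons G"
  proof (rule lin_ext_xs[OF linF lin_cons])
    fix S :: "ix set" and m :: "ix \<Rightarrow> nat"
    show "F (xs S * mon m ^ 2) = cons G (xs S * mon m ^ 2)"
    proof (cases "card S = 3")
      case True
      then obtain i where "S = - {i}" using card_3_compl by blast
      then show ?thesis by (simp add: cons_xs_compl[OF linG]) (simp add: G_def comp_def)
    next
      case False
      have "card S \<le> card (UNIV :: ix set)" by (intro card_mono) simp_all
      moreover have "card (UNIV :: ix set) = 4" by (simp add: UNIV_ix)
      ultimately have "card S = 1 \<or> even (card S)" using False by presburger
      then have "F (xs S * mon m ^ 2) = 0"
      proof
        assume "card S = 1"
        then obtain i where "S = {i}" by (auto simp: card_1_singleton_iff)
        then show ?thesis using X by (simp add: xs_def)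
      next
        assume "even (card S)"
        then show ?thesis by (intro supported_xs_square[OF linF supF]) presburger
      qed
      then show ?thesis by (simp add: cons_xs_other[OF linG False])
    qed
  qed
  have "G i (Sq p) = G i p" for i p
    using paD(3)[OF F, of "xs (- {i}) * p^2"] unfolding F_eq by (simp add: cons_Sq_compl[OF linG] cons_xs_compl[OF linG])
  then have "G i \<in> pa d" for i by (simp add: pa_def linG supp)
  moreover have "(\<Sum>i\<in>UNIV. G i (X i * p)) = 0" for p
  proof (rule Sq_cancel[where H = "\<lambda>p. \<Sum>i\<in>UNIV. G i (X i * p)" and n = "d - 1"])
    show "lin (\<lambda>p. \<Sum>i\<in>UNIV. G i (X i * p))"
      by (intro lin_sum_fun lin_comp[OF linG lin_mult(1)])
    show "supported (d - 1) (\<lambda>p. \<Sum>i\<in>UNIV. G i (X i * p))"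
      unfolding supported_def X_def mon_add[symmetric]
      by (auto intro!: sum.neutral supportedD[OF supp] simp del: plus_fun_apply)
    fix p
    have "card (UNIV :: ix set) \<noteq> 3" by (simp add: UNIV_ix)
    then show "(\<Sum>i\<in>UNIV. G i (X i * Sq p)) = 0"
      using paD(3)[OF F, of "xs UNIV * p^2"] unfolding F_eq
      by (simp add: cons_Sq_UNIV[OF linG] cons_xs_other[OF linG])
  qed
  ultimately show ?thesis unfolding step_def F_eq by blast
qed

lemma pa_step:
  assumes "F \<in> pa (2 * d + 3)" "\<And>k. d + 2 \<noteq> 2 ^ k"
  shows "F \<in> step (pa d)"
proof (rule stepI[OF assms(1)])
  show "F (X i * mon m ^ 2) = 0" for i m
    by (rule pa_X_square_eq_0[of F "d + 1"]) (use assms in \<open>simp_all add: add.commute eval_nat_numeral\<close>)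
qed

declare plus_fun_apply [simp del] zero_fun_apply [simp del]

lemmas fun_apply = plus_fun_apply zero_fun_apply

lemma fun_add_self [simp]: "(F :: 'a \<Rightarrow> bit) + F = 0"
  by (simp add: fun_eq_iff fun_apply)

lemma fun_double [simp]: "2 * (F :: 'a \<Rightarrow> bit) = 0"
  by (simp only: mult_2 fun_add_self)

lemma fun_add_left_self [simp]: "(F :: 'a \<Rightarrow> bit) + (F + G) = G"
  by (simp add: fun_eq_iff fun_apply)

lemma pa_0: "0 \<in> pa n"
  by (simp add: pa_def lin_def supported_def fun_apply)

lemma pa_add: "F \<in> pa n \<Longrightarrow> G \<in> pa n \<Longrightarrow> F + G \<in> pa n"
  by (simp add: pa_def supported_def lin_plus_fun fun_apply)

lemma cons_add: "cons (\<lambda>i. F i + G i) = cons F + cons G"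
  by (simp add: cons_def lift_def fun_eq_iff fun_apply flip: sum.distrib)
    (auto intro!: sum.cong simp: fun_apply)

lemma cons_0: "cons (\<lambda>i. 0) = 0"
  by (auto simp: cons_def lift_def fun_eq_iff fun_apply intro!: sum.neutral)

lemma comp_add: "comp i (F + G) = comp i F + comp i G"
  by (simp add: comp_def fun_eq_iff fun_apply)

lemma comp_0: "comp i 0 = 0"
  by (simp add: comp_def fun_eq_iff fun_apply)

lemma sum_UNIV_ix: "(\<Sum>i\<in>UNIV. f i) = f I0 + f I1 + f I2 + f I3"
  by (simp add: UNIV_ix algebra_simps)

lemma card_ix: "card (UNIV :: ix set) = 4"
  by (simp add: UNIV_ix)

lemma distinct_ix_UNIV: "distinct [i, j, k, l] \<Longrightarrow> {i, j, k, l} = (UNIV :: ix set)"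
  by (rule card_subset_eq) (simp_all add: card_ix)

lemma step_mono: "B \<subseteq> C \<Longrightarrow> step B \<subseteq> step C"
  unfolding step_def by blast

lemma cons_X_xs_square:
  assumes "\<And>j. lin (H j)"
  shows "cons H (X i * (xs S * p^2)) =
    (if S = UNIV then H i (X i * p) else 0) + (\<Sum>j\<in>UNIV. if S = - {i, j} \<and> i \<noteq> j then H j p else 0)"
proof (cases "i \<in> S")
  case True
  then have "X i * (xs S * p^2) = xs (S - {i}) * (X i * p)^2"
    using xs_insert[of i "S - {i}"] by (simp add: insert_absorb power2_eq_square algebra_simps)
  moreover have "S - {i} = - {j} \<longleftrightarrow> j = i \<and> S = UNIV" for j
    using True by auto
  moreover have "S \<noteq> - {i, j}" for j using True by auto
  ultimately show ?thesis
    by (cases "S = UNIV") (simp_all add: cons_xs_square[OF assms])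
next
  case False
  then have "X i * (xs S * p^2) = xs (insert i S) * p^2"
    by (simp add: xs_insert algebra_simps)
  moreover have "insert i S = - {j} \<longleftrightarrow> S = - {i, j} \<and> i \<noteq> j" for j
    using False by auto
  moreover have "S \<noteq> UNIV" using False by auto
  ultimately show ?thesis by (simp add: cons_xs_square[OF assms])
qed

lemma sum_X_cons_eq_0_iff:
  assumes "\<And>i j. lin (H i j)"
  shows "(\<forall>p. (\<Sum>i\<in>UNIV. cons (H i) (X i * p)) = 0) \<longleftrightarrow>
    (\<forall>i j. H i j = H j i) \<and> (\<forall>p. (\<Sum>i\<in>UNIV. H i i (X i * p)) = 0)"
    (is "?L \<longleftrightarrow> ?R")
proof -
  have eq: "(\<Sum>i\<in>UNIV. cons (H i) (X i * (xs S * p^2))) =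
    (if S = UNIV then (\<Sum>i\<in>UNIV. H i i (X i * p)) else 0)
     + (\<Sum>i\<in>UNIV. \<Sum>j\<in>UNIV. if S = - {i, j} \<and> i \<noteq> j then H i j p else 0)" for S p
    using assms by (subst cons_X_xs_square) (auto simp: sum.distrib)
  have pair: "(\<Sum>i\<in>UNIV. \<Sum>j\<in>UNIV. if - {a, b} = - {i, j} \<and> i \<noteq> j then H i j p else 0) = H a b p + H b a p"
    if "a \<noteq> b" for a b p
    using that by (cases a; cases b) (simp_all add: sum_UNIV_ix doubleton_eq_iff)
  show ?thesis
  proof
    assume L: ?L
    have "H a b = H b a" for a b
    proof (cases "a = b")
      case False
      have "H a b p + H b a p = 0" for p
      proof -
        have "- {a, b} \<noteq> UNIV" by auto
        then show ?thesis
          using eq[of "- {a, b}" p] L by (simp only: if_False pair[OF False] add_0 L[rule_format])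
      qed
      then show ?thesis by (simp add: bit_add_eq_0_iff fun_eq_iff fun_apply)
    qed simp
    moreover have "(\<Sum>i\<in>UNIV. H i i (X i * p)) = 0" for p
    proof -
      have "(UNIV::ix set) \<noteq> - {i, j}" for i j by auto
      then show ?thesis using eq[of UNIV p] L by simp
    qed
    ultimately show ?R by blast
  next
    assume R: ?R
    have "(\<lambda>p. \<Sum>i\<in>UNIV. cons (H i) (X i * p)) = (\<lambda>p. 0)"
    proof (rule lin_ext_xs)
      show "lin (\<lambda>p. \<Sum>i\<in>UNIV. cons (H i) (X i * p))"
        by (intro lin_sum_fun lin_comp[OF lin_cons lin_mult(1)])
      show "lin (\<lambda>p::pol. 0 :: bit)" by (rule lin_zero)
      fix S :: "ix set" and m
      show "(\<Sum>i\<in>UNIV. cons (H i) (X i * (xs S * mon m ^ 2))) = 0"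
      proof (cases "\<exists>a b. S = - {a, b} \<and> a \<noteq> b")
        case True
        then obtain a b where ab: "S = - {a, b}" "a \<noteq> b" by blast
        then have "S \<noteq> UNIV" by auto
        moreover have "H a b = H b a" using R by blast
        ultimately show ?thesis
          unfolding eq unfolding ab(1) pair[OF ab(2)] by (simp only: if_False add_0 bit_add_self)
      next
        case False
        then have "(\<Sum>i\<in>UNIV. \<Sum>j\<in>UNIV. if S = - {i, j} \<and> i \<noteq> j then H i j (mon m) else 0) = 0"
          by (intro sum.neutral ballI) auto
        then show ?thesis unfolding eq using R by simp
      qed
    qed
    then show ?L by (auto dest: fun_cong)
  qed
qed

definition SS :: "nat \<Rightarrow> nat \<Rightarrow> (pol \<Rightarrow> bit) set" where
  "SS d s = (step ^^ s) (pa d)"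

lemma SS_0 [simp]: "SS d 0 = pa d"
  by (simp add: SS_def)

lemma SS_Suc: "SS d (Suc s) = step (SS d s)"
  by (simp add: SS_def)

lemma SS_pa: "SS d r \<subseteq> pa (2 ^ r * (d + 3) - 3)"
proof (induction r)
  case (Suc r)
  have "3 \<le> 2 ^ r * (d + 3)" using mult_le_mono[of 1 "2 ^ r" 3 "d + 3"] by simp
  then have "2 * (2 ^ r * (d + 3) - 3) + 3 = 2 ^ Suc r * (d + 3) - 3" by simp
  moreover have "step (SS d r) \<subseteq> pa (2 * (2 ^ r * (d + 3) - 3) + 3)"
    using step_mono[OF Suc] step_pa by blast
  ultimately show ?case by (simp only: SS_Suc)
qed simp

lemma SS_lin: "F \<in> SS d s \<Longrightarrow> lin F"
  by (cases s) (auto simp: SS_Suc step_def lin_cons dest: paD)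

lemma SS_SucE:
  assumes "F \<in> SS d (Suc s)"
  shows "F = cons (\<lambda>i. comp i F)" "comp i F \<in> SS d s" "(\<Sum>i\<in>UNIV. comp i F (X i * p)) = 0"
proof -
  obtain G where G: "F = cons G" "\<And>i. G i \<in> SS d s" "\<And>p. (\<Sum>i\<in>UNIV. G i (X i * p)) = 0"
    using assms by (auto simp: SS_Suc step_def)
  have "comp i F = G i" for i
    unfolding G(1) by (rule comp_cons) (rule SS_lin[OF G(2)])
  then show "F = cons (\<lambda>i. comp i F)" "comp i F \<in> SS d s" "(\<Sum>i\<in>UNIV. comp i F (X i * p)) = 0"
    using G by simp_all
qed

lemma SS_SucI:
  assumes "\<And>i. G i \<in> SS d s" "\<And>p. (\<Sum>i\<in>UNIV. G i (X i * p)) = 0"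
  shows "cons G \<in> SS d (Suc s)"
  using assms by (auto simp: SS_Suc step_def)

lemma SS_add: "F \<in> SS d s \<Longrightarrow> G \<in> SS d s \<Longrightarrow> F + G \<in> SS d s"
proof (induction s arbitrary: F G)
  case (Suc s)
  note F = SS_SucE[OF Suc.prems(1)] and G = SS_SucE[OF Suc.prems(2)]
  have "F + G = cons (\<lambda>i. comp i F + comp i G)"
    by (subst F(1), subst G(1)) (rule cons_add[symmetric])
  moreover have "cons (\<lambda>i. comp i F + comp i G) \<in> SS d (Suc s)"
    using F(3) G(3) by (intro SS_SucI Suc.IH F(2) G(2)) (simp add: sum.distrib fun_apply)
  ultimately show ?case by simp
qed (simp add: pa_add)

lemma SS_0_mem: "0 \<in> SS d s"
proof (induction s)
  case (Suc s)
  then have "cons (\<lambda>i. 0) \<in> SS d (Suc s)" by (intro SS_SucI) (assumption, simp add: fun_apply)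
  then show ?case by (metis cons_0)
qed (simp add: pa_0)

lemma SS_sum: "(\<And>i. i \<in> A \<Longrightarrow> F i \<in> SS d s) \<Longrightarrow> (\<Sum>i\<in>A. F i) \<in> SS d s"
  by (induction A rule: infinite_finite_induct) (auto simp: SS_0_mem SS_add)

lemma SS_comp_comm:
  assumes F: "F \<in> SS d (Suc (Suc s))"
  shows "comp j (comp i F) = comp i (comp j F)" "(\<Sum>i\<in>UNIV. comp i (comp i F) (X i * p)) = 0"
proof -
  note 1 = SS_SucE[OF F]
  note 2 = SS_SucE[OF 1(2)]
  have "\<forall>p. (\<Sum>i\<in>UNIV. cons (\<lambda>j. comp j (comp i F)) (X i * p)) = 0"
    using 1(3) by (simp flip: 2(1))
  then have "(\<forall>i j. comp j (comp i F) = comp i (comp j F)) \<and> (\<forall>p. (\<Sum>i\<in>UNIV. comp i (comp i F) (X i * p)) = 0)"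
    using sum_X_cons_eq_0_iff[of "\<lambda>i j. comp j (comp i F)"] SS_lin[OF 2(2)] by blast
  then show "comp j (comp i F) = comp i (comp j F)" "(\<Sum>i\<in>UNIV. comp i (comp i F) (X i * p)) = 0"
    by blast+
qed

definition diag :: "(pol \<Rightarrow> bit) \<Rightarrow> pol \<Rightarrow> bit" where
  "diag F = cons (\<lambda>i. comp i (comp i F))"

lemma diag_SS: "F \<in> SS d (Suc (Suc s)) \<Longrightarrow> diag F \<in> SS d (Suc s)"
  unfolding diag_def by (intro SS_SucI SS_SucE(2) SS_comp_comm(2))

lemma diag_add: "diag (F + G) = diag F + diag G"
  by (simp add: diag_def comp_add cons_add)

lemma diag_0: "diag 0 = 0"
  by (simp add: diag_def comp_0 cons_0)

lemma comp_diag: "F \<in> SS d (Suc (Suc s)) \<Longrightarrow> comp i (diag F) = comp i (comp i F)"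
  unfolding diag_def by (rule comp_cons) (meson SS_SucE(2) SS_lin)

lemma SS_eq_0: "F \<in> SS d (Suc s) \<Longrightarrow> (\<And>i. comp i F = 0) \<Longrightarrow> F = 0"
  using SS_SucE(1)[of F d s] by (simp add: cons_0)

lemma pa_eq_0:
  assumes "H \<in> pa d" "0 < d" "\<And>i p. H (X i * p) = 0"
  shows "H = 0"
proof
  fix p
  show "H p = 0 p"
  proof (rule lin_ext_mon[OF paD(1)[OF assms(1)] lin_zero_fun])
    fix e
    show "H (mon e) = 0 (mon e)"
    proof (cases "e = 0")
      case True
      then show ?thesis using supportedD[OF paD(2)[OF assms(1)], of 0] assms(2) by (simp add: fun_apply)
    next
      case False
      then obtain i where i: "0 < e i" by (auto simp: fun_eq_iff fun_apply)
      then have "e = unit i + (\<lambda>j. e j - unit i j)" by (auto simp: fun_eq_iff fun_apply unit_def)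
      then have "mon e = X i * mon (\<lambda>j. e j - unit i j)" by (metis X_def mon_add)
      then show ?thesis using assms(3) by (simp add: fun_apply)
    qed
  qed
qed

lemma diag_eq_0:
  assumes F: "F \<in> SS d (Suc s)" and s: "3 \<le> s" and d: "0 < d" and D: "diag F = 0"
  shows "F = 0"
proof -
  obtain r where r: "s = Suc (Suc (Suc r))"
    using s by (metis Suc_le_D numeral_3_eq_3 Suc_le_mono)
  define w where "w i j k l = comp l (comp k (comp j (comp i F)))" for i j k l
  have F4: "F \<in> SS d (Suc (Suc (Suc (Suc r))))" using F r by simp
  note m1 = SS_SucE(2)[OF F4]
  note m2 = SS_SucE(2)[OF m1]
  note m3 = SS_SucE(2)[OF m2]
  have s1: "w i j k l = w j i k l" for i j k l
    unfolding w_def by (simp only: SS_comp_comm(1)[OF F4, of j i])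
  have s2: "w i j k l = w i k j l" for i j k l
    unfolding w_def by (simp only: SS_comp_comm(1)[OF m1, of k j])
  have s3: "w i j k l = w i j l k" for i j k l
    unfolding w_def by (simp only: SS_comp_comm(1)[OF m2, of l k])
  have z0: "w i i k l = 0" for i k l
    unfolding w_def comp_diag[OF F4, symmetric] D by (simp add: comp_0)
  have z: "w i j k l = 0" if "\<not> distinct [i, j, k, l]" for i j k l
  proof -
    have "i = j \<or> i = k \<or> i = l \<or> j = k \<or> j = l \<or> k = l" using that by auto
    then show ?thesis by (metis s1 s2 s3 z0)
  qed
  have w0: "w i j k l = 0" for i j k l
  proof (cases "distinct [i, j, k, l]")
    case True
    have sum0: "(\<Sum>l\<in>UNIV. w i j k l (X l * p)) = 0" for i j k p
      unfolding w_def by (rule SS_SucE(3)[OF m3])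
    have kill: "w i j k l (X l * p) = 0" if "distinct [i, j, k, l]" for i j k l p
    proof -
      have "w i j k i = 0" "w i j k j = 0" "w i j k k = 0" by (auto intro!: z)
      then show ?thesis
        using sum0[of i j k p] that
        by (cases i; cases j; cases k; cases l) (simp_all add: sum_UNIV_ix fun_apply)
    qed
    have perm: "w i j k l = w j k l i" "w i j k l = w i k l j" "w i j k l = w i j l k"
      by (metis s1 s2 s3)+
    have "w i j k l (X x * p) = 0" for x p
    proof -
      have "x = i \<or> x = j \<or> x = k \<or> x = l"
        using distinct_ix_UNIV[OF True] by auto
      moreover have "w j k l i (X i * p) = 0" "w i k l j (X j * p) = 0" "w i j l k (X k * p) = 0" "w i j k l (X l * p) = 0"
        using True by (auto intro!: kill)
      ultimately show ?thesis using perm by metis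
    qed
    moreover have "w i j k l \<in> pa ((2 ^ r) * (d + 3) - 3)" "0 < 2 ^ r * (d + 3) - 3"
    proof -
      show "w i j k l \<in> pa ((2 ^ r) * (d + 3) - 3)"
        unfolding w_def using SS_pa SS_SucE(2)[OF m3] by blast
      have "d + 3 \<le> 2 ^ r * (d + 3)" by simp
      then show "0 < 2 ^ r * (d + 3) - 3" using d by linarith
    qed
    ultimately show ?thesis using pa_eq_0 by blast
  qed (rule z)
  show ?thesis
    by (intro SS_eq_0[OF F4] SS_eq_0[OF m1] SS_eq_0[OF m2] SS_eq_0[OF m3]) (rule w0[unfolded w_def])
qed

definition E1 :: "ix set \<Rightarrow> (pol \<Rightarrow> bit) \<Rightarrow> pol \<Rightarrow> bit" where
  "E1 v h = cons (\<lambda>i. if i \<in> v then h else 0)"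

definition EE :: "nat \<Rightarrow> ix set \<Rightarrow> (pol \<Rightarrow> bit) \<Rightarrow> pol \<Rightarrow> bit" where
  "EE s v = E1 v ^^ s"

lemma EE_0 [simp]: "EE 0 v h = h"
  by (simp add: EE_def)

lemma EE_Suc: "EE (Suc s) v h = E1 v (EE s v h)"
  by (simp add: EE_def)

lemma EE_Suc_right: "EE (Suc s) v h = EE s v (E1 v h)"
  by (simp add: EE_def funpow_swap1)

lemma comp_E1: "lin h \<Longrightarrow> comp i (E1 v h) = (if i \<in> v then h else 0)"
  unfolding E1_def by (subst comp_cons) (auto simp: lin_zero_fun)

lemma E1_add: "E1 v (h + h') = E1 v h + E1 v h'"
  unfolding E1_def cons_add[symmetric] by (rule arg_cong[of _ _ cons]) auto

lemma E1_0: "E1 v 0 = 0"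
  by (simp add: E1_def cons_0)

lemma EE_add: "EE s v (h + h') = EE s v h + EE s v h'"
  by (induction s) (simp_all add: EE_Suc E1_add)

lemma EE_zero: "EE s v 0 = 0"
  by (induction s) (simp_all add: EE_Suc E1_0)

lemma EE_sum: "EE s v (\<Sum>i\<in>A. h i) = (\<Sum>i\<in>A. EE s v (h i))"
  by (induction A rule: infinite_finite_induct) (simp_all add: EE_zero EE_add)

lemma lin_EE: "lin h \<Longrightarrow> lin (EE s v h)"
  by (cases s) (simp_all add: EE_Suc E1_def lin_cons)

definition KK :: "nat \<Rightarrow> ix set \<Rightarrow> (pol \<Rightarrow> bit) set" where
  "KK d v = {h \<in> pa d. \<forall>p. h (lform v * p) = 0}"

lemma KKD: "h \<in> KK d v \<Longrightarrow> h \<in> pa d" "h \<in> KK d v \<Longrightarrow> h (lform v * p) = 0"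
  by (auto simp: KK_def)

lemma lin_lform: "lin h \<Longrightarrow> h (lform v * p) = (\<Sum>i\<in>v. h (X i * p))"
  by (simp add: lform_def sum_distrib_right lin_sum)

lemma sum_if_mem_ix: "(\<Sum>i\<in>UNIV. (if i \<in> v then h else 0) (X i * p)) = (\<Sum>i\<in>v. h (X i * p))"
  for v :: "ix set" and h :: "pol \<Rightarrow> bit"
proof -
  have "(\<Sum>i\<in>UNIV. (if i \<in> v then h else 0) (X i * p)) = (\<Sum>i\<in>UNIV. if i \<in> v then h (X i * p) else 0)"
    by (rule sum.cong) (auto simp: fun_apply)
  also have "\<dots> = (\<Sum>i\<in>v. h (X i * p))" by (simp add: sum.If_cases)
  finally show ?thesis .
qed

lemma E1_lform:
  assumes h: "lin h" "\<And>p. h (lform v * p) = 0"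
  shows "E1 v h (lform v * p) = 0"
proof -
  let ?H = "\<lambda>i j. if i \<in> v then if j \<in> v then h else 0 else 0"
  have lin: "lin (?H i j)" for i j using h(1) by (simp add: lin_zero_fun)
  have "?H i j = ?H j i" for i j by auto
  moreover have "(\<Sum>i\<in>UNIV. ?H i i (X i * p)) = 0" for p
    using h(2)[of p] by (simp add: lin_lform[OF h(1)] sum_if_mem_ix[symmetric] cong: if_cong)
  ultimately have "(\<Sum>i\<in>UNIV. cons (?H i) (X i * p)) = 0"
    using sum_X_cons_eq_0_iff[of ?H, OF lin] by blast
  moreover have "cons (?H i) = (if i \<in> v then E1 v h else 0)" for i
    by (auto simp: E1_def cons_0)
  ultimately have "(\<Sum>i\<in>UNIV. (if i \<in> v then E1 v h else 0) (X i * p)) = 0" by simp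
  then show ?thesis by (simp add: lin_lform[OF lin_cons[folded E1_def]] lin_lform sum_if_mem_ix E1_def lin_cons)
qed

lemma EE_lform: "lin h \<Longrightarrow> (\<And>p. h (lform v * p) = 0) \<Longrightarrow> EE s v h (lform v * p) = 0"
proof (induction s arbitrary: p)
  case (Suc s)
  then show ?case unfolding EE_Suc by (intro E1_lform lin_EE) auto
qed simp

lemma EE_SS:
  assumes "h \<in> KK d v"
  shows "EE s v h \<in> SS d s"
proof (induction s)
  case (Suc s)
  note h = paD(1)[OF KKD(1)[OF assms]]
  have "(\<Sum>i\<in>UNIV. (if i \<in> v then EE s v h else 0) (X i * p)) = 0" for p
    using EE_lform[OF h KKD(2)[OF assms]] by (simp add: sum_if_mem_ix lin_lform[OF lin_EE[OF h]])
  then show ?case unfolding EE_Suc E1_def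
    using Suc by (intro SS_SucI) (auto simp: SS_0_mem)
qed (simp add: KKD(1)[OF assms])

lemma diag_EE: "lin h \<Longrightarrow> diag (EE (Suc (Suc s)) v h) = EE (Suc s) v h"
proof -
  assume h: "lin h"
  have "comp i (comp i (EE (Suc (Suc s)) v h)) = (if i \<in> v then EE s v h else 0)" for i
  proof -
    have "lin (E1 v (EE s v h))" by (simp add: E1_def lin_cons)
    then show ?thesis using lin_EE[OF h, of s v] by (simp add: EE_Suc comp_E1 comp_0)
  qed
  then show ?thesis by (simp add: diag_def EE_Suc E1_def)
qed

section \<open>The Koszul complex\<close>

lemma sum_distinct_ix:
  assumes "distinct [i, j, k, l]"
  shows "(\<Sum>x\<in>UNIV. f x) = f i + f j + f k + f (l :: ix)"
proof -
  have "(\<Sum>x\<in>UNIV. f x) = (\<Sum>x\<in>{i, j, k, l}. f x)" by (simp only: distinct_ix_UNIV[OF assms])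
  then show ?thesis using assms by (simp add: add.assoc)
qed

lemma obtain_distinct_ix:
  obtains j k l where "distinct [i, j, k, l :: ix]"
proof (cases i)
  case I0 show ?thesis by (rule that[of I1 I2 I3]) (simp add: I0)
next
  case I1 show ?thesis by (rule that[of I0 I2 I3]) (simp add: I1)
next
  case I2 show ?thesis by (rule that[of I0 I1 I3]) (simp add: I2)
next
  case I3 show ?thesis by (rule that[of I0 I1 I2]) (simp add: I3)
qed

lemma obtain_distinct_ix2:
  assumes "i \<noteq> j"
  obtains k l where "distinct [i, j, k, l :: ix]"
proof -
  obtain a b c where "distinct [i, a, b, c]" by (rule obtain_distinct_ix)
  moreover from distinct_ix_UNIV[OF this] have "j = a \<or> j = b \<or> j = c" using assms UNIV_I[of j] by auto
  ultimately show ?thesis using that by (auto simp: eq_commute)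
qed

lemma lform_UNIV: "lform UNIV = X i + lform (- {i})"
  using sum.remove[of UNIV i X] by (simp add: lform_def Compl_eq_Diff_UNIV)

lemma lform_compl: "distinct [a, b, c, i] \<Longrightarrow> lform (- {i}) = X a + X b + X c"
proof -
  assume d: "distinct [a, b, c, i]"
  have "- {i} = {a, b, c}" using distinct_ix_UNIV[OF d] d by auto
  then show ?thesis using d by (simp add: lform_def add.assoc)
qed

lemma mon_induct [case_names one X]:
  assumes "P 1" "\<And>i m. P (X i * mon m)"
  shows "P (mon e)"
proof (cases "e = 0")
  case False
  then obtain i where i: "0 < e i" by (auto simp: fun_eq_iff zero_fun_apply)
  then have "e = unit i + (\<lambda>j. e j - unit i j)" by (auto simp: fun_eq_iff unit_def plus_fun_apply)
  then have "mon e = X i * mon (\<lambda>j. e j - unit i j)" by (metis X_def mon_add)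
  then show ?thesis using assms(2) by simp
qed (use assms(1) in simp)

lemma pa_relation_square:
  assumes f: "\<And>a. a \<in> A \<Longrightarrow> f a \<in> pa d" and rel: "\<And>p. (\<Sum>a\<in>A. f a (lform (v a) * p)) = 0"
  shows "(\<Sum>a\<in>A. f a (lform (v a) ^ 2 * p)) = 0"
proof (rule Sq_cancel[where H = "\<lambda>p. \<Sum>a\<in>A. f a (lform (v a) ^ 2 * p)" and n = "d - 2"])
  show "lin (\<lambda>p. \<Sum>a\<in>A. f a (lform (v a) ^ 2 * p))"
    by (intro lin_sum_fun) (auto intro: lin_comp[OF paD(1)[OF f] lin_mult(1)])
  have "f a (lform (v a) ^ 2 * mon e) = 0" if "a \<in> A" "tot e \<noteq> d - 2" for a e
  proof -
    note fa = f[OF that(1)]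
    have "X i ^ 2 * mon e = mon (unit i + (unit i + e))" for i
      by (simp add: X_def mon_add power2_eq_square algebra_simps)
    moreover have "f a (mon (unit i + (unit i + e))) = 0" for i
      using that(2) by (intro supportedD[OF paD(2)[OF fa]]) simp
    ultimately show ?thesis
      by (simp add: lform_def pol_square_sum sum_distrib_right lin_sum[OF paD(1)[OF fa]])
  qed
  then show "supported (d - 2) (\<lambda>p. \<Sum>a\<in>A. f a (lform (v a) ^ 2 * p))"
    by (simp add: supported_def)
  fix p
  have "(\<Sum>a\<in>A. f a (Sq (lform (v a) * p))) = 0"
    using rel[of p] by (simp add: paD(3)[OF f])
  then show "(\<Sum>a\<in>A. f a (lform (v a) ^ 2 * Sq p)) = 0"
    using rel[of "Sq p"] by (simp add: Sq_mult Sq_lform distrib_right lin_add[OF paD(1)[OF f]] sum.distrib)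
qed

lemma pa_relation_mult:
  assumes f: "f \<in> pa d" "g \<in> pa d" and rel: "\<And>p. g (lform v * p) = f (lform w * p)"
  shows "g (lform v * ((lform v + lform w) * p)) = 0"
proof -
  have "(\<Sum>a\<in>(UNIV::bool set). (if a then f else g) (lform (if a then w else v) ^ 2 * p)) = 0"
    by (rule pa_relation_square[where d = d]) (simp_all add: f UNIV_bool rel)
  then have "g (lform v ^ 2 * p) = f (lform w ^ 2 * p)"
    by (simp add: UNIV_bool bit_add_eq_0_iff)
  moreover have "f (lform w ^ 2 * p) = g (lform v * (lform w * p))"
    using rel[of "lform w * p"] by (simp add: power2_eq_square mult.assoc)
  ultimately show ?thesis
    by (simp add: distrib_right distrib_left lin_add[OF paD(1)[OF f(2)]] power2_eq_square mult.assoc)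
qed

lemma koszul_lift:
  assumes lin: "\<And>i. lin (N i)" and sym: "\<And>i j p. N i (X j * p) = N j (X i * p)"
  obtains h :: "pol \<Rightarrow> bit" where "lin h" "h 1 = 0" "\<And>i p. h (X i * p) = N i p"
proof
  define pick where "pick e = (SOME i. 0 < e i)" for e :: "ix \<Rightarrow> nat"
  define h where "h = lift (\<lambda>e. if e = 0 then 0 else N (pick e) (mon (\<lambda>j. e j - unit (pick e) j)))"
  show lin_h: "lin h" unfolding h_def by (rule lin_lift_bit)
  have "h (mon 0) = 0" unfolding h_def lift_mon by simp
  then show "h 1 = 0" by simp
  show "h (X i * p) = N i p" for i p
  proof (rule lin_ext_mon[OF lin_comp[OF lin_h lin_mult(1)] lin])
    fix m
    let ?e = "unit i + m"
    let ?k = "pick ?e"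
    have "0 < ?e i" by (simp add: plus_fun_apply unit_def)
    then have k: "0 < ?e ?k" unfolding pick_def by (rule someI)
    have ne: "?e \<noteq> 0" using \<open>0 < ?e i\<close> by (metis less_irrefl zero_fun_apply)
    have "h (X i * mon m) = N ?k (mon (\<lambda>j. ?e j - unit ?k j))"
      unfolding X_def mon_add[symmetric] h_def lift_mon by (simp only: ne if_False)
    also have "\<dots> = N i (mon m)"
    proof (cases "?k = i")
      case True
      have "(\<lambda>j. ?e j - unit i j) = m" by (simp add: fun_eq_iff plus_fun_apply)
      then show ?thesis by (simp only: True)
    next
      case False
      then have "0 < m ?k" using k by (simp add: plus_fun_apply unit_def split: if_splits)
      then have m: "m = unit ?k + (\<lambda>j. m j - unit ?k j)"
        by (auto simp: fun_eq_iff plus_fun_apply unit_def)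
      have "(\<lambda>j. ?e j - unit ?k j) = unit i + (\<lambda>j. m j - unit ?k j)"
        using False \<open>0 < m ?k\<close> by (auto simp: fun_eq_iff plus_fun_apply unit_def)
      then have "N ?k (mon (\<lambda>j. ?e j - unit ?k j)) = N ?k (X i * mon (\<lambda>j. m j - unit ?k j))"
        by (simp only: mon_add X_def)
      also have "\<dots> = N i (X ?k * mon (\<lambda>j. m j - unit ?k j))" by (rule sym)
      also have "X ?k * mon (\<lambda>j. m j - unit ?k j) = mon m"
        by (subst (3) m) (simp only: mon_add X_def)
      finally show ?thesis .
    qed
    finally show "h (X i * mon m) = N i (mon m)" .
  qed
qed

locale symmetric_family =
  fixes t :: "ix \<Rightarrow> ix \<Rightarrow> ix \<Rightarrow> pol \<Rightarrow> bit" and d :: nat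
  assumes t_pa: "t i j k \<in> pa d"
    and s1: "t i j k = t j i k" and s2: "t i j k = t i k j" and s3: "t i i j = t i j j"
    and c2: "(\<Sum>k\<in>UNIV. t i j k (X k * p)) = 0"
    and c0: "(\<Sum>i\<in>UNIV. t i i i (X i * p)) = 0"
    and d: "0 < d"
begin

lemmas lin_t = paD(1)[OF t_pa]

definition tt :: "ix \<Rightarrow> pol \<Rightarrow> bit" where
  "tt i = (case i of I0 \<Rightarrow> t I1 I2 I3 | I1 \<Rightarrow> t I0 I2 I3 | I2 \<Rightarrow> t I0 I1 I3 | I3 \<Rightarrow> t I0 I1 I2)"

lemma tt_pa: "tt i \<in> pa d"
  by (cases i) (simp_all add: tt_def t_pa)

lemmas lin_tt = paD(1)[OF tt_pa]

lemma tt: "distinct [a, b, c, i] \<Longrightarrow> t a b c = tt i"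
  by (cases a; cases b; cases c; cases i; simp add: tt_def; metis s1 s2)

lemma c2':
  assumes "distinct [i, j, k, l]"
  shows "t i j i (X i * p) + t i j j (X j * p) + tt l (X k * p) + tt k (X l * p) = 0"
    "t i i i (X i * p) + t i i j (X j * p) + t i i k (X k * p) + t i i l (X l * p) = 0"
    "t i i i (X i * p) + t j j j (X j * p) + t k k k (X k * p) + t l l l (X l * p) = 0"
proof -
  have "t i j k = tt l" "t i j l = tt k" using assms by (auto intro!: tt)
  then show "t i j i (X i * p) + t i j j (X j * p) + tt l (X k * p) + tt k (X l * p) = 0"
    "t i i i (X i * p) + t i i j (X j * p) + t i i k (X k * p) + t i i l (X l * p) = 0"
    "t i i i (X i * p) + t j j j (X j * p) + t k k k (X k * p) + t l l l (X l * p) = 0"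
    using c2[of i j p] c2[of i i p] c0[of p] by (simp_all add: sum_distinct_ix[OF assms])
qed

lemma tt_lform:
  obtains f where "f \<in> pa d" "\<And>p. tt i (lform (- {i}) * p) = f (X i * p)"
proof -
  obtain a b c where abc: "distinct [i, a, b, c]" by (rule obtain_distinct_ix)
  define f where "f = t i i i + t a a i + t b b i + t c c i + tt a + tt b + tt c"
  have perm: "distinct [a, b, c, i]" "distinct [a, c, b, i]" "distinct [b, c, a, i]"
    "distinct [a, i, b, c]" "distinct [b, i, a, c]" "distinct [c, i, a, b]"
    using abc by auto
  have fp: "f \<in> pa d" unfolding f_def by (intro pa_add t_pa tt_pa)
  have sym: "t a b a = t a a b" "t a b b = t a a b" "t a c a = t a a c" "t a c c = t a a c"
    "t b c b = t b b c" "t b c c = t b b c" "t b b a = t a a b" "t c c a = t a a c" "t c c b = t b b c"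
    by (metis s1 s2 s3)+
  have "tt i (lform (- {i}) * p) = f (X i * p)" for p
  proof -
    have "tt i (lform (- {i}) * p) + f (X i * p) =
      (t i i i (X i * p) + t a a a (X a * p) + t b b b (X b * p) + t c c c (X c * p))
     + (t a a a (X a * p) + t a a i (X i * p) + t a a b (X b * p) + t a a c (X c * p))
     + (t b b b (X b * p) + t b b i (X i * p) + t b b a (X a * p) + t b b c (X c * p))
     + (t c c c (X c * p) + t c c i (X i * p) + t c c a (X a * p) + t c c b (X b * p))
     + (t a b a (X a * p) + t a b b (X b * p) + tt i (X c * p) + tt c (X i * p))
     + (t a c a (X a * p) + t a c c (X c * p) + tt i (X b * p) + tt b (X i * p))
     + (t b c b (X b * p) + t b c c (X c * p) + tt i (X a * p) + tt a (X i * p))"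
      unfolding lform_compl[OF perm(1)] f_def sym
      by (simp add: plus_fun_apply distrib_right lin_add[OF lin_tt] algebra_simps)
    also have "\<dots> = 0"
      by (simp only: c2'(3)[OF abc] c2'(2)[OF perm(4)] c2'(2)[OF perm(5)] c2'(2)[OF perm(6)]
          c2'(1)[OF perm(1)] c2'(1)[OF perm(2)] c2'(1)[OF perm(3)] add_0)
    finally show ?thesis by (simp add: bit_add_eq_0_iff)
  qed
  then show ?thesis using fp that by blast
qed

lemma tt_lform_mult: "tt i (lform (- {i}) * (lform UNIV * p)) = 0"
proof -
  obtain f where f: "f \<in> pa d" "\<And>p. tt i (lform (- {i}) * p) = f (X i * p)"
    using tt_lform[of i] by blast
  have X: "X i = lform {i}" by (simp add: lform_def)
  show ?thesis
    unfolding lform_UNIV[of i] using pa_relation_mult[OF f(1) tt_pa f(2)[unfolded X], of p]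
    by (simp add: X add.commute)
qed

lemma tt_compat: "tt i (lform (- {i}) * (X k * p)) = tt k (lform (- {k}) * (X i * p))"
proof (cases "i = k")
  case False
  obtain a b where ab: "distinct [i, k, a, b]" by (rule obtain_distinct_ix2[OF False])
  then have perm: "distinct [a, b, i, k]" "distinct [a, b, k, i]" by auto
  let ?g = "t a b a" and ?l = "lform {a, b}"
  have g: "t a b b = t a b a" by (metis s1 s2 s3)
  have l: "?l = X a + X b" using ab by (simp add: lform_def)
  have rel: "?g (?l * p) + tt k (X i * p) + tt i (X k * p) = 0" for p
    using c2'(1)[OF perm(1), of p] by (simp add: g l distrib_right lin_add[OF lin_t])
  define f where "f x = (if x = a then t a b a else if x = i then tt k else tt i)" for x
  define v where "v x = (if x = a then {a, b} else {x})" for x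
  have ne: "a \<noteq> i" "a \<noteq> k" "k \<noteq> i" using ab by auto
  have "(\<Sum>x\<in>{a, i, k}. f x (lform (v x) ^ 2 * p)) = 0"
  proof (rule pa_relation_square[where d = d])
    show "f x \<in> pa d" for x by (simp add: f_def t_pa tt_pa)
    show "(\<Sum>x\<in>{a, i, k}. f x (lform (v x) * p)) = 0" for p
      using rel[of p] ab ne by (simp add: f_def v_def add.assoc) (simp add: lform_def add.assoc)
  qed
  then have sq: "?g (?l * (?l * p)) + tt k (X i * (X i * p)) + tt i (X k * (X k * p)) = 0"
    using ab ne by (simp add: f_def v_def add.assoc power2_eq_square mult.assoc) (simp add: lform_def)
  have "tt i (lform (- {i}) * (X k * p)) + tt k (lform (- {k}) * (X i * p)) =
    (?g (?l * (?l * p)) + tt k (X i * (X i * p)) + tt i (X k * (X k * p)))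
    + (?g (?l * (?l * p)) + tt k (X i * (?l * p)) + tt i (X k * (?l * p)))"
    unfolding lform_compl[OF perm(1)] lform_compl[OF perm(2)] l
    by (simp add: distrib_right distrib_left lin_add[OF lin_tt] lin_add[OF lin_t] algebra_simps)
  also have "\<dots> = 0" by (simp only: sq rel add_0)
  finally show ?thesis by (simp add: bit_add_eq_0_iff)
qed simp

lemma tt_sum: "(\<Sum>i\<in>UNIV. tt i (lform (- {i}) * p)) = 0"
proof -
  have d: "distinct [I0, I1, I2, I3]" "distinct [I1, I0, I2, I3]" "distinct [I2, I0, I1, I3]" "distinct [I3, I0, I1, I2]"
    "distinct [I0, I2, I1, I3]" "distinct [I0, I3, I1, I2]" "distinct [I1, I2, I0, I3]" "distinct [I1, I3, I0, I2]"
    "distinct [I2, I3, I0, I1]"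
    and d': "distinct [I1, I2, I3, I0]" "distinct [I0, I2, I3, I1]" "distinct [I0, I1, I3, I2]"
    by simp_all
  have sym: "t I1 I1 I0 = t I0 I0 I1" "t I2 I2 I0 = t I0 I0 I2" "t I3 I3 I0 = t I0 I0 I3"
    "t I2 I2 I1 = t I1 I1 I2" "t I3 I3 I1 = t I1 I1 I3" "t I3 I3 I2 = t I2 I2 I3"
    "t I0 I1 I0 = t I0 I0 I1" "t I0 I1 I1 = t I0 I0 I1" "t I0 I2 I0 = t I0 I0 I2" "t I0 I2 I2 = t I0 I0 I2"
    "t I0 I3 I0 = t I0 I0 I3" "t I0 I3 I3 = t I0 I0 I3" "t I1 I2 I1 = t I1 I1 I2" "t I1 I2 I2 = t I1 I1 I2"
    "t I1 I3 I1 = t I1 I1 I3" "t I1 I3 I3 = t I1 I1 I3" "t I2 I3 I2 = t I2 I2 I3" "t I2 I3 I3 = t I2 I2 I3"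
    by (metis s1 s2 s3)+
  have "(\<Sum>i\<in>UNIV. tt i (lform (- {i}) * p)) =
      (t I0 I0 I0 (X I0 * p) + t I1 I1 I1 (X I1 * p) + t I2 I2 I2 (X I2 * p) + t I3 I3 I3 (X I3 * p))
     + (t I0 I0 I0 (X I0 * p) + t I0 I0 I1 (X I1 * p) + t I0 I0 I2 (X I2 * p) + t I0 I0 I3 (X I3 * p))
     + (t I1 I1 I1 (X I1 * p) + t I1 I1 I0 (X I0 * p) + t I1 I1 I2 (X I2 * p) + t I1 I1 I3 (X I3 * p))
     + (t I2 I2 I2 (X I2 * p) + t I2 I2 I0 (X I0 * p) + t I2 I2 I1 (X I1 * p) + t I2 I2 I3 (X I3 * p))
     + (t I3 I3 I3 (X I3 * p) + t I3 I3 I0 (X I0 * p) + t I3 I3 I1 (X I1 * p) + t I3 I3 I2 (X I2 * p))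
     + (t I0 I1 I0 (X I0 * p) + t I0 I1 I1 (X I1 * p) + tt I3 (X I2 * p) + tt I2 (X I3 * p))
     + (t I0 I2 I0 (X I0 * p) + t I0 I2 I2 (X I2 * p) + tt I3 (X I1 * p) + tt I1 (X I3 * p))
     + (t I0 I3 I0 (X I0 * p) + t I0 I3 I3 (X I3 * p) + tt I2 (X I1 * p) + tt I1 (X I2 * p))
     + (t I1 I2 I1 (X I1 * p) + t I1 I2 I2 (X I2 * p) + tt I3 (X I0 * p) + tt I0 (X I3 * p))
     + (t I1 I3 I1 (X I1 * p) + t I1 I3 I3 (X I3 * p) + tt I2 (X I0 * p) + tt I0 (X I2 * p))
     + (t I2 I3 I2 (X I2 * p) + t I2 I3 I3 (X I3 * p) + tt I1 (X I0 * p) + tt I0 (X I1 * p))"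
    unfolding sum_UNIV_ix lform_compl[OF d(1)] lform_compl[OF d'(1)] lform_compl[OF d'(2)] lform_compl[OF d'(3)] sym
    by (simp add: distrib_right lin_add[OF lin_tt] algebra_simps)
  also have "\<dots> = 0"
    by (simp only: c2'(3)[OF d(1)] c2'(2)[OF d(1)] c2'(2)[OF d(2)] c2'(2)[OF d(3)] c2'(2)[OF d(4)]
        c2'(1)[OF d(1)] c2'(1)[OF d(5)] c2'(1)[OF d(6)] c2'(1)[OF d(7)] c2'(1)[OF d(8)] c2'(1)[OF d(9)] add_0)
  finally show ?thesis .
qed

lemma koszul_top:
  obtains h where "h \<in> KK d UNIV" "\<And>i p. h (X i * p) = tt i (lform (- {i}) * p)"
proof -
  obtain h where lin_h: "lin h" and h1: "h 1 = 0" and hX: "\<And>i p. h (X i * p) = tt i (lform (- {i}) * p)"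
    by (rule koszul_lift[where N = "\<lambda>i p. tt i (lform (- {i}) * p)"])
      (auto intro: lin_comp[OF lin_tt lin_mult(1)] tt_compat)
  have "h (mon e) = 0" if "tot e \<noteq> d" for e
    using that
  proof (cases "e = 0")
    case False
    then obtain i where i: "0 < e i" by (auto simp: fun_eq_iff zero_fun_apply)
    define m where "m = (\<lambda>j. e j - unit i j)"
    have e: "e = unit i + m" using i by (auto simp: m_def fun_eq_iff unit_def plus_fun_apply)
    have "h (mon e) = tt i (lform (- {i}) * mon m)"
      unfolding e mon_add using hX[of i "mon m"] by (simp add: X_def)
    also have "\<dots> = 0"
    proof -
      have "tt i (mon (unit j + m)) = 0" for j
        using that e by (intro supportedD[OF paD(2)[OF tt_pa]]) simp
      then show ?thesis by (simp add: lform_def sum_distrib_right lin_sum[OF lin_tt] X_def flip: mon_add)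
    qed
    finally show ?thesis .
  qed (simp add: h1)
  moreover have "h (Sq p) = h p" for p
  proof (rule lin_ext_mon[OF lin_comp[OF lin_h lin_Sq] lin_h])
    show "h (Sq (mon e)) = h (mon e)" for e
    proof (induction e rule: mon_induct)
      case (X i m)
      let ?l = "lform (- {i})" and ?q = "Sq (mon m)"
      have "tt i (Sq (?l * mon m)) = tt i (?l * mon m)" by (rule paD(3)[OF tt_pa])
      then have 1: "tt i (?l * ?q) + tt i (?l * (?l * ?q)) = tt i (?l * mon m)"
        by (simp add: Sq_mult Sq_lform distrib_right lin_add[OF lin_tt] power2_eq_square mult.assoc)
      have 2: "tt i (?l * (X i * ?q)) + tt i (?l * (?l * ?q)) = 0"
        using tt_lform_mult[of i ?q] by (simp add: lform_UNIV[of i] distrib_right distrib_left lin_add[OF lin_tt])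
      have "h (Sq (X i * mon m)) = tt i (?l * ?q) + tt i (?l * (X i * ?q))"
        by (simp add: Sq_mult distrib_right lin_add[OF lin_h] power2_eq_square mult.assoc hX)
      also have "\<dots> = tt i (?l * mon m)"
        unfolding 1[symmetric] using 2 by (simp add: bit_add_eq_0_iff)
      finally show ?case by (simp add: hX)
    qed simp
  qed
  ultimately have "h \<in> pa d" by (simp add: pa_def supported_def lin_h)
  moreover have "h (lform UNIV * p) = 0" for p
    by (simp add: lin_lform[OF lin_h] hX tt_sum)
  ultimately have "h \<in> KK d UNIV" by (simp add: KK_def)
  then show ?thesis using hX by (rule that)
qed

end

inductive_set span_E :: "nat \<Rightarrow> nat \<Rightarrow> (pol \<Rightarrow> bit) set" for d s where
  zero: "0 \<in> span_E d s"
| add: "F \<in> span_E d s \<Longrightarrow> h \<in> KK d v \<Longrightarrow> v \<noteq> {} \<Longrightarrow> F + EE s v h \<in> span_E d s"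

lemma span_E_gen: "h \<in> KK d v \<Longrightarrow> v \<noteq> {} \<Longrightarrow> EE s v h \<in> span_E d s"
  using span_E.add[OF span_E.zero, of h d v s] by (simp add: zero_fun_def plus_fun_def)

lemma span_E_plus: "F \<in> span_E d s \<Longrightarrow> G \<in> span_E d s \<Longrightarrow> F + G \<in> span_E d s"
proof (induction arbitrary: rule: span_E.induct)
  case (add F h v)
  then show ?case using span_E.add[of "F + G" d s h v] by (simp add: ac_simps)
qed simp

lemma span_E_SS: "F \<in> span_E d s \<Longrightarrow> F \<in> SS d s"
  by (induction rule: span_E.induct) (auto simp: SS_0_mem SS_add EE_SS)

lemma span_E_cancel: "F + G \<in> span_E d s \<Longrightarrow> G \<in> span_E d s \<Longrightarrow> F \<in> span_E d s"
  using span_E_plus[of "F + G" d s G] by (simp add: add.assoc)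

section \<open>Three and two halvings\<close>

lemma obtain_distinct_ix3:
  assumes "distinct [i, j, k :: ix]"
  obtains l where "distinct [i, j, k, l]"
proof -
  have "card {i, j, k} \<noteq> card (UNIV :: ix set)" using assms by (simp add: card_ix)
  then have "{i, j, k} \<noteq> UNIV" by metis
  then obtain l where "l \<notin> {i, j, k}" by blast
  then show ?thesis using assms by (intro that[of l]) auto
qed

definition comp3 :: "(pol \<Rightarrow> bit) \<Rightarrow> ix \<Rightarrow> ix \<Rightarrow> ix \<Rightarrow> pol \<Rightarrow> bit" where
  "comp3 F i j k = comp k (comp j (comp i F))"

lemma comp3_add: "comp3 (F + G) i j k = comp3 F i j k + comp3 G i j k"
  by (simp add: comp3_def comp_add)

lemma comp3_EE:
  assumes "lin h"
  shows "comp3 (EE (Suc (Suc (Suc 0))) v h) i j k = (if i \<in> v \<and> j \<in> v \<and> k \<in> v then h else 0)"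
  using assms lin_EE[OF assms, of 1 v] lin_EE[OF assms, of 2 v]
  by (simp add: comp3_def EE_Suc comp_E1 comp_0 eval_nat_numeral)

lemma comp3_eq_0: "F \<in> SS d (Suc (Suc (Suc 0))) \<Longrightarrow> (\<And>i j k. comp3 F i j k = 0) \<Longrightarrow> F = 0"
  unfolding comp3_def by (meson SS_SucE(2) SS_eq_0)

lemma symmetric_family_comp3:
  assumes F: "F \<in> SS d (Suc (Suc (Suc 0)))" and d: "0 < d"
  shows "symmetric_family (comp3 F) d"
proof
  note m1 = SS_SucE(2)[OF F]
  note m2 = SS_SucE(2)[OF m1]
  note m3 = SS_SucE(2)[OF m2]
  note D = diag_SS[OF F]
  fix i j k p
  show "comp3 F i j k \<in> pa d" unfolding comp3_def using m3 by simp
  show "comp3 F i j k = comp3 F j i k" unfolding comp3_def by (simp only: SS_comp_comm(1)[OF F, of j i])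
  show "comp3 F i j k = comp3 F i k j" unfolding comp3_def by (simp only: SS_comp_comm(1)[OF m1, of k j])
  show "(\<Sum>k\<in>UNIV. comp3 F i j k (X k * p)) = 0" unfolding comp3_def by (rule SS_SucE(3)[OF m2])
  have "comp3 F i i j = comp j (comp i (diag F))" for i j
    unfolding comp3_def by (simp only: comp_diag[OF F])
  then have iij: "comp3 F i i j = comp3 F j j i" for i j
    using SS_comp_comm(1)[OF D, of j i] by simp
  show "comp3 F i i j = comp3 F i j j"
    unfolding iij[of i j] unfolding comp3_def
    by (simp only: SS_comp_comm(1)[OF F, of j i] SS_comp_comm(1)[OF m1, of j i])
  show "(\<Sum>i\<in>UNIV. comp3 F i i i (X i * p)) = 0"
    using SS_comp_comm(2)[OF D, of p] unfolding comp3_def by (simp only: comp_diag[OF F])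
  show "0 < d" by (rule d)
qed

lemma span_E_3_diagonal:
  assumes F: "F \<in> SS d (Suc (Suc (Suc 0)))" and d: "0 < d"
    and zero: "\<And>i j k. \<not> (i = j \<and> j = k) \<Longrightarrow> comp3 F i j k = 0"
  shows "F \<in> span_E d (Suc (Suc (Suc 0)))"
proof -
  interpret symmetric_family "comp3 F" d by (rule symmetric_family_comp3[OF F d])
  have KK: "comp3 F i i i \<in> KK d {i}" for i
  proof -
    obtain j k l where ijkl: "distinct [i, j, k, l]" by (rule obtain_distinct_ix)
    then have "comp3 F i i j = 0" "comp3 F i i k = 0" "comp3 F i i l = 0" by (auto intro!: zero)
    then show ?thesis
      using c2'(2)[OF ijkl] t_pa by (simp add: KK_def lform_def zero_fun_apply)
  qed
  define S where "S = EE (Suc (Suc (Suc 0))) {I0} (comp3 F I0 I0 I0) + EE (Suc (Suc (Suc 0))) {I1} (comp3 F I1 I1 I1)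
    + EE (Suc (Suc (Suc 0))) {I2} (comp3 F I2 I2 I2) + EE (Suc (Suc (Suc 0))) {I3} (comp3 F I3 I3 I3)"
  have S: "S \<in> span_E d (Suc (Suc (Suc 0)))"
    unfolding S_def by (intro span_E_plus span_E_gen KK) simp_all
  have "F + S = 0"
  proof (rule comp3_eq_0)
    show "F + S \<in> SS d (Suc (Suc (Suc 0)))" by (intro SS_add F span_E_SS S)
    show "comp3 (F + S) i j k = 0" for i j k
      unfolding S_def comp3_add comp3_EE[OF lin_t]
      by (cases i; cases j; cases k) (simp_all add: zero)
  qed
  then show ?thesis using S span_E_cancel span_E.zero by metis
qed

lemma span_E_3_pairs:
  assumes F: "F \<in> SS d (Suc (Suc (Suc 0)))" and d: "0 < d"
    and zero: "\<And>i j k. distinct [i, j, k] \<Longrightarrow> comp3 F i j k = 0"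
  shows "F \<in> span_E d (Suc (Suc (Suc 0)))"
proof -
  interpret symmetric_family "comp3 F" d by (rule symmetric_family_comp3[OF F d])
  have KK: "comp3 F i i j \<in> KK d {i, j}" if ij: "i \<noteq> j" for i j
  proof -
    obtain k l where ijkl: "distinct [i, j, k, l]" by (rule obtain_distinct_ix2[OF ij])
    have "tt l = comp3 F i j k" "tt k = comp3 F i j l" using ijkl by (auto intro!: tt[symmetric])
    then have "tt l = 0" "tt k = 0" using ijkl zero by simp_all
    moreover have "comp3 F i j i = comp3 F i i j" "comp3 F i j j = comp3 F i i j" by (metis s1 s2 s3)+
    ultimately show ?thesis
      using c2'(1)[OF ijkl] t_pa ij
      by (simp add: KK_def lform_def distrib_right lin_add[OF lin_t] zero_fun_apply)
  qed
  define S where "S = EE (Suc (Suc (Suc 0))) {I0, I1} (comp3 F I0 I0 I1) + EE (Suc (Suc (Suc 0))) {I0, I2} (comp3 F I0 I0 I2)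
    + EE (Suc (Suc (Suc 0))) {I0, I3} (comp3 F I0 I0 I3) + EE (Suc (Suc (Suc 0))) {I1, I2} (comp3 F I1 I1 I2)
    + EE (Suc (Suc (Suc 0))) {I1, I3} (comp3 F I1 I1 I3) + EE (Suc (Suc (Suc 0))) {I2, I3} (comp3 F I2 I2 I3)"
  have S: "S \<in> span_E d (Suc (Suc (Suc 0)))"
    unfolding S_def by (intro span_E_plus span_E_gen KK) simp_all
  have sym: "comp3 F I0 I1 I0 = comp3 F I0 I0 I1" "comp3 F I0 I1 I1 = comp3 F I0 I0 I1"
    "comp3 F I1 I0 I0 = comp3 F I0 I0 I1" "comp3 F I1 I0 I1 = comp3 F I0 I0 I1"
    "comp3 F I1 I1 I0 = comp3 F I0 I0 I1" "comp3 F I0 I2 I0 = comp3 F I0 I0 I2"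
    "comp3 F I0 I2 I2 = comp3 F I0 I0 I2" "comp3 F I2 I0 I0 = comp3 F I0 I0 I2"
    "comp3 F I2 I0 I2 = comp3 F I0 I0 I2" "comp3 F I2 I2 I0 = comp3 F I0 I0 I2"
    "comp3 F I0 I3 I0 = comp3 F I0 I0 I3" "comp3 F I0 I3 I3 = comp3 F I0 I0 I3"
    "comp3 F I3 I0 I0 = comp3 F I0 I0 I3" "comp3 F I3 I0 I3 = comp3 F I0 I0 I3"
    "comp3 F I3 I3 I0 = comp3 F I0 I0 I3" "comp3 F I1 I2 I1 = comp3 F I1 I1 I2"
    "comp3 F I1 I2 I2 = comp3 F I1 I1 I2" "comp3 F I2 I1 I1 = comp3 F I1 I1 I2"
    "comp3 F I2 I1 I2 = comp3 F I1 I1 I2" "comp3 F I2 I2 I1 = comp3 F I1 I1 I2"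
    "comp3 F I1 I3 I1 = comp3 F I1 I1 I3" "comp3 F I1 I3 I3 = comp3 F I1 I1 I3"
    "comp3 F I3 I1 I1 = comp3 F I1 I1 I3" "comp3 F I3 I1 I3 = comp3 F I1 I1 I3"
    "comp3 F I3 I3 I1 = comp3 F I1 I1 I3" "comp3 F I2 I3 I2 = comp3 F I2 I2 I3"
    "comp3 F I2 I3 I3 = comp3 F I2 I2 I3" "comp3 F I3 I2 I2 = comp3 F I2 I2 I3"
    "comp3 F I3 I2 I3 = comp3 F I2 I2 I3" "comp3 F I3 I3 I2 = comp3 F I2 I2 I3"
    by (metis s1 s2 s3)+
  have "F + S \<in> span_E d (Suc (Suc (Suc 0)))"
  proof (rule span_E_3_diagonal[OF _ d])
    show "F + S \<in> SS d (Suc (Suc (Suc 0)))" by (intro SS_add F span_E_SS S)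
    show "comp3 (F + S) i j k = 0" if "\<not> (i = j \<and> j = k)" for i j k
      using that unfolding S_def comp3_add comp3_EE[OF lin_t]
      by (cases i; cases j; cases k) (simp_all add: zero sym)
  qed
  then show ?thesis using S by (rule span_E_cancel)
qed

lemma span_E_3:
  assumes F: "F \<in> SS d (Suc (Suc (Suc 0)))" and d: "0 < d"
  shows "F \<in> span_E d (Suc (Suc (Suc 0)))"
proof -
  interpret symmetric_family "comp3 F" d by (rule symmetric_family_comp3[OF F d])
  obtain h where h: "h \<in> KK d UNIV" and hX: "\<And>i p. h (X i * p) = tt i (lform (- {i}) * p)"
    using koszul_top by blast
  note lin_h = paD(1)[OF KKD(1)[OF h]]
  have KK: "tt l + h \<in> KK d (- {l})" for l
  proof -
    have "h (lform (- {l}) * p) = tt l (lform (- {l}) * p)" for p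
      using KKD(2)[OF h, of p] by (simp add: lform_UNIV[of l] distrib_right lin_add[OF lin_h] bit_add_eq_0_iff hX)
    then show ?thesis by (simp add: KK_def pa_add tt_pa KKD(1)[OF h] plus_fun_apply)
  qed
  have lin_hl: "lin (tt l + h)" for l by (rule lin_plus_fun[OF lin_tt lin_h])
  define S where "S = EE (Suc (Suc (Suc 0))) UNIV h + EE (Suc (Suc (Suc 0))) (- {I0}) (tt I0 + h)
    + EE (Suc (Suc (Suc 0))) (- {I1}) (tt I1 + h) + EE (Suc (Suc (Suc 0))) (- {I2}) (tt I2 + h)
    + EE (Suc (Suc (Suc 0))) (- {I3}) (tt I3 + h)"
  have ne: "- {i} \<noteq> {}" for i :: ix
    using card_compl[of i] by auto
  have S: "S \<in> span_E d (Suc (Suc (Suc 0)))"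
    unfolding S_def by (intro span_E_plus span_E_gen KK h ne) simp_all
  have "F + S \<in> span_E d (Suc (Suc (Suc 0)))"
  proof (rule span_E_3_pairs[OF _ d])
    show "F + S \<in> SS d (Suc (Suc (Suc 0)))" by (intro SS_add F span_E_SS S)
    show "comp3 (F + S) i j k = 0" if ijk: "distinct [i, j, k]" for i j k
    proof -
      obtain l where l: "distinct [i, j, k, l]"
        using obtain_distinct_ix3[OF ijk] by blast
      have "comp3 F i j k = tt l" by (rule tt[OF l])
      moreover have "i \<in> - {m} \<and> j \<in> - {m} \<and> k \<in> - {m} \<longleftrightarrow> m = l" for m
        using l UNIV_I[of m] unfolding distinct_ix_UNIV[OF l, symmetric] by auto
      ultimately show ?thesis
        unfolding S_def comp3_add comp3_EE[OF lin_hl] comp3_EE[OF lin_h]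
        by (cases l) (simp_all add: add.assoc)
    qed
  qed
  then show ?thesis using S by (rule span_E_cancel)
qed

theorem SS_span_E:
  assumes "F \<in> SS d s" "3 \<le> s" "0 < d"
  shows "F \<in> span_E d s"
  using assms(2,1)
proof (induction s arbitrary: F rule: dec_induct)
  case base
  then show ?case using span_E_3 assms(3) by (simp add: eval_nat_numeral)
next
  case (step s)
  then obtain r where r: "s = Suc r" by (cases s) simp_all
  have lift: "\<exists>G\<in>span_E d (Suc s). diag G = D" if "D \<in> span_E d s" for D
    using that
  proof (induction rule: span_E.induct)
    case zero
    then show ?case using span_E.zero diag_0 by blast
  next
    case (add D h v)
    then obtain G where "G \<in> span_E d (Suc s)" "diag G = D" by blast
    then have "G + EE (Suc s) v h \<in> span_E d (Suc s)" "diag (G + EE (Suc s) v h) = D + EE s v h"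
      using add(2,3) by (auto intro: span_E.add simp: diag_add r diag_EE[OF paD(1)[OF KKD(1)]])
    then show ?case by blast
  qed
  have "diag F \<in> span_E d s" using step(3,4) diag_SS[of F d r] by (simp add: r)
  then obtain G where G: "G \<in> span_E d (Suc s)" "diag G = diag F" using lift by blast
  have "F + G = 0"
  proof (rule diag_eq_0[of _ d s])
    show "F + G \<in> SS d (Suc s)" by (rule SS_add[OF step(4) span_E_SS[OF G(1)]])
    show "diag (F + G) = 0" by (simp add: diag_add G(2))
  qed (use step(1) assms(3) in auto)
  then show ?case using G(1) span_E_cancel span_E.zero by metis
qed

lemma unit_add_eq_iff: "unit a + unit b = unit c + unit d \<longleftrightarrow> a = c \<and> b = d \<or> a = d \<and> b = c"
proof
  assume eq: "unit a + unit b = unit c + unit d"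
  have inj: "unit x = unit y \<Longrightarrow> x = y" for x y
    by (drule fun_cong[of _ _ x]) (simp add: unit_def split: if_splits)
  have "a = c \<or> a = d"
    using fun_cong[OF eq, of a] by (auto simp: plus_fun_apply unit_def split: if_splits)
  then show "a = c \<and> b = d \<or> a = d \<and> b = c"
  proof
    assume "a = c"
    then have "unit b = unit d" using eq by simp
    then show ?thesis using inj \<open>a = c\<close> by blast
  next
    assume "a = d"
    then have "unit b = unit c" using eq by (simp add: add.commute)
    then show ?thesis using inj \<open>a = d\<close> by blast
  qed
qed (auto simp: add.commute)

lemma tot_eq_1D: "tot e = 1 \<Longrightarrow> \<exists>a. e = unit a"
proof -
  assume e: "tot e = 1"
  then have "e \<noteq> 0" by auto
  then obtain i where i: "0 < e i" by (auto simp: fun_eq_iff zero_fun_apply)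
  define m where "m = (\<lambda>j. e j - unit i j)"
  have em: "e = unit i + m" using i by (auto simp: m_def fun_eq_iff unit_def plus_fun_apply)
  then have "tot m = 0" using e by simp
  then show ?thesis using em by auto
qed

lemma tot_SucE:
  assumes "tot e = Suc n"
  obtains i m where "e = unit i + m" "tot m = n"
proof -
  have "e \<noteq> 0" using assms by auto
  then obtain i where i: "0 < e i" by (auto simp: fun_eq_iff zero_fun_apply)
  define m where "m = (\<lambda>j. e j - unit i j)"
  have em: "e = unit i + m" using i by (auto simp: m_def fun_eq_iff unit_def plus_fun_apply)
  then have "tot m = n" using assms by simp
  then show ?thesis using em that by blast
qed

lemma pa_2_iff: "F \<in> pa 2 \<longleftrightarrow> lin F \<and> supported 2 F \<and> (\<forall>a. F (X a * X a) = 0)"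
proof
  assume F: "F \<in> pa 2"
  have "F (X a) = 0" for a using supportedD[OF paD(2)[OF F], of "unit a"] by (simp add: X_def)
  then have "F (X a * X a) = 0" for a
    using paD(3)[OF F, of "X a"] by (simp add: lin_add[OF paD(1)[OF F]] power2_eq_square)
  then show "lin F \<and> supported 2 F \<and> (\<forall>a. F (X a * X a) = 0)" using paD[OF F] by blast
next
  assume F: "lin F \<and> supported 2 F \<and> (\<forall>a. F (X a * X a) = 0)"
  then have linF: "lin F" and supF: "supported 2 F" by auto
  have "F (Sq p) = F p" for p
  proof (rule lin_ext_mon[OF lin_comp[OF linF lin_Sq] linF])
    fix e
    consider "e = 0" | a where "e = unit a" | "2 \<le> tot e"
      using tot_eq_1D[of e] by (metis One_nat_def Suc_1 Suc_leI le_neq_implies_less not_less_eq_eq tot_eq_0_iff zero_less_iff_neq_zero)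
    then show "F (Sq (mon e)) = F (mon e)"
    proof cases
      case 2
      then show ?thesis using F by (simp add: X_def[symmetric] lin_add[OF linF] power2_eq_square)
    next
      case 3
      then have "F (Sq (mon e) + mon e) = 0"
        using highdeg_Sq_mon[of e] by (intro supported_eq_0[OF linF supF]) (fastforce simp: highdeg_def)
      then show ?thesis by (simp add: lin_add[OF linF] bit_add_eq_0_iff)
    qed simp
  qed
  then show "F \<in> pa 2" using F by (simp add: pa_def)
qed

lemma pa_2_ext:
  assumes "F \<in> pa 2" "G \<in> pa 2" "\<And>a b. a \<noteq> b \<Longrightarrow> F (X a * X b) = G (X a * X b)"
  shows "F = G"
proof
  fix p
  show "F p = G p"
  proof (rule lin_ext_mon[OF paD(1)[OF assms(1)] paD(1)[OF assms(2)]])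
    fix e
    show "F (mon e) = G (mon e)"
    proof (cases "tot e = 2")
      case True
      then obtain a m where e: "e = unit a + m" and "tot m = 1" by (auto elim: tot_SucE simp: eval_nat_numeral)
      then obtain b where "m = unit b" using tot_eq_1D by blast
      then have "mon e = X a * X b" by (simp add: e X_def mon_add)
      then show ?thesis using assms by (cases "a = b") (simp_all add: pa_2_iff)
    next
      case False
      then show ?thesis using assms(1,2) by (auto simp: supportedD dest!: paD(2))
    qed
  qed
qed

lemma KK_2I:
  assumes F: "F \<in> pa 2" and X: "\<And>c. F (lform v * X c) = 0"
  shows "F \<in> KK 2 v"
proof -
  have "F (lform v * p) = 0" for p
  proof (rule lin_ext_mon[OF lin_comp[OF paD(1)[OF F] lin_mult(1)] lin_zero])
    fix e
    show "F (lform v * mon e) = 0"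
    proof (cases "tot e = 1")
      case True
      then obtain a where "e = unit a" using tot_eq_1D by blast
      then show ?thesis using X[of a] by (simp add: X_def)
    next
      case False
      then show ?thesis
        by (auto simp: lform_def sum_distrib_right lin_sum[OF paD(1)[OF F]] X_def mon_add[symmetric]
            intro!: sum.neutral supportedD[OF paD(2)[OF F]])
    qed
  qed
  then show ?thesis using F by (simp add: KK_def)
qed

definition alt :: "(ix \<Rightarrow> ix \<Rightarrow> bit) \<Rightarrow> pol \<Rightarrow> bit" where
  "alt c = lift (\<lambda>e. if e = unit I0 + unit I1 then c I0 I1 else if e = unit I0 + unit I2 then c I0 I2
     else if e = unit I0 + unit I3 then c I0 I3 else if e = unit I1 + unit I2 then c I1 I2
     else if e = unit I1 + unit I3 then c I1 I3 else if e = unit I2 + unit I3 then c I2 I3 else 0)"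

lemma alt_X: "c a b = c b a \<Longrightarrow> alt c (X a * X b) = (if a = b then 0 else c a b)"
  unfolding alt_def X_def mon_add[symmetric] lift_mon unit_add_eq_iff
  by (cases a; cases b) simp_all

lemma alt_pa: "alt c \<in> pa 2"
proof -
  have "supported 2 (alt c)"
    unfolding supported_def alt_def lift_mon by auto
  moreover have "alt c (X a * X a) = 0" for a
    using alt_X[of c a a] by simp
  ultimately show ?thesis by (simp add: pa_2_iff) (simp add: alt_def lin_lift_bit)
qed

definition comp2 :: "(pol \<Rightarrow> bit) \<Rightarrow> ix \<Rightarrow> ix \<Rightarrow> pol \<Rightarrow> bit" where
  "comp2 F i j = comp j (comp i F)"

lemma comp2_add: "comp2 (F + G) i j = comp2 F i j + comp2 G i j"
  by (simp add: comp2_def comp_add)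

lemma comp2_EE: "lin h \<Longrightarrow> comp2 (EE (Suc (Suc 0)) v h) i j = (if i \<in> v \<and> j \<in> v then h else 0)"
  using lin_EE[of h 1 v] by (simp add: comp2_def EE_Suc comp_E1 comp_0)

lemma comp2_eq_0: "F \<in> SS d (Suc (Suc 0)) \<Longrightarrow> (\<And>i j. comp2 F i j = 0) \<Longrightarrow> F = 0"
  unfolding comp2_def by (meson SS_SucE(2) SS_eq_0)

lemma comp2_props:
  assumes F: "F \<in> SS d (Suc (Suc 0))"
  shows "comp2 F i j \<in> pa d" "comp2 F i j = comp2 F j i"
    "(\<Sum>i\<in>UNIV. comp2 F j i (X i * p)) = 0" "(\<Sum>i\<in>UNIV. comp2 F i i (X i * p)) = 0"
proof -
  note m1 = SS_SucE(2)[OF F]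
  show "comp2 F i j \<in> pa d" unfolding comp2_def using SS_SucE(2)[OF m1] by simp
  show "comp2 F i j = comp2 F j i" unfolding comp2_def by (rule SS_comp_comm(1)[OF F])
  show "(\<Sum>i\<in>UNIV. comp2 F j i (X i * p)) = 0" unfolding comp2_def by (rule SS_SucE(3)[OF m1])
  show "(\<Sum>i\<in>UNIV. comp2 F i i (X i * p)) = 0" unfolding comp2_def by (rule SS_comp_comm(2)[OF F])
qed

lemma span_E_2_diagonal:
  assumes F: "F \<in> SS d (Suc (Suc 0))" and zero: "\<And>i j. i \<noteq> j \<Longrightarrow> comp2 F i j = 0"
  shows "F \<in> span_E d (Suc (Suc 0))"
proof -
  note P = comp2_props[OF F]
  have KK: "comp2 F i i \<in> KK d {i}" for i
  proof -
    obtain j k l where ijkl: "distinct [i, j, k, l]" by (rule obtain_distinct_ix)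
    then have "comp2 F i j = 0" "comp2 F i k = 0" "comp2 F i l = 0" by (auto intro!: zero)
    then have "comp2 F i i (X i * p) = 0" for p
      using P(3)[of i p] by (simp add: sum_distinct_ix[OF ijkl] zero_fun_apply)
    then show ?thesis using P(1) by (simp add: KK_def lform_def)
  qed
  define S where "S = EE (Suc (Suc 0)) {I0} (comp2 F I0 I0) + EE (Suc (Suc 0)) {I1} (comp2 F I1 I1)
    + EE (Suc (Suc 0)) {I2} (comp2 F I2 I2) + EE (Suc (Suc 0)) {I3} (comp2 F I3 I3)"
  have S: "S \<in> span_E d (Suc (Suc 0))"
    unfolding S_def by (intro span_E_plus span_E_gen KK) simp_all
  have "F + S = 0"
  proof (rule comp2_eq_0)
    show "F + S \<in> SS d (Suc (Suc 0))" by (intro SS_add F span_E_SS S)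
    show "comp2 (F + S) i j = 0" for i j
      unfolding S_def comp2_add comp2_EE[OF paD(1)[OF P(1)]]
      by (cases i; cases j) (simp_all add: zero)
  qed
  then show ?thesis using S span_E_cancel span_E.zero by metis
qed

lemma span_E_2_pairs:
  assumes F: "F \<in> SS d (Suc (Suc 0))" and KK: "\<And>i j. i \<noteq> j \<Longrightarrow> comp2 F i j \<in> KK d {i, j}"
  shows "F \<in> span_E d (Suc (Suc 0))"
proof -
  note P = comp2_props[OF F]
  define S where "S = EE (Suc (Suc 0)) {I0, I1} (comp2 F I0 I1) + EE (Suc (Suc 0)) {I0, I2} (comp2 F I0 I2)
    + EE (Suc (Suc 0)) {I0, I3} (comp2 F I0 I3) + EE (Suc (Suc 0)) {I1, I2} (comp2 F I1 I2)
    + EE (Suc (Suc 0)) {I1, I3} (comp2 F I1 I3) + EE (Suc (Suc 0)) {I2, I3} (comp2 F I2 I3)"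
  have S: "S \<in> span_E d (Suc (Suc 0))"
    unfolding S_def by (intro span_E_plus span_E_gen KK) simp_all
  have sym: "comp2 F I1 I0 = comp2 F I0 I1" "comp2 F I2 I0 = comp2 F I0 I2" "comp2 F I3 I0 = comp2 F I0 I3"
    "comp2 F I2 I1 = comp2 F I1 I2" "comp2 F I3 I1 = comp2 F I1 I3" "comp2 F I3 I2 = comp2 F I2 I3"
    by (rule P(2))+
  have "F + S \<in> span_E d (Suc (Suc 0))"
  proof (rule span_E_2_diagonal)
    show "F + S \<in> SS d (Suc (Suc 0))" by (intro SS_add F span_E_SS S)
    show "comp2 (F + S) i j = 0" if "i \<noteq> j" for i j
      using that unfolding S_def comp2_add comp2_EE[OF paD(1)[OF P(1)]]
      by (cases i; cases j) (simp_all add: sym)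
  qed
  then show ?thesis using S by (rule span_E_cancel)
qed

lemma bit_add_swap: "a + b = c + d \<Longrightarrow> c + a = d + b" for a b c d :: bit
  by (cases a; cases b; cases c; cases d) simp_all

theorem SS_2_span_E:
  assumes F: "F \<in> SS 2 (Suc (Suc 0))"
  shows "F \<in> span_E 2 (Suc (Suc 0))"
proof -
  note P = comp2_props[OF F]
  define f where "f i j a b = comp2 F i j (X a * X b)" for i j a b
  have f_diag: "f i j a a = 0" for i j a using P(1)[of i j] by (simp add: f_def pa_2_iff)
  have f_sym: "f i j a b = f j i a b" "f i j a b = f i j b a" for i j a b
    by (simp_all add: f_def P(2)[of i j] mult.commute)
  have c2: "(\<Sum>i\<in>UNIV. f j i i a) = 0" for j a using P(3) by (simp add: f_def)
  have c0: "(\<Sum>i\<in>UNIV. f i i i a) = 0" for a using P(4) by (simp add: f_def)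
  have vertex: "f i j i j + f i k i k + f i l i l = 0" if ijkl: "distinct [i, j, k, l]" for i j k l
    using c2[of i i] by (simp add: sum_distinct_ix[OF ijkl] f_diag f_sym(2)[of _ _ _ i])
  define p where "p l = (case l of I0 \<Rightarrow> 0 | I1 \<Rightarrow> f I2 I3 I2 I3 | I2 \<Rightarrow> f I1 I3 I1 I3 | I3 \<Rightarrow> f I1 I2 I1 I2)" for l
  have edge: "f i j i j = p k + p l" if ijkl: "distinct [i, j, k, l]" for i j k l
  proof -
    have v: "f I1 I0 I1 I0 + f I1 I2 I1 I2 + f I1 I3 I1 I3 = 0"
      "f I2 I0 I2 I0 + f I1 I2 I1 I2 + f I2 I3 I2 I3 = 0"
      "f I3 I0 I3 I0 + f I1 I3 I1 I3 + f I2 I3 I2 I3 = 0"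
      using vertex[of I1 I0 I2 I3] vertex[of I2 I0 I1 I3] vertex[of I3 I0 I1 I2]
      by (simp_all add: f_sym(1)[of I2 I1] f_sym(1)[of I3 I1] f_sym(1)[of I3 I2] f_sym(2)[of _ _ I2 I1] f_sym(2)[of _ _ I3 I1] f_sym(2)[of _ _ I3 I2])
    have v': "f I1 I0 I1 I0 = p I2 + p I3" "f I2 I0 I2 I0 = p I1 + p I3" "f I3 I0 I3 I0 = p I1 + p I2"
      "f I2 I3 I2 I3 = p I0 + p I1" "f I1 I3 I1 I3 = p I0 + p I2" "f I1 I2 I1 I2 = p I0 + p I3"
      using v by (simp_all add: p_def bit_add_eq_0_iff add.assoc add.commute)
    have "f i j i j = f j i j i" by (metis f_sym)
    then show ?thesis using ijkl v' by (cases i; cases j; cases k; cases l) (simp_all add: add.commute)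
  qed
  define r where "r l k = (\<Sum>i\<in>- {k, l}. \<Sum>j\<in>- {k, l} - {i}. f i j i l)" for l k
  have r: "r l k = f i j i l + f i j j l" if ijkl: "distinct [i, j, k, l]" for i j k l
  proof -
    have "- {k, l} = {i, j}" using distinct_ix_UNIV[OF ijkl] ijkl by auto
    moreover have "j \<noteq> i" "i \<noteq> j" using ijkl by auto
    ultimately show ?thesis using f_sym(1)[of j i] by (simp add: r_def insert_Diff_if)
  qed
  have r_sum: "r l i + r l j + r l k = 0" if ijkl: "distinct [i, j, k, l]" for i j k l
  proof -
    have perm: "distinct [j, k, i, l]" "distinct [i, k, j, l]" using ijkl by auto
    have "(f i i i l + f i j j l + f i k k l) + (f i j i l + f j j j l + f j k k l) + (f i k i l + f j k j l + f k k k l) = 0"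
      using c2[of i l] c2[of j l] c2[of k l]
      by (simp add: sum_distinct_ix[OF ijkl] f_diag f_sym(1)[of j i] f_sym(1)[of k i] f_sym(1)[of k j])
    moreover have "f i i i l + f j j j l + f k k k l = 0"
      using c0[of l] by (simp add: sum_distinct_ix[OF ijkl] f_diag)
    ultimately have "(f i i i l + f i j j l + f i k k l) + (f i j i l + f j j j l + f j k k l) + (f i k i l + f j k j l + f k k k l)
      + (f i i i l + f j j j l + f k k k l) = 0" by simp
    then show ?thesis
      unfolding r[OF ijkl] r[OF perm(1)] r[OF perm(2)] by (simp add: ac_simps)
  qed
  define c where "c l a b = (if a = l then r l b else if b = l then r l a else p l)" for l a b
  define h where "h l = alt (c l)" for l
  have h_pa: "h l \<in> pa 2" for l unfolding h_def by (rule alt_pa)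
  have hX: "h l (X a * X b) = (if a = b then 0 else c l a b)" for l a b
    unfolding h_def by (rule alt_X) (auto simp: c_def)
  have h_KK: "h l \<in> KK 2 (- {l})" for l
  proof (rule KK_2I[OF h_pa])
    fix x
    obtain i j k where "distinct [l, i, j, k]" by (rule obtain_distinct_ix)
    then have ijkl: "distinct [i, j, k, l]" by auto
    have "x = i \<or> x = j \<or> x = k \<or> x = l" using distinct_ix_UNIV[OF ijkl] by auto
    then show "h l (lform (- {l}) * X x) = 0"
      using ijkl r_sum[OF ijkl]
      by (auto simp: lform_compl[OF ijkl] distrib_right lin_add[OF paD(1)[OF h_pa]] hX c_def)
  qed
  have ne: "- {i} \<noteq> {}" for i :: ix
    using card_compl[of i] by auto
  define S where "S = EE (Suc (Suc 0)) (- {I0}) (h I0) + EE (Suc (Suc 0)) (- {I1}) (h I1)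
    + EE (Suc (Suc 0)) (- {I2}) (h I2) + EE (Suc (Suc 0)) (- {I3}) (h I3)"
  have S: "S \<in> span_E 2 (Suc (Suc 0))"
    unfolding S_def by (intro span_E_plus span_E_gen h_KK ne)
  have "F + S \<in> span_E 2 (Suc (Suc 0))"
  proof (rule span_E_2_pairs)
    show FS: "F + S \<in> SS 2 (Suc (Suc 0))" by (intro SS_add F span_E_SS S)
    fix i j :: ix assume "i \<noteq> j"
    then obtain k l where ijkl: "distinct [i, j, k, l]" by (rule obtain_distinct_ix2)
    then have perm: "distinct [i, j, l, k]" by auto
    have "comp2 S i j = h k + h l"
      using ijkl unfolding S_def comp2_add comp2_EE[OF paD(1)[OF h_pa]]
      by (cases i; cases j; cases k; cases l) (simp_all add: add.commute)
    then have eq: "comp2 (F + S) i j = comp2 F i j + (h k + h l)" by (simp only: comp2_add)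
    have eqX: "comp2 (F + S) i j (X a * X b) = f i j a b + (if a = b then 0 else c k a b + c l a b)" for a b
      by (simp add: eq plus_fun_apply hX f_def)
    show "comp2 (F + S) i j \<in> KK 2 {i, j}"
    proof (rule KK_2I[OF comp2_props(1)[OF FS]])
      fix x
      have "x = i \<or> x = j \<or> x = k \<or> x = l" using distinct_ix_UNIV[OF ijkl] by auto
      moreover have "lform {i, j} = X i + X j" using \<open>i \<noteq> j\<close> by (simp add: lform_def)
      moreover have "f i j i k + r k i = f i j j k + r k j" "f i j i l + r l i = f i j j l + r l j"
        using r_sum[OF ijkl] r_sum[OF perm] unfolding r[OF ijkl] r[OF perm]
        by (simp_all only: bit_add_eq_0_iff) (rule bit_add_swap, assumption)+
      ultimately show "comp2 (F + S) i j (lform {i, j} * X x) = 0"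
        using ijkl edge[OF ijkl] r[OF ijkl] r[OF perm]
        by (auto simp: distrib_right lin_add[OF paD(1)[OF comp2_props(1)[OF FS]]] eqX c_def f_diag f_sym(2)[of i j j i] bit_add_eq_0_iff)
    qed
  qed
  then show ?thesis using S by (rule span_E_cancel)
qed

section \<open>Functionals of degree seven\<close>

definition coef :: "nat \<Rightarrow> pol \<Rightarrow> bit" where
  "coef d = lift (\<lambda>e. of_bool (e = (\<lambda>j. d * unit I0 j)))"

lemma lin_coef: "lin (coef d)"
  unfolding coef_def by (rule lin_lift_bit)

lemma coef_power: "coef d (X I0 ^ n) = of_bool (n = d)"
  unfolding coef_def power_X lift_mon by (auto simp: fun_eq_iff unit_def)

text \<open>The divided power of the vector with support U: evaluation of the degree-d part at U.\<close>

definition pt :: "nat \<Rightarrow> ix set \<Rightarrow> pol \<Rightarrow> bit" where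
  "pt d U p = coef d (lsub (\<lambda>i. if i \<in> U then {I0} else {}) p)"

lemma lin_pt: "lin (pt d U)"
  unfolding pt_def by (rule lin_comp[OF lin_coef lin_lsub])

lemma lsub_point_mon:
  "lsub (\<lambda>i. if i \<in> U then {I0} else {}) (mon e) = (if {i. e i \<noteq> 0} \<subseteq> U then X I0 ^ tot e else 0)"
proof (cases "{i. e i \<noteq> 0} \<subseteq> U")
  case True
  have "lsub (\<lambda>i. if i \<in> U then {I0} else {}) (mon e) = (\<Prod>i\<in>UNIV. X I0 ^ e i)"
    unfolding lsub_def subst_mon
  proof (rule prod.cong)
    fix x
    show "lform (if x \<in> U then {I0} else {}) ^ e x = X I0 ^ e x"
      using True by (cases "x \<in> U"; cases "e x = 0") (auto simp: lform_def)
  qed simp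
  then show ?thesis using True by (simp add: tot_def power_sum)
next
  case False
  then obtain i where "i \<notin> U" "0 < e i" by auto
  then have "(\<Prod>i\<in>UNIV. lform (if i \<in> U then {I0} else {}) ^ e i) = 0"
    by (intro prod_zero bexI[of _ i]) (simp_all add: lform_def zero_power)
  then show ?thesis using False by (simp add: lsub_def subst_mon)
qed

lemma pt_mon: "pt d U (mon e) = of_bool (tot e = d \<and> {i. e i \<noteq> 0} \<subseteq> U)"
  by (simp add: pt_def lsub_point_mon coef_power lin_0[OF lin_coef])

lemma supported_pt: "supported d (pt d U)"
  by (simp add: supported_def pt_mon)

lemma lsub_lform: "lsub M (lform A) = (\<Sum>i\<in>A. lform (M i))"
  by (simp add: lform_def lsub_sum)

lemma sum_const_pol: "(\<Sum>i\<in>A. p :: pol) = (if odd (card A) then p else 0)"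
  by (induction A rule: infinite_finite_induct) (auto simp del: sum_constant)

lemma lsub_point_lform: "lsub (\<lambda>i. if i \<in> U then {I0} else {}) (lform A) = (if odd (card (A \<inter> U)) then X I0 else 0)"
proof -
  have "lsub (\<lambda>i. if i \<in> U then {I0} else {}) (lform A) = (\<Sum>i\<in>A \<inter> U. X I0)"
    unfolding lsub_lform by (rule sum.mono_neutral_cong_right) (auto simp: lform_def)
  then show ?thesis by (simp only: sum_const_pol)
qed

lemma pt_lform_mult: "even (card (A \<inter> U)) \<Longrightarrow> pt d U (lform A * p) = 0"
  by (simp add: pt_def lsub_mult lsub_point_lform lin_0[OF lin_coef])

lemma pt_lsub: "pt d U (lsub M p) = pt d {i. odd (card (M i \<inter> U))} p"
proof -
  have "lform (if odd (card (M i \<inter> U)) then {I0} else {}) = (if odd (card (M i \<inter> U)) then X I0 else 0)" for i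
    by (simp add: lform_def)
  then show ?thesis
    unfolding pt_def
    by (simp add: lsub_def subst_subst) (simp add: lsub_point_lform[unfolded lsub_def])
qed

lemma Sq_power_X_7:
  assumes "n \<le> 7"
  shows "coef 7 (Sq (X I0 ^ n)) = coef 7 (X I0 ^ n)"
proof -
  let ?x = "X I0"
  have s2: "(?x + ?x^2)^2 = ?x^2 + ?x^4" and s4: "(?x + ?x^2)^4 = ?x^4 + ?x^8"
    using pol_frobenius[of ?x "?x^2" 1] pol_frobenius[of ?x "?x^2" 2] by (simp_all flip: power_mult)
  have e: "n = 0 \<or> n = 1 \<or> n = 2 \<or> n = 3 \<or> n = 4 \<or> n = 5 \<or> n = 6 \<or> n = 7" using assms by linarith
  have p3: "(?x + ?x^2)^3 = ?x^3 + ?x^4 + ?x^5 + ?x^6"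
  proof -
    have "(?x + ?x^2)^3 = (?x + ?x^2)^2 * (?x + ?x^2)" by (simp add: eval_nat_numeral)
    then show ?thesis unfolding s2 by (simp add: algebra_simps flip: power_Suc2 power_add power_Suc)
  qed
  have p5: "(?x + ?x^2)^5 = ?x^5 + ?x^6 + ?x^9 + ?x^10"
  proof -
    have "(?x + ?x^2)^5 = (?x + ?x^2)^4 * (?x + ?x^2)" by (simp add: eval_nat_numeral)
    then show ?thesis unfolding s4 by (simp add: algebra_simps flip: power_Suc2 power_add power_Suc)
  qed
  have p6: "(?x + ?x^2)^6 = ?x^6 + ?x^8 + ?x^10 + ?x^12"
  proof -
    have "(?x + ?x^2)^6 = (?x + ?x^2)^4 * (?x + ?x^2)^2" by (simp flip: power_add)
    then show ?thesis unfolding s2 s4 by (simp add: algebra_simps flip: power_add)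
  qed
  have p7: "(?x + ?x^2)^7 = ?x^7 + ?x^8 + ?x^9 + ?x^10 + ?x^11 + ?x^12 + ?x^13 + ?x^14"
  proof -
    have "(?x + ?x^2)^7 = (?x + ?x^2)^4 * (?x + ?x^2)^3" by (simp flip: power_add)
    then show ?thesis unfolding s4 p3 by (simp add: algebra_simps flip: power_add)
  qed
  have p1: "coef 7 ?x = 0" using coef_power[of 7 1] by simp
  show ?thesis
    using e by (elim disjE)
      (simp_all only: Sq_power Sq_X power_0 power_one_right s2 s4 p3 p5 p6 p7 lin_add[OF lin_coef] coef_power Sq_1 p1, simp_all)
qed

lemma pt_7_pa: "pt 7 U \<in> pa 7"
proof -
  have "pt 7 U (Sq p) = pt 7 U p" for p
  proof (rule lin_ext_mon[OF lin_comp[OF lin_pt lin_Sq] lin_pt])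
    fix e
    show "pt 7 U (Sq (mon e)) = pt 7 U (mon e)"
    proof (cases "tot e \<le> 7")
      case True
      then show ?thesis
        using Sq_power_X_7[of "tot e"]
        by (cases "{i. e i \<noteq> 0} \<subseteq> U") (simp_all add: pt_def Sq_lsub[symmetric] lsub_point_mon lin_0[OF lin_Sq])
    next
      case False
      then have "pt 7 U (Sq (mon e) + mon e) = 0"
        using highdeg_Sq_mon[of e] by (intro supported_eq_0[OF lin_pt supported_pt]) (fastforce simp: highdeg_def)
      then show ?thesis by (simp add: lin_add[OF lin_pt] bit_add_eq_0_iff)
    qed
  qed
  then show ?thesis by (simp add: pa_def lin_pt supported_pt)
qed

definition homog :: "nat \<Rightarrow> pol \<Rightarrow> bool" where
  "homog n p \<longleftrightarrow> (\<forall>e\<in>keys p. tot e = n)"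

lemma homog_X: "homog 1 (X i)"
  by (simp add: homog_def X_def)

lemma homog_mult: "homog m p \<Longrightarrow> homog n q \<Longrightarrow> homog (m + n) (p * q)"
  using keys_mult[of p q] by (fastforce simp: homog_def)

lemma homog_X_power: "homog n (X i ^ n)"
  by (simp add: homog_def power_X tot_scale)

lemma homog_pa: "F \<in> pa d \<Longrightarrow> homog n p \<Longrightarrow> n \<noteq> d \<Longrightarrow> F p = 0"
  by (rule supported_eq_0[OF paD(1,2)]) (auto simp: homog_def)

lemma pa_X4: "F \<in> pa d \<Longrightarrow> i + j + k + l \<noteq> d \<Longrightarrow> F (X a ^ i * X b ^ j * X c ^ k * X e ^ l) = 0"
  by (erule homog_pa[where n = "i + j + k + l"]) (intro homog_mult homog_X_power)

lemma pa_7_relations: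
  assumes h: "h \<in> pa 7"
  shows "h (X a * X b^2 * X c^4) = h (X b * X a^2 * X c^4)"
    "h (X a * X b^2 * X c^4) = h (X a * X c^2 * X b^4)"
    "h (X a^3 * X b^4) = h (X b^3 * X a^4)"
    "h (X a^3 * X b^2 * X c^2) = h (X a^4 * X b * X c^2)"
    "h (X a * X b^2 * X c^2 * X e^2) = h (X b * X a^2 * X c^2 * X e^2)"
proof -
  note add = lin_add[OF paD(1)[OF h]]
  have Z: "h (X a ^ i * X b ^ j * X c ^ k * X e ^ l) = 0" if "i + j + k + l \<noteq> 7" for a b c e i j k l
    using pa_X4[OF h that] .
  have s2: "Sq (X i ^ 2) = X i ^ 2 + X i ^ 4" and s4: "Sq (X i ^ 4) = X i ^ 4 + X i ^ 8"
    and s3: "Sq (X i ^ 3) = X i ^ 3 + X i ^ 4 + X i ^ 5 + X i ^ 6" for i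
  proof -
    show 2: "Sq (X i ^ 2) = X i ^ 2 + X i ^ 4" and 4: "Sq (X i ^ 4) = X i ^ 4 + X i ^ 8"
      using pol_frobenius[of "X i" "X i ^ 2" 1] pol_frobenius[of "X i" "X i ^ 2" 2]
      by (simp_all add: Sq_power flip: power_mult)
    have "Sq (X i ^ 3) = Sq (X i ^ 2 * X i)" by (simp flip: power_Suc2)
    also have "\<dots> = Sq (X i ^ 2) * (X i + X i ^ 2)" by (simp only: Sq_mult Sq_X)
    finally show "Sq (X i ^ 3) = X i ^ 3 + X i ^ 4 + X i ^ 5 + X i ^ 6"
      unfolding 2 by (simp add: algebra_simps flip: power_Suc2 power_add power_Suc)
  qed
  have s1: "Sq (X i ^ 1) = X i ^ 1 + X i ^ 2" and s0: "Sq (X i ^ 0) = X i ^ 0" for i by simp_all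
  note expand = Sq_mult s0 s1 s2 s3 s4 distrib_left distrib_right add
  have inv: "h (Sq (X a ^ i * X b ^ j * X c ^ k * X e ^ l)) = 0" if "i + j + k + l < 7" for a b c e i j k l
    using paD(3)[OF h] Z[of i j k l] that by simp
  have "h (X a ^ 1 * X b ^ 2 * X c ^ 4 * X e ^ 0) = h (X a ^ 2 * X b ^ 1 * X c ^ 4 * X e ^ 0)"
    using inv[of 1 1 4 0 a b c e] by (simp add: expand Z bit_add_eq_0_iff del: power_one_right power_0 One_nat_def)
  then show "h (X a * X b^2 * X c^4) = h (X b * X a^2 * X c^4)" by (simp add: mult.commute mult.left_commute)
  have "h (X a ^ 1 * X b ^ 2 * X c ^ 4 * X e ^ 0) = h (X a ^ 1 * X b ^ 4 * X c ^ 2 * X e ^ 0)"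
    using inv[of 1 2 2 0 a b c e] by (simp add: expand Z bit_add_eq_0_iff del: power_one_right power_0 One_nat_def)
  then show "h (X a * X b^2 * X c^4) = h (X a * X c^2 * X b^4)" by (simp add: mult.commute mult.left_commute)
  have "h (X a ^ 3 * X b ^ 4 * X c ^ 0 * X e ^ 0) = h (X a ^ 4 * X b ^ 3 * X c ^ 0 * X e ^ 0)"
    using inv[of 3 3 0 0 a b c e] by (simp add: expand Z bit_add_eq_0_iff del: power_one_right power_0 One_nat_def)
  then show "h (X a^3 * X b^4) = h (X b^3 * X a^4)" by (simp add: mult.commute mult.left_commute)
  have "h (X a ^ 3 * X b ^ 2 * X c ^ 2 * X e ^ 0) = h (X a ^ 4 * X b ^ 1 * X c ^ 2 * X e ^ 0)"
    using inv[of 3 1 2 0 a b c e] by (simp add: expand Z bit_add_eq_0_iff del: power_one_right power_0 One_nat_def)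
  then show "h (X a^3 * X b^2 * X c^2) = h (X a^4 * X b * X c^2)" by simp
  have "h (X a ^ 1 * X b ^ 2 * X c ^ 2 * X e ^ 2) = h (X a ^ 2 * X b ^ 1 * X c ^ 2 * X e ^ 2)"
    using inv[of 1 1 2 2 a b c e] by (simp add: expand Z bit_add_eq_0_iff del: power_one_right power_0 One_nat_def)
  then show "h (X a * X b^2 * X c^2 * X e^2) = h (X b * X a^2 * X c^2 * X e^2)" by (simp add: mult.commute mult.left_commute)
qed

definition mU :: "ix set \<Rightarrow> pol" where
  "mU U = (case filter (\<lambda>i. i \<in> U) [I0, I1, I2, I3] of
     [] \<Rightarrow> 1 | [a] \<Rightarrow> X a * (X a * X a * X a)^2 | [a, b] \<Rightarrow> X a * (X b * X b * X b)^2
   | [a, b, c] \<Rightarrow> X a * (X b * X c * X c)^2 | a # b # c # e # _ \<Rightarrow> X a * (X b * X c * X e)^2)"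

lemma supp_unit_add: "{i. (unit a + m) i \<noteq> 0} = insert a {i. m i \<noteq> 0}"
  by (auto simp: plus_fun_apply unit_def)

lemma pt_X_mult: "pt (Suc d) U (X a * p) = (if a \<in> U then pt d U p else 0)"
proof (rule lin_ext_mon[OF lin_comp[OF lin_pt lin_mult(1)]])
  show "lin (\<lambda>p. if a \<in> U then pt d U p else 0)"
    by (cases "a \<in> U") (simp_all add: lin_pt lin_zero)
  show "pt (Suc d) U (X a * mon e) = (if a \<in> U then pt d U (mon e) else 0)" for e
    unfolding X_def mon_add[symmetric] pt_mon supp_unit_add by simp
qed

lemma pt_0_1: "pt 0 U 1 = 1"
  using pt_mon[of 0 U 0] by (simp add: zero_fun_apply)

lemma pt_X: "pt 1 U (X a) = of_bool (a \<in> U)"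
  using pt_X_mult[of 0 U a 1] by (simp add: pt_0_1)

lemma pt_7_X_cubic_square:
  "pt 7 U (X i * (X a * X b * X c)^2) = of_bool ({i, a, b, c} \<subseteq> U)"
proof -
  have "X i * (X a * X b * X c)^2 = X i * (X a * (X a * (X b * (X b * (X c * (X c * 1))))))"
    by (simp add: power2_eq_square algebra_simps)
  moreover have seven: "7 = Suc (Suc (Suc (Suc (Suc (Suc (Suc 0))))))" by simp
  ultimately show ?thesis
    using pt_0_1[of U] by (simp only: pt_X_mult) simp
qed

lemma pt_7_mU:
  assumes "W \<noteq> {}"
  shows "pt 7 U (mU W) = of_bool (W \<subseteq> U)"
proof -
  obtain i a b c where m: "mU W = X i * (X a * X b * X c)^2" "{i, a, b, c} = W"
  proof -
    have "\<exists>i a b c. mU W = X i * (X a * X b * X c)^2 \<and> {i, a, b, c} = W"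
    proof -
      have W: "W = set (filter (\<lambda>i. i \<in> W) [I0, I1, I2, I3])"
      proof (rule set_eqI)
        show "x \<in> W \<longleftrightarrow> x \<in> set (filter (\<lambda>i. i \<in> W) [I0, I1, I2, I3])" for x
          by (cases x) auto
      qed
      let ?l = "filter (\<lambda>i. i \<in> W) [I0, I1, I2, I3]"
      have "length ?l \<le> 4" using length_filter_le[of "\<lambda>i. i \<in> W" "[I0, I1, I2, I3]"] by (simp del: filter.simps)
      moreover have "?l \<noteq> []" using W assms by (metis set_empty)
      ultimately consider a where "?l = [a]" | a b where "?l = [a, b]" | a b c where "?l = [a, b, c]"
        | a b c e where "?l = [a, b, c, e]"
        by (cases ?l rule: list.exhaust; cases "tl ?l" rule: list.exhaust; cases "tl (tl ?l)" rule: list.exhaust;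
            cases "tl (tl (tl ?l))" rule: list.exhaust) (auto simp del: filter.simps)
      then show ?thesis
        unfolding mU_def by cases (subst (2) W, force simp del: filter.simps)+
    qed
    then show ?thesis using that by blast
  qed
  then show ?thesis by (simp only: pt_7_X_cubic_square)
qed

lemma sum_between_sets:
  "(\<Sum>U\<in>UNIV. of_bool (W \<subseteq> U) * of_bool (U \<subseteq> V) :: bit) = of_bool (W = (V :: ix set))"
proof -
  have "(\<Sum>U\<in>UNIV. of_bool (W \<subseteq> U) * of_bool (U \<subseteq> V) :: bit) =
    (\<Sum>U\<in>Pow UNIV. (\<Prod>i\<in>U. of_bool (i \<in> V)) * (\<Prod>i\<in>UNIV - U. of_bool (i \<notin> W)))"
  proof (rule sum.cong)
    fix U :: "ix set"
    have *: "(\<Prod>i\<in>A. of_bool (P i)) = (of_bool (\<forall>i\<in>A. P i) :: bit)" for A :: "ix set" and P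
      by (induction A rule: infinite_finite_induct) auto
    show "of_bool (W \<subseteq> U) * of_bool (U \<subseteq> V) = (\<Prod>i\<in>U. of_bool (i \<in> V) :: bit) * (\<Prod>i\<in>UNIV - U. of_bool (i \<notin> W))"
      unfolding * by (auto simp: of_bool_def)
  qed simp
  also have "\<dots> = (\<Prod>i\<in>UNIV. of_bool (i \<in> V) + of_bool (i \<notin> W))"
    by (rule prod_add[symmetric]) simp
  also have "\<dots> = of_bool (W = V)"
  proof (cases "W = V")
    case True
    have "(\<Prod>i\<in>UNIV. of_bool (i \<in> V) + of_bool (i \<notin> W) :: bit) = (\<Prod>i\<in>(UNIV :: ix set). 1)"
      by (rule prod.cong) (auto simp: True of_bool_def)
    then show ?thesis using True by simp
  next
    case False
    then obtain i where "(i \<in> W) \<noteq> (i \<in> V)" by blast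
    then have "(\<Prod>i\<in>UNIV. of_bool (i \<in> V) + of_bool (i \<notin> W) :: bit) = 0"
      by (intro prod_zero bexI[of _ i]) (auto simp: of_bool_def)
    then show ?thesis using False by simp
  qed
  finally show ?thesis .
qed

lemma moebius:
  "(\<Sum>U\<in>UNIV. (\<Sum>V\<in>UNIV. of_bool (U \<subseteq> V) * T V) * of_bool (W \<subseteq> U)) = (T W :: bit)" for W :: "ix set"
proof -
  have "(\<Sum>U\<in>UNIV. (\<Sum>V\<in>UNIV. of_bool (U \<subseteq> V) * T V) * of_bool (W \<subseteq> U)) =
    (\<Sum>U\<in>UNIV. \<Sum>V\<in>UNIV. of_bool (W \<subseteq> U) * of_bool (U \<subseteq> V) * T V)"
    unfolding sum_distrib_right by (intro sum.cong refl) (simp only: ac_simps)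
  also have "\<dots> = (\<Sum>V\<in>UNIV. (\<Sum>U\<in>UNIV. of_bool (W \<subseteq> U) * of_bool (U \<subseteq> V)) * T V)"
    by (subst sum.swap) (simp only: sum_distrib_right)
  also have "\<dots> = T W" by (simp add: sum_between_sets)
  finally show ?thesis .
qed

lemma annihilator_constant:
  fixes a :: "ix set \<Rightarrow> bit"
  assumes "\<And>W. W \<noteq> {} \<Longrightarrow> W \<noteq> UNIV \<Longrightarrow> (\<Sum>V\<in>UNIV. of_bool (W \<subseteq> V) * a V) = 0" and "U \<noteq> {}"
  shows "a U = a UNIV"
proof -
  have "a U = (\<Sum>W\<in>UNIV. (\<Sum>V\<in>UNIV. of_bool (W \<subseteq> V) * a V) * of_bool (U \<subseteq> W))"
    by (rule moebius[symmetric])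
  also have "\<dots> = (\<Sum>W\<in>{UNIV}. (\<Sum>V\<in>UNIV. of_bool (W \<subseteq> V) * a V) * of_bool (U \<subseteq> W))"
    by (rule sum.mono_neutral_right) (use assms in \<open>auto simp: of_bool_def\<close>)
  also have "\<dots> = a UNIV"
    by (simp add: top.extremum_unique[unfolded top_set_def])
  finally show ?thesis .
qed

definition sc :: "bit \<Rightarrow> (pol \<Rightarrow> bit) \<Rightarrow> pol \<Rightarrow> bit" where
  "sc c F p = c * F p"

lemma sc_0 [simp]: "sc 0 F = 0" and sc_1 [simp]: "sc 1 F = F"
  by (simp_all add: sc_def fun_eq_iff zero_fun_apply)

lemma sc_pa: "F \<in> pa d \<Longrightarrow> sc c F \<in> pa d"
  by (cases c) (simp_all add: pa_0)

lemma sum_pa: "(\<And>i. i \<in> A \<Longrightarrow> F i \<in> pa d) \<Longrightarrow> (\<Sum>i\<in>A. F i) \<in> pa d"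
  by (induction A rule: infinite_finite_induct) (auto simp: pa_0 pa_add)

text \<open>The coefficient of the divided power of the vector \<open>U\<close>, by Moebius inversion, and the remainder, which comes from degree 2.\<close>

definition cc :: "(pol \<Rightarrow> bit) \<Rightarrow> ix set \<Rightarrow> bit" where
  "cc h U = (\<Sum>V\<in>UNIV. of_bool (U \<subseteq> V) * h (mU V))"

definition qq :: "(pol \<Rightarrow> bit) \<Rightarrow> pol \<Rightarrow> bit" where
  "qq h = h + (\<Sum>U\<in>UNIV. sc (cc h U) (pt 7 U))"

lemma qq_apply: "qq h p = h p + (\<Sum>U\<in>UNIV. cc h U * pt 7 U p)"
  by (simp add: qq_def plus_fun_apply sum_fun_apply sc_def)

lemma qq_pa: "h \<in> pa 7 \<Longrightarrow> qq h \<in> pa 7"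
  unfolding qq_def by (intro pa_add sum_pa sc_pa pt_7_pa)

lemma qq_mU: "W \<noteq> {} \<Longrightarrow> qq h (mU W) = 0"
  using moebius[of "\<lambda>V. h (mU V)" W] by (simp only: qq_apply pt_7_mU cc_def bit_add_self not_False_eq_True)

lemma pa_7_words:
  assumes h: "h \<in> pa 7" and m: "\<And>W. W \<noteq> {} \<Longrightarrow> h (mU W) = 0"
  shows "h (X a * X b ^ 2 * X c ^ 4) = 0"
proof -
  define T where "T a b c = h (X a * X b ^ 2 * X c ^ 4)" for a b c
  have s1: "T a b c = T b a c" and s2: "T a b c = T a c b" for a b c
    unfolding T_def using pa_7_relations(1,2)[OF h] by blast+
  have s3: "T a a b = T b b a" for a b
  proof -
    have "T x x y = h (X x ^ 3 * X y ^ 4)" for x y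
      by (simp add: T_def flip: power_Suc)
    then show ?thesis using pa_7_relations(3)[OF h] by simp
  qed
  have d: "T I0 I0 I0 = 0" "T I1 I1 I1 = 0" "T I2 I2 I2 = 0" "T I3 I3 I3 = 0"
    "T I0 I1 I1 = 0" "T I0 I2 I2 = 0" "T I0 I3 I3 = 0" "T I1 I2 I2 = 0" "T I1 I3 I3 = 0" "T I2 I3 I3 = 0"
    "T I0 I1 I2 = 0" "T I0 I1 I3 = 0" "T I0 I2 I3 = 0" "T I1 I2 I3 = 0"
    using m[of "{I0}"] m[of "{I1}"] m[of "{I2}"] m[of "{I3}"] m[of "{I0, I1}"] m[of "{I0, I2}"] m[of "{I0, I3}"]
      m[of "{I1, I2}"] m[of "{I1, I3}"] m[of "{I2, I3}"] m[of "{I0, I1, I2}"] m[of "{I0, I1, I3}"]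
      m[of "{I0, I2, I3}"] m[of "{I1, I2, I3}"]
    by (simp_all add: T_def mU_def eval_nat_numeral algebra_simps)
  have "T a b c = 0"
    by (cases a; cases b; cases c; metis d s1 s2 s3)
  then show ?thesis by (simp add: T_def)
qed

lemma cubic_cases:
  assumes "tot m = 3"
  obtains (two) b c where "mon m = X b * X c * X c" | (three) j k l i where "distinct [i, j, k, l]" "mon m = X j * X k * X l"
proof -
  obtain a m1 where m1: "m = unit a + m1" "tot m1 = 2" using assms by (auto elim: tot_SucE simp: eval_nat_numeral)
  obtain b m2 where m2: "m1 = unit b + m2" "tot m2 = 1" using m1(2) by (auto elim: tot_SucE simp: eval_nat_numeral)
  obtain c where m3: "m2 = unit c" using m2(2) tot_eq_1D by blast
  have m: "mon m = X a * X b * X c" by (simp add: m1(1) m2(1) m3 mon_add X_def mult.assoc)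
  show ?thesis
  proof (cases "distinct [a, b, c]")
    case True
    then obtain i where "distinct [a, b, c, i]" by (rule obtain_distinct_ix3)
    then show ?thesis using three[of i a b c] m by auto
  next
    case False
    then consider "a = b" | "a = c" | "b = c" by auto
    then show ?thesis
    proof cases
      case 1
      then show ?thesis using m two[of c b] by (simp add: ac_simps)
    next
      case 2
      then show ?thesis using m two[of b c] by (simp add: ac_simps)
    next
      case 3
      then show ?thesis using m two[of a c] by (simp add: ac_simps)
    qed
  qed
qed

lemma pa_7_SS:
  assumes h: "h \<in> pa 7" and m: "\<And>W. W \<noteq> {} \<Longrightarrow> h (mU W) = 0"
  shows "h \<in> SS 2 1"
proof -
  have T0: "h (X a * X b ^ 2 * X c ^ 4) = 0" for a b c by (rule pa_7_words[OF assms])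
  have "h (X a * mon e ^ 2) = 0" for a e
  proof (cases "tot e = 3")
    case False
    have "X a = xs {a}" by (simp add: xs_def)
    then show ?thesis using supported_xs_square[OF paD(1,2)[OF h], of "{a}" e] False by simp
  next
    case True
    then show ?thesis
    proof (cases rule: cubic_cases)
      case (two b c)
      have "X a * mon e ^ 2 = X a * X b ^ 2 * X c ^ 4"
        by (simp add: two power_mult_distrib mult.assoc flip: power_add)
      then show ?thesis by (simp only: T0)
    next
      case (three j k l i)
      then have e: "X a * mon e ^ 2 = X a * X j ^ 2 * X k ^ 2 * X l ^ 2"
        by (simp add: power_mult_distrib mult.assoc)
      show ?thesis
      proof (cases "a = i")
        case True
        define Y where "Y x = h (X x * (\<Prod>y\<in>- {x}. X y ^ 2))" for x
        have prod: "(\<Prod>y\<in>- {a}. X y ^ 2) = X b ^ 2 * X c ^ 2 * X d ^ 2" if abcd: "distinct [a, b, c, d]" for a b c d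
        proof -
          have "- {a} = {b, c, d}" using distinct_ix_UNIV[OF abcd] abcd by auto
          then show ?thesis using abcd by (simp add: mult.assoc)
        qed
        have Y: "Y x = Y y" for x y
        proof (cases "x = y")
          case False
          then obtain c d where xy: "distinct [x, y, c, d]" by (rule obtain_distinct_ix2)
          then have "distinct [y, x, c, d]" by auto
          then show ?thesis
            using pa_7_relations(5)[OF h, of x y c d] by (simp add: Y_def prod[OF xy] prod mult.assoc)
        qed simp
        have "Y I0 = 0"
          using m[of UNIV] prod[of I0 I1 I2 I3] by (simp add: Y_def mU_def power_mult_distrib)
        then have "Y i = 0" using Y by metis
        then show ?thesis unfolding e unfolding True by (simp add: Y_def prod[OF three(1)] mult.assoc)
      next
        case False
        have Z: "h (X b * X b ^ 2 * X c ^ 2 * X d ^ 2) = 0" for b c d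
        proof -
          have "h (X b ^ 3 * X c ^ 2 * X d ^ 2) = h (X b ^ 4 * X c * X d ^ 2)" by (rule pa_7_relations(4)[OF h])
          also have "\<dots> = 0" using T0[of c d b] by (simp add: ac_simps)
          finally show ?thesis by (simp add: eval_nat_numeral ac_simps)
        qed
        have "a = j \<or> a = k \<or> a = l" using False distinct_ix_UNIV[OF three(1)] UNIV_I[of a] by auto
        then show ?thesis unfolding e using Z[of j k l] Z[of k j l] Z[of l j k] by (auto simp: ac_simps)
      qed
    qed
  qed
  then have "h \<in> step (pa 2)" using h by (intro stepI) simp_all
  then show ?thesis by (simp add: SS_Suc)
qed

lemma qq_SS: "h \<in> pa 7 \<Longrightarrow> qq h \<in> SS 2 1"
  by (rule pa_7_SS[OF qq_pa qq_mU])

lemma SS_X_square: "F \<in> SS d (Suc s) \<Longrightarrow> F (X i * p ^ 2) = 0"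
proof -
  assume F: "F \<in> SS d (Suc s)"
  have "X i = xs {i}" by (simp add: xs_def)
  moreover have "cons (\<lambda>i. comp i F) (xs {i} * p ^ 2) = 0"
    by (rule cons_xs_other[OF SS_lin[OF SS_SucE(2)[OF F]]]) simp
  ultimately show ?thesis by (metis SS_SucE(1)[OF F])
qed

lemma qq_expand: "h = qq h + (\<Sum>U\<in>UNIV. sc (cc h U) (pt 7 U))"
  by (simp add: qq_def add.assoc)

lemma cubic_support:
  assumes "W \<noteq> {}" "W \<noteq> UNIV"
  obtains a b c where "{a, b, c} = (W :: ix set)"
proof -
  have "card W \<noteq> 0" using assms by simp
  moreover have "card W < card (UNIV :: ix set)" using assms by (intro psubset_card_mono) auto
  ultimately have "card W = 1 \<or> card W = 2 \<or> card W = 3" unfolding card_ix by arith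
  then show ?thesis
  proof (elim disjE)
    assume "card W = 1"
    then obtain a where "W = {a}" by (auto simp: card_1_singleton_iff)
    then show ?thesis using that[of a a a] by simp
  next
    assume "card W = 2"
    then obtain a b where "W = {a, b}" by (auto simp: card_2_iff)
    then show ?thesis using that[of a a b] by simp
  next
    assume "card W = 3"
    then obtain a b c where "W = {a, b, c}" by (auto simp: card_3_iff)
    then show ?thesis using that[of a b c] by simp
  qed
qed

lemma cc_relation:
  assumes h: "\<And>i. h i \<in> pa 7" and rel: "\<And>p. (\<Sum>i\<in>UNIV. h i (X i * p)) = 0" and U: "U \<noteq> {}"
  shows "(\<Sum>i\<in>U. cc (h i) U) = (\<Sum>i\<in>UNIV. cc (h i) UNIV)"
proof (rule annihilator_constant[OF _ U])
  fix W :: "ix set"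
  assume "W \<noteq> {}" "W \<noteq> UNIV"
  then obtain a b c where W: "{a, b, c} = W" by (rule cubic_support)
  have "h i (X i * (X a * X b * X c)^2) = (\<Sum>U\<in>UNIV. cc (h i) U * of_bool (insert i W \<subseteq> U))" for i
  proof -
    have "h i (X i * (X a * X b * X c)^2) = qq (h i) (X i * (X a * X b * X c)^2)
        + (\<Sum>U\<in>UNIV. cc (h i) U * pt 7 U (X i * (X a * X b * X c)^2))"
      by (simp add: qq_apply)
    also have "qq (h i) (X i * (X a * X b * X c)^2) = 0"
      using SS_X_square[of _ 2 0] qq_SS[OF h] by simp
    finally show ?thesis by (simp only: pt_7_X_cubic_square W[symmetric] add_0)
  qed
  then have "(\<Sum>i\<in>UNIV. \<Sum>U\<in>UNIV. cc (h i) U * of_bool (insert i W \<subseteq> U)) = 0"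
    using rel[of "(X a * X b * X c)^2"] by simp
  moreover have "(\<Sum>i\<in>UNIV. \<Sum>U\<in>UNIV. cc (h i) U * of_bool (insert i W \<subseteq> U)) =
      (\<Sum>U\<in>UNIV. of_bool (W \<subseteq> U) * (\<Sum>i\<in>U. cc (h i) U))"
  proof (subst sum.swap, rule sum.cong)
    fix U :: "ix set"
    have "(\<Sum>i\<in>UNIV. cc (h i) U * of_bool (insert i W \<subseteq> U)) = (\<Sum>i\<in>U. of_bool (W \<subseteq> U) * cc (h i) U)"
      by (rule sum.mono_neutral_cong_right) auto
    then show "(\<Sum>i\<in>UNIV. cc (h i) U * of_bool (insert i W \<subseteq> U)) = of_bool (W \<subseteq> U) * (\<Sum>i\<in>U. cc (h i) U)"
      by (simp add: sum_distrib_left)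
  qed simp
  ultimately show "(\<Sum>V\<in>UNIV. of_bool (W \<subseteq> V) * (\<Sum>i\<in>V. cc (h i) V)) = 0" by simp
qed

lemma sum_const_bit: "(\<Sum>i\<in>A. c :: bit) = of_bool (odd (card A)) * c"
  by (induction A rule: infinite_finite_induct) (auto simp: of_bool_def simp del: sum_constant)

lemma cc_0: "cc 0 U = 0"
  by (simp add: cc_def zero_fun_apply)

lemma cc_KK:
  assumes h: "h \<in> KK 7 v" and v: "v \<noteq> {}" and odd: "odd (card (v \<inter> U))"
  shows "cc h U = 0"
proof -
  let ?h = "\<lambda>i. if i \<in> v then h else 0"
  have eq: "(\<Sum>i\<in>U. cc (?h i) U) = of_bool (odd (card (v \<inter> U))) * cc h U" for U
  proof -
    have "(\<Sum>i\<in>U. cc (?h i) U) = (\<Sum>i\<in>v \<inter> U. cc h U)"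
      by (rule sum.mono_neutral_cong_right) (auto simp: cc_0)
    then show ?thesis by (simp only: sum_const_bit)
  qed
  have const: "(\<Sum>i\<in>U. cc (?h i) U) = (\<Sum>i\<in>UNIV. cc (?h i) UNIV)" if "U \<noteq> {}" for U
  proof (rule cc_relation[OF _ _ that])
    show "?h i \<in> pa 7" for i using KKD(1)[OF h] by (simp add: pa_0)
    show "(\<Sum>i\<in>UNIV. ?h i (X i * p)) = 0" for p
      using KKD(2)[OF h, of p] by (simp add: sum_if_mem_ix lin_lform[OF paD(1)[OF KKD(1)[OF h]]])
  qed
  obtain U0 where U0: "U0 \<noteq> {}" "even (card (v \<inter> U0))"
  proof (cases "\<exists>i. i \<notin> v")
    case True
    then obtain i where "i \<notin> v" by blast
    then show ?thesis using that[of "{i}"] by simp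
  next
    case False
    then have "v = UNIV" by auto
    then show ?thesis using that[of UNIV] by (simp add: card_ix)
  qed
  have "U \<noteq> {}" using odd by auto
  then have "of_bool (odd (card (v \<inter> U))) * cc h U = of_bool (odd (card (v \<inter> U0))) * cc h U0"
    using const[of U] const[OF U0(1)] unfolding eq by simp
  then show ?thesis using U0(2) odd by simp
qed

lemma SS_KK_E1:
  assumes q: "q \<in> SS d 1" and K: "\<And>p. q (lform v * p) = 0" and v: "v \<noteq> {}"
  obtains l where "l \<in> KK d v" "q = E1 v l"
proof -
  have q': "q \<in> SS d (Suc 0)" using q by simp
  note q1 = SS_SucE[OF q']
  let ?H = "\<lambda>i j. if i \<in> v then comp j q else 0"
  have lin: "lin (?H i j)" for i j using SS_lin[OF q1(2)] by (simp add: lin_zero_fun)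
  have "cons (?H i) = (if i \<in> v then q else 0)" for i
    using q1(1) by (auto simp: cons_0)
  then have "\<forall>p. (\<Sum>i\<in>UNIV. cons (?H i) (X i * p)) = 0"
    using K by (simp add: sum_if_mem_ix lin_lform[OF SS_lin[OF q]])
  then have H: "?H i j = ?H j i" "(\<Sum>i\<in>UNIV. ?H i i (X i * p)) = 0" for i j p
    using sum_X_cons_eq_0_iff[of ?H, OF lin] by blast+
  obtain i0 where i0: "i0 \<in> v" using v by blast
  define l where "l = comp i0 q"
  have comp: "comp i q = (if i \<in> v then l else 0)" for i
    using H(1)[of i i0] i0 by (auto simp: l_def split: if_splits)
  have "lin l" unfolding l_def by (rule SS_lin[OF q1(2)])
  have "l (lform v * p) = 0" for p
    using H(2)[of p] by (simp add: lin_lform[OF \<open>lin l\<close>] sum_if_mem_ix[symmetric] comp cong: if_cong)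
  then have "l \<in> KK d v" using q1(2)[of i0] by (simp add: KK_def l_def)
  moreover have "q = E1 v l"
    by (subst q1(1)) (simp add: E1_def comp)
  ultimately show ?thesis by (rule that)
qed

lemma KK_7:
  assumes h: "h \<in> KK 7 v" and v: "v \<noteq> {}"
  obtains l where "l \<in> KK 2 v" "h = E1 v l + (\<Sum>U | U \<noteq> {} \<and> even (card (v \<inter> U)). sc (cc h U) (pt 7 U))"
proof -
  have pa: "h \<in> pa 7" by (rule KKD(1)[OF h])
  have pt0: "pt 7 {} = 0"
  proof
    fix p
    show "pt 7 {} p = 0 p"
    proof (rule lin_ext_mon[OF lin_pt lin_zero_fun])
      fix e :: "ix \<Rightarrow> nat"
      have "{i. e i \<noteq> 0} \<subseteq> {} \<Longrightarrow> e = 0" by (auto simp: fun_eq_iff zero_fun_apply)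
      then have "\<not> (tot e = 7 \<and> {i. e i \<noteq> 0} \<subseteq> {})" by fastforce
      then show "pt 7 {} (mon e) = 0 (mon e)" by (simp add: pt_mon zero_fun_apply del: subset_empty)
    qed
  qed
  have sum: "(\<Sum>U\<in>UNIV. sc (cc h U) (pt 7 U)) = (\<Sum>U | U \<noteq> {} \<and> even (card (v \<inter> U)). sc (cc h U) (pt 7 U))"
  proof (rule sum.mono_neutral_right)
    show "\<forall>U\<in>UNIV - {U. U \<noteq> {} \<and> even (card (v \<inter> U))}. sc (cc h U) (pt 7 U) = 0"
      using cc_KK[OF h v] pt0 by (auto simp: sc_def fun_eq_iff zero_fun_apply)
  qed simp_all
  have "qq h (lform v * p) = 0" for p
  proof -
    have "cc h U * pt 7 U (lform v * p) = 0" for U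
      using cc_KK[OF h v, of U] pt_lform_mult[of v U 7 p] by (cases "even (card (v \<inter> U))") simp_all
    then have "(\<Sum>U\<in>UNIV. cc h U * pt 7 U (lform v * p)) = 0" by (intro sum.neutral ballI)
    then show ?thesis using KKD(2)[OF h] by (simp add: qq_apply)
  qed
  then obtain l where "l \<in> KK 2 v" "qq h = E1 v l"
    using SS_KK_E1[OF qq_SS[OF pa] _ v] by blast
  then show ?thesis using that qq_expand[of h] sum by simp
qed

text \<open>The second value is the number modulo 2 of flags \<open>(v, u)\<close> in the sum.\<close>

inductive rep :: "nat \<Rightarrow> (pol \<Rightarrow> bit) \<Rightarrow> bit \<Rightarrow> bool" for s where
  zero: "rep s 0 0"
| flag: "rep s F b \<Longrightarrow> v \<noteq> {} \<Longrightarrow> u \<noteq> {} \<Longrightarrow> even (card (v \<inter> u)) \<Longrightarrow> rep s (F + EE s v (pt 7 u)) (b + 1)"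
| low: "rep s F b \<Longrightarrow> v \<noteq> {} \<Longrightarrow> l \<in> KK 2 v \<Longrightarrow> rep s (F + EE (Suc s) v l) b"

lemma rep_plus: "rep s F b \<Longrightarrow> rep s G c \<Longrightarrow> rep s (F + G) (b + c)"
proof (induction rule: rep.induct)
  case (flag F b v u)
  then show ?case using rep.flag[of s "F + G" "b + c" v u] by (simp add: ac_simps)
next
  case (low F b v l)
  then show ?case using rep.low[of s "F + G" "b + c" v l] by (simp add: ac_simps)
qed simp

lemma rep_flag1: "v \<noteq> {} \<Longrightarrow> u \<noteq> {} \<Longrightarrow> even (card (v \<inter> u)) \<Longrightarrow> rep s (EE s v (pt 7 u)) 1"
  using rep.flag[OF rep.zero, of v u s] by (metis add_0)

lemma rep_low1: "v \<noteq> {} \<Longrightarrow> l \<in> KK 2 v \<Longrightarrow> rep s (EE (Suc s) v l) 0"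
  using rep.low[OF rep.zero, of v l s] by (metis add_0)

lemma rep_sum: "(\<And>i. i \<in> A \<Longrightarrow> \<exists>b. rep s (F i) b) \<Longrightarrow> \<exists>b. rep s (\<Sum>i\<in>A. F i) b"
proof (induction A rule: infinite_finite_induct)
  case (insert x A)
  then show ?case by (metis insertCI rep_plus sum.insert)
qed (auto intro: rep.zero)

lemma rep_cancel: "\<exists>b. rep s (F + G) b \<Longrightarrow> \<exists>b. rep s G b \<Longrightarrow> \<exists>b. rep s F b"
  using rep_plus[of s "F + G" _ G] by (metis add.assoc fun_add_self add.right_neutral)

lemma rep_sc: "\<exists>b. rep s F b \<Longrightarrow> \<exists>b. rep s (sc c F) b"
  by (cases c) (auto intro: rep.zero)

lemma EE_sc: "EE s v (sc c h) = sc c (EE s v h)"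
  by (cases c) (simp_all add: EE_zero)

lemma span_E_2_rep: "F \<in> span_E 2 (Suc s) \<Longrightarrow> rep s F 0"
  by (induction rule: span_E.induct) (auto intro: rep.intros)

theorem SS_7_rep:
  assumes "F \<in> SS 7 s" "3 \<le> s"
  shows "\<exists>b. rep s F b"
proof -
  have "F \<in> span_E 7 s" using SS_span_E[OF assms] by simp
  then show ?thesis
  proof (induction rule: span_E.induct)
    case zero
    show ?case using rep.zero by blast
  next
    case (add F h v)
    obtain l where l: "l \<in> KK 2 v"
      "h = E1 v l + (\<Sum>U | U \<noteq> {} \<and> even (card (v \<inter> U)). sc (cc h U) (pt 7 U))"
      using KK_7[OF add(2,3)] by blast
    have "\<exists>b. rep s (\<Sum>U | U \<noteq> {} \<and> even (card (v \<inter> U)). EE s v (sc (cc h U) (pt 7 U))) b"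
      unfolding EE_sc using add(3) by (intro rep_sum rep_sc) (auto intro: rep_flag1)
    moreover have "EE s v h = EE (Suc s) v l + (\<Sum>U | U \<noteq> {} \<and> even (card (v \<inter> U)). EE s v (sc (cc h U) (pt 7 U)))"
      by (subst l(2)) (simp only: EE_add EE_sum EE_Suc_right)
    ultimately have "\<exists>b. rep s (EE s v h) b" using rep_plus[OF rep_low1[OF add(3) l(1)]] by auto
    then show ?case using add.IH rep_plus by blast
  qed
qed

lemma cc_UNIV: "cc h UNIV = h (mU UNIV)"
proof -
  have "cc h UNIV = (\<Sum>V\<in>{UNIV}. of_bool (UNIV \<subseteq> V) * h (mU V))"
    unfolding cc_def by (rule sum.mono_neutral_right) auto
  then show ?thesis by simp
qed

lemma bit_sum_card: "(\<Sum>i\<in>A. f i) = (of_bool (odd (card {i \<in> A. f i = 1})) :: bit)" if "finite A"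
proof -
  have "(\<Sum>i\<in>A. f i) = (\<Sum>i\<in>{i \<in> A. f i = 1}. 1)"
    by (rule sum.mono_neutral_cong_right) (use that in auto)
  then show ?thesis by (simp only: sum_const_bit mult_1_right)
qed

lemma pt_7_KK: "even (card (v \<inter> u)) \<Longrightarrow> pt 7 u \<in> KK 7 v"
  by (simp add: KK_def pt_7_pa pt_lform_mult)

definition alpha :: "(pol \<Rightarrow> bit) \<Rightarrow> bit" where
  "alpha F = (\<Sum>i\<in>UNIV. comp i F (mU UNIV))"

lemma pt_7_empty: "pt 7 {} = 0"
proof
  fix p
  show "pt 7 {} p = 0 p"
  proof (rule lin_ext_mon[OF lin_pt lin_zero_fun])
    fix e :: "ix \<Rightarrow> nat"
    have "{i. e i \<noteq> 0} \<subseteq> {} \<Longrightarrow> e = 0" by (auto simp: fun_eq_iff zero_fun_apply)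
    then have "\<not> (tot e = 7 \<and> {i. e i \<noteq> 0} \<subseteq> {})" by fastforce
    then show "pt 7 {} (mon e) = 0 (mon e)" by (simp add: pt_mon zero_fun_apply del: subset_empty)
  qed
qed

lemma E1_empty: "E1 {} h = 0"
  by (simp add: E1_def cons_0)

lemma EE_empty: "EE (Suc s) {} h = 0"
  by (simp add: EE_Suc E1_empty)

lemma rep_flag_ex: "even (card (v \<inter> u)) \<Longrightarrow> \<exists>b. rep (Suc s) (EE (Suc s) v (pt 7 u)) b"
  by (cases "v = {}"; cases "u = {}")
    (auto simp: EE_empty pt_7_empty EE_zero intro: rep_flag1 rep.zero)

theorem SS_7_1_rep:
  assumes F: "F \<in> SS 7 (Suc 0)" and alpha: "alpha F = 0"
  shows "\<exists>b. rep (Suc 0) F b"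
proof -
  note 1 = SS_SucE[OF F]
  define v where "v U = {i. cc (comp i F) U = 1}" for U
  have even: "even (card (v U \<inter> U))" if "U \<noteq> {}" for U
  proof -
    have "(\<Sum>i\<in>U. cc (comp i F) U) = (\<Sum>i\<in>UNIV. cc (comp i F) UNIV)"
      by (rule cc_relation[where h = "\<lambda>i. comp i F", OF _ 1(3) that]) (use 1(2) in simp)
    then have "(\<Sum>i\<in>U. cc (comp i F) U) = 0" using alpha by (simp add: alpha_def cc_UNIV)
    then have "even (card {i \<in> U. cc (comp i F) U = 1})" by (simp add: bit_sum_card)
    moreover have "{i \<in> U. cc (comp i F) U = 1} = v U \<inter> U" by (auto simp: v_def)
    ultimately show ?thesis by simp
  qed
  define G where "G = (\<Sum>U\<in>UNIV. EE (Suc 0) (v U) (pt 7 U))"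
  have "\<exists>b. rep (Suc 0) (EE (Suc 0) (v U) (pt 7 U)) b" for U
  proof (cases "U = {}")
    case True
    then show ?thesis using rep.zero[of "Suc 0"] by (auto simp: pt_7_empty EE_zero)
  qed (rule rep_flag_ex[OF even])
  then have G_rep: "\<exists>b. rep (Suc 0) G b" unfolding G_def by (intro rep_sum)
  have "EE (Suc 0) (v U) (pt 7 U) \<in> SS 7 (Suc 0)" for U
  proof (cases "U = {}")
    case True
    then show ?thesis by (simp add: pt_7_empty EE_zero SS_0_mem)
  qed (rule EE_SS[OF pt_7_KK[OF even]])
  then have "G \<in> SS 7 (Suc 0)" unfolding G_def by (intro SS_sum)
  then have FG: "F + G \<in> SS 7 (Suc 0)" by (intro SS_add F)
  note 2 = SS_SucE[OF FG]
  have "comp i G = (\<Sum>U\<in>UNIV. sc (cc (comp i F) U) (pt 7 U))" for i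
  proof -
    have "comp i G = (\<Sum>U\<in>UNIV. comp i (EE (Suc 0) (v U) (pt 7 U)))"
      by (simp add: G_def comp_def fun_eq_iff sum_fun_apply)
    also have "\<dots> = (\<Sum>U\<in>UNIV. sc (cc (comp i F) U) (pt 7 U))"
      by (intro sum.cong refl) (auto simp: EE_Suc comp_E1[OF lin_pt] v_def)
    finally show ?thesis .
  qed
  then have "comp i (F + G) = qq (comp i F)" for i
    by (simp add: comp_add qq_def)
  then have "comp i (F + G) \<in> SS 2 (Suc 0)" for i using qq_SS[of "comp i F"] 1(2)[of i] by simp
  then have "cons (\<lambda>i. comp i (F + G)) \<in> SS 2 (Suc (Suc 0))" using 2(3) by (intro SS_SucI)
  then have "F + G \<in> SS 2 (Suc (Suc 0))" using 2(1) by simp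
  then have "rep (Suc 0) (F + G) 0" by (intro span_E_2_rep SS_2_span_E)
  then show ?thesis using G_rep rep_cancel by blast
qed

text \<open>A symmetric matrix over the two-element field that kills u is a sum of squares of vectors orthogonal to u.\<close>

lemma symmetric_matrix_rep:
  assumes u: "k \<in> u" and sym: "\<And>i j. C i j = (C j i :: bit)" and ker: "\<And>j. (\<Sum>i\<in>u. C j i) = 0"
  obtains G where "\<exists>b. rep (Suc (Suc 0)) G b" "G \<in> SS 7 (Suc (Suc 0))" "\<And>i j. comp2 G i j = sc (C i j) (pt 7 u)"
proof -
  obtain i j l where kijl: "distinct [k, i, j, l]" by (rule obtain_distinct_ix)
  have UNIV: "UNIV = {k, i, j, l}" using distinct_ix_UNIV[OF kijl] by simp
  define e where "e x = {x} \<union> (if x \<in> u then {k} else {})" for x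
  define e2 where "e2 x y = {x, y} \<union> (if (x \<in> u) \<noteq> (y \<in> u) then {k} else {})" for x y
  have ev: "even (card (e x \<inter> u))" if "x \<noteq> k" for x
  proof -
    have "e x \<inter> u = (if x \<in> u then {x, k} else {})" using u by (auto simp: e_def)
    then show ?thesis using that by simp
  qed
  have ev2: "even (card (e2 x y \<inter> u))" if "distinct [k, x, y]" for x y
  proof -
    have "e2 x y \<inter> u = (if x \<in> u \<and> y \<in> u then {x, y} else if x \<in> u then {x, k} else if y \<in> u then {y, k} else {})"
      using u by (auto simp: e2_def)
    then show ?thesis using that by (auto simp: card_insert_if)
  qed
  define T where "T v = EE (Suc (Suc 0)) v (pt 7 u)" for v
  have T: "\<exists>b. rep (Suc (Suc 0)) (T v) b" "T v \<in> SS 7 (Suc (Suc 0))" if "even (card (v \<inter> u))" for v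
    unfolding T_def using that by (auto intro: rep_flag_ex EE_SS pt_7_KK)
  define G where "G = sc (C i j) (T (e2 i j)) + sc (C i l) (T (e2 i l)) + sc (C j l) (T (e2 j l))
    + sc (C i i + C i j + C i l) (T (e i)) + sc (C j j + C i j + C j l) (T (e j)) + sc (C l l + C i l + C j l) (T (e l))"
  have evs: "even (card (e2 i j \<inter> u))" "even (card (e2 i l \<inter> u))" "even (card (e2 j l \<inter> u))"
    "even (card (e i \<inter> u))" "even (card (e j \<inter> u))" "even (card (e l \<inter> u))"
    using kijl by (auto intro!: ev ev2)
  have rep_add: "\<exists>b. rep s F b \<Longrightarrow> \<exists>b. rep s F' b \<Longrightarrow> \<exists>b. rep s (F + F') b" for s F F'
    using rep_plus by blast
  have SS_sc: "F \<in> SS 7 s \<Longrightarrow> sc c F \<in> SS 7 s" for c F s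
    by (cases c) (simp_all add: SS_0_mem)
  have "\<exists>b. rep (Suc (Suc 0)) G b" unfolding G_def by (intro rep_add rep_sc T evs)
  moreover have "G \<in> SS 7 (Suc (Suc 0))" unfolding G_def by (intro SS_add SS_sc T evs)
  moreover have "comp2 G x y = sc (C x y) (pt 7 u)" for x y
  proof -
    have comp_sc: "comp2 (sc c F) x y = sc c (comp2 F x y)" for c F
      by (cases c) (simp_all add: comp2_def comp_0)
    have comp_T: "comp2 (T v) x y = (if x \<in> v \<and> y \<in> v then pt 7 u else 0)" for v
      unfolding T_def by (rule comp2_EE[OF lin_pt])
    have kerk: "C x k = of_bool (i \<in> u) * C x i + of_bool (j \<in> u) * C x j + of_bool (l \<in> u) * C x l" for x
    proof -
      have "(\<Sum>y\<in>u. C x y) = (\<Sum>y\<in>UNIV. of_bool (y \<in> u) * C x y)"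
        by (rule sum.mono_neutral_cong_left) auto
      also have "\<dots> = C x k + (of_bool (i \<in> u) * C x i + of_bool (j \<in> u) * C x j + of_bool (l \<in> u) * C x l)"
        using u by (simp add: sum_distinct_ix[OF kijl] add.assoc)
      finally show ?thesis using ker[of x] by (simp add: bit_add_eq_0_iff)
    qed
    have s: "C j i = C i j" "C l i = C i l" "C l j = C j l" "C k i = C i k" "C k j = C j k" "C k l = C l k"
      by (rule sym)+
    have xy: "x = k \<or> x = i \<or> x = j \<or> x = l" "y = k \<or> y = i \<or> y = j \<or> y = l"
      using UNIV UNIV_I[of x] UNIV_I[of y] by auto
    have ne: "k \<noteq> i" "k \<noteq> j" "k \<noteq> l" "i \<noteq> j" "i \<noteq> l" "j \<noteq> l" "i \<noteq> k" "j \<noteq> k" "l \<noteq> k" "j \<noteq> i" "l \<noteq> i" "l \<noteq> j"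
      using kijl by auto
    have "comp2 G x y p = C x y * pt 7 u p" for p
    proof -
      let ?t = "pt 7 u p"
      have "comp2 G x y p = (of_bool (x \<in> e2 i j \<and> y \<in> e2 i j) * C i j + of_bool (x \<in> e2 i l \<and> y \<in> e2 i l) * C i l
          + of_bool (x \<in> e2 j l \<and> y \<in> e2 j l) * C j l + of_bool (x \<in> e i \<and> y \<in> e i) * (C i i + C i j + C i l)
          + of_bool (x \<in> e j \<and> y \<in> e j) * (C j j + C i j + C j l) + of_bool (x \<in> e l \<and> y \<in> e l) * (C l l + C i l + C j l)) * ?t"
        unfolding G_def comp2_add comp_sc comp_T plus_fun_apply sc_def distrib_right of_bool_def
        by (simp add: zero_fun_apply algebra_simps)
      also have "(of_bool (x \<in> e2 i j \<and> y \<in> e2 i j) * C i j + of_bool (x \<in> e2 i l \<and> y \<in> e2 i l) * C i l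
          + of_bool (x \<in> e2 j l \<and> y \<in> e2 j l) * C j l + of_bool (x \<in> e i \<and> y \<in> e i) * (C i i + C i j + C i l)
          + of_bool (x \<in> e j \<and> y \<in> e j) * (C j j + C i j + C j l) + of_bool (x \<in> e l \<and> y \<in> e l) * (C l l + C i l + C j l)) = C x y"
      proof -
        have mem: "z \<in> e i \<longleftrightarrow> z = i \<or> z = k \<and> i \<in> u" "z \<in> e j \<longleftrightarrow> z = j \<or> z = k \<and> j \<in> u"
          "z \<in> e l \<longleftrightarrow> z = l \<or> z = k \<and> l \<in> u"
          "z \<in> e2 i j \<longleftrightarrow> z = i \<or> z = j \<or> z = k \<and> (i \<in> u) \<noteq> (j \<in> u)"
          "z \<in> e2 i l \<longleftrightarrow> z = i \<or> z = l \<or> z = k \<and> (i \<in> u) \<noteq> (l \<in> u)"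
          "z \<in> e2 j l \<longleftrightarrow> z = j \<or> z = l \<or> z = k \<and> (j \<in> u) \<noteq> (l \<in> u)" for z
          by (auto simp: e_def e2_def)
        show ?thesis
          using xy(1)
        proof (elim disjE)
          assume x: "x = k"
          show ?thesis unfolding mem x using xy(2)
            by (elim disjE; simp only: ne simp_thms kerk s; cases "i \<in> u"; cases "j \<in> u"; cases "l \<in> u"; simp add: ac_simps)
        next
          assume x: "x = i"
          show ?thesis unfolding mem x using xy(2)
            by (elim disjE; simp only: ne simp_thms kerk s; cases "i \<in> u"; cases "j \<in> u"; cases "l \<in> u"; simp add: ac_simps)
        next
          assume x: "x = j"
          show ?thesis unfolding mem x using xy(2)
            by (elim disjE; simp only: ne simp_thms kerk s; cases "i \<in> u"; cases "j \<in> u"; cases "l \<in> u"; simp add: ac_simps)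
        next
          assume x: "x = l"
          show ?thesis unfolding mem x using xy(2)
            by (elim disjE; simp only: ne simp_thms kerk s; cases "i \<in> u"; cases "j \<in> u"; cases "l \<in> u"; simp add: ac_simps)
        qed
      qed
      finally show ?thesis .
    qed
    then show ?thesis by (simp add: fun_eq_iff sc_def)
  qed
  ultimately show ?thesis by (rule that)
qed

theorem SS_7_2_rep:
  assumes F: "F \<in> SS 7 (Suc (Suc 0))"
  shows "\<exists>b. rep (Suc (Suc 0)) F b"
proof -
  note P = comp2_props[OF F]
  define C where "C U i j = cc (comp2 F i j) U" for U i j
  define \<alpha> where "\<alpha> j = (\<Sum>i\<in>UNIV. C UNIV j i)" for j
  define \<beta> where "\<beta> = (\<Sum>i\<in>UNIV. C UNIV i i)"
  have sym: "C U i j = C U j i" for U i j by (simp add: C_def P(2)[of i j])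
  have row: "(\<Sum>i\<in>U. C U j i) = \<alpha> j" if "U \<noteq> {}" for U j
    unfolding C_def \<alpha>_def by (rule cc_relation[OF P(1) P(3) that])
  have diag: "(\<Sum>i\<in>U. C U i i) = \<beta>" if "U \<noteq> {}" for U
    unfolding C_def \<beta>_def by (rule cc_relation[OF P(1) P(4) that])
  have a1: "\<alpha> a = \<beta>" for a
    using row[of "{a}" a] diag[of "{a}"] by simp
  have "\<alpha> I0 + \<alpha> I1 = \<beta>"
  proof -
    let ?U = "{I0, I1}"
    have "\<alpha> I0 + \<alpha> I1 = (C ?U I0 I0 + C ?U I0 I1) + (C ?U I1 I0 + C ?U I1 I1)"
      using row[of ?U I0] row[of ?U I1] by simp
    also have "\<dots> = C ?U I0 I0 + C ?U I1 I1" by (simp add: sym[of ?U I1 I0] ac_simps)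
    also have "\<dots> = \<beta>" using diag[of ?U] by simp
    finally show ?thesis .
  qed
  then have "\<beta> = 0" by (simp add: a1)
  then have ker: "(\<Sum>i\<in>U. C U j i) = 0" if "U \<noteq> {}" for U j using row[OF that] a1 by simp
  have "\<exists>G. (\<exists>b. rep (Suc (Suc 0)) G b) \<and> G \<in> SS 7 (Suc (Suc 0)) \<and> (\<forall>i j. comp2 G i j = sc (C U i j) (pt 7 U))" for U
  proof (cases "U = {}")
    case True
    have "comp2 0 i j = sc c 0" for i j c by (simp add: comp2_def comp_0 sc_def fun_eq_iff zero_fun_apply)
    then show ?thesis using True by (intro exI[of _ 0]) (auto simp: SS_0_mem pt_7_empty intro: rep.zero)
  next
    case False
    then obtain k where "k \<in> U" by blast
    then show ?thesis
      using symmetric_matrix_rep[of k U "C U", OF _ sym ker[OF False]] by metis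
  qed
  then obtain M where M: "\<And>U. \<exists>b. rep (Suc (Suc 0)) (M U) b" "\<And>U. M U \<in> SS 7 (Suc (Suc 0))"
    "\<And>U i j. comp2 (M U) i j = sc (C U i j) (pt 7 U)" by metis
  define G where "G = (\<Sum>U\<in>UNIV. M U)"
  have G_rep: "\<exists>b. rep (Suc (Suc 0)) G b" unfolding G_def by (intro rep_sum M)
  have "G \<in> SS 7 (Suc (Suc 0))" unfolding G_def by (intro SS_sum M)
  then have FG: "F + G \<in> SS 7 (Suc (Suc 0))" by (intro SS_add F)
  note 1 = SS_SucE[OF FG]
  note 2 = SS_SucE[OF 1(2)]
  have "comp2 G i j = (\<Sum>U\<in>UNIV. sc (C U i j) (pt 7 U))" for i j
  proof -
    have "comp2 G i j = (\<Sum>U\<in>UNIV. comp2 (M U) i j)"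
      by (simp add: G_def comp2_def comp_def fun_eq_iff sum_fun_apply)
    then show ?thesis by (simp add: M(3))
  qed
  then have "comp2 (F + G) i j = qq (comp2 F i j)" for i j
    by (simp add: comp2_add qq_def C_def)
  then have "comp j (comp i (F + G)) \<in> SS 2 (Suc 0)" for i j
    using qq_SS[OF P(1)[of i j]] by (simp add: comp2_def)
  then have "cons (\<lambda>j. comp j (comp i (F + G))) \<in> SS 2 (Suc (Suc 0))" for i using 2(3) by (intro SS_SucI)
  then have "comp i (F + G) \<in> SS 2 (Suc (Suc 0))" for i using 2(1) by simp
  then have "cons (\<lambda>i. comp i (F + G)) \<in> SS 2 (Suc (Suc (Suc 0)))" using 1(3) by (intro SS_SucI)
  then have "F + G \<in> SS 2 (Suc (Suc (Suc 0)))" using 1(1) by simp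
  then have "rep (Suc (Suc 0)) (F + G) 0" by (intro span_E_2_rep SS_span_E) simp_all
  then show ?thesis using G_rep rep_cancel by blast
qed

section \<open>The action of the general linear group\<close>

lemma homog_add: "homog n p \<Longrightarrow> homog n q \<Longrightarrow> homog n (p + q)"
  using keys_add[of p q] by (auto simp: homog_def)

lemma homog_0: "homog n 0"
  by (simp add: homog_def)

lemma homog_1: "homog 0 1"
  by (simp add: homog_def)

lemma homog_sum: "(\<And>i. i \<in> A \<Longrightarrow> homog n (f i)) \<Longrightarrow> homog n (\<Sum>i\<in>A. f i)"
  by (induction A rule: infinite_finite_induct) (auto simp: homog_0 homog_add)

lemma homog_lform: "homog 1 (lform A)"
  unfolding lform_def by (intro homog_sum homog_X)

lemma homog_power: "homog n p \<Longrightarrow> homog (k * n) (p ^ k)"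
  by (induction k) (auto simp: homog_1 intro: homog_mult)

lemma homog_prod: "finite A \<Longrightarrow> (\<And>i. i \<in> A \<Longrightarrow> homog (n i) (f i)) \<Longrightarrow> homog (\<Sum>i\<in>A. n i) (\<Prod>i\<in>A. f i)"
  by (induction A rule: finite_induct) (auto simp: homog_1 intro: homog_mult)

lemma homog_lsub_mon: "homog (tot e) (lsub M (mon e))"
proof -
  have "homog (\<Sum>i\<in>UNIV. e i * 1) (\<Prod>i\<in>UNIV. lform (M i) ^ e i)"
    by (intro homog_prod homog_power homog_lform) simp
  then show ?thesis by (simp add: lsub_def subst_mon tot_def)
qed

lemma homog_lsub_xs: "homog (card S) (lsub M (xs S))"
proof -
  have "homog (\<Sum>i\<in>S. 1) (\<Prod>i\<in>S. lform (M i))"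
    by (intro homog_prod homog_lform) simp
  then show ?thesis by (simp add: xs_def lsub_prod)
qed

lemma pa_lsub:
  assumes "F \<in> pa n"
  shows "(\<lambda>p. F (lsub M p)) \<in> pa n"
proof -
  have "F (lsub M (mon e)) = 0" if "tot e \<noteq> n" for e
    using homog_pa[OF assms homog_lsub_mon that] .
  then show ?thesis
    using assms by (simp add: pa_def supported_def lin_comp[OF _ lin_lsub]) (simp flip: Sq_lsub)
qed

definition coord :: "ix set \<Rightarrow> pol \<Rightarrow> bit" where
  "coord v = lift (\<lambda>e. of_bool (tot e = 3 \<and> (\<exists>i\<in>v. {j. odd (e j)} = - {i})))"

lemma lin_coord: "lin (coord v)"
  unfolding coord_def by (rule lin_lift_bit)

lemma E1_square_mult:
  assumes p: "homog n p" "n \<le> 4" and h: "lin h"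
  shows "E1 v h (p * q ^ 2) = coord v p * h q"
proof -
  have "E1 v h (mon e * q ^ 2) = coord v (mon e) * h q" if "e \<in> keys p" for e
  proof -
    have tot: "tot e \<le> 4" using p that by (auto simp: homog_def)
    let ?S = "{j. odd (e j)}" and ?m = "\<lambda>j. e j div 2"
    have e': "(\<lambda>j. of_bool (j \<in> ?S) + 2 * ?m j) = e"
      by (simp add: fun_eq_iff flip: of_bool_odd_eq_mod_2)
    have tot_e: "tot e = card ?S + 2 * tot ?m" using tot_xs_square[of ?S ?m] unfolding e' .
    have "mon e * q ^ 2 = xs ?S * (mon ?m * q) ^ 2"
      by (subst mon_eq_xs_square) (simp add: power_mult_distrib mult.assoc)
    then have eq: "E1 v h (mon e * q ^ 2) = (\<Sum>i\<in>UNIV. if ?S = - {i} then (if i \<in> v then h else 0) (mon ?m * q) else 0)"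
      unfolding E1_def using cons_xs_square[of "\<lambda>i. if i \<in> v then h else 0" ?S "mon ?m * q"] h
      by (simp add: lin_zero_fun)
    show ?thesis
    proof (cases "\<exists>i. ?S = - {i}")
      case True
      then obtain i where i: "?S = - {i}" by blast
      then have "tot e = 3 + 2 * tot ?m" using tot_e card_compl[of i] by simp
      then have "tot e = 3 \<and> tot ?m = 0" using tot by presburger
      then have 3: "tot e = 3" and "tot ?m = 0" by auto
      then have m: "?m = 0" by (simp only: tot_eq_0_iff)
      have "E1 v h (mon e * q ^ 2) = (if i \<in> v then h else 0) (mon ?m * q)"
        unfolding eq i by (simp add: eq_commute[of i])
      also have "\<dots> = of_bool (i \<in> v) * h q" by (simp add: m zero_fun_apply)
      finally show ?thesis by (simp add: coord_def i 3)
    next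
      case False
      then show ?thesis unfolding eq by (auto simp: coord_def)
    qed
  qed
  then have "(\<Sum>e\<in>keys p. E1 v h (mon e * q ^ 2)) = (\<Sum>e\<in>keys p. coord v (mon e) * h q)" by simp
  moreover have "E1 v h (p * q ^ 2) = (\<Sum>e\<in>keys p. E1 v h (mon e * q ^ 2))"
    by (subst pol_eq_sum_mon[of p]) (simp add: sum_distrib_right lin_sum[OF lin_cons[folded E1_def]] E1_def)
  moreover have "coord v p = (\<Sum>e\<in>keys p. coord v (mon e))"
    by (subst pol_eq_sum_mon[of p]) (simp add: lin_sum[OF lin_coord])
  ultimately show ?thesis by (simp add: sum_distrib_right)
qed

lemma coord_homog: "homog n p \<Longrightarrow> n \<noteq> 3 \<Longrightarrow> coord v p = 0"
  by (rule supported_eq_0[OF lin_coord]) (auto simp: homog_def supported_def coord_def)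

text \<open>The contragredient of \<open>M\<close>, read off from its effect on the functionals \<^term>\<open>coord v\<close> of degree 3.\<close>

definition act :: "(ix \<Rightarrow> ix set) \<Rightarrow> ix set \<Rightarrow> ix set" where
  "act M v = {i. coord v (lsub M (xs (- {i}))) = 1}"

lemma E1_lsub:
  assumes h: "lin h"
  shows "(\<lambda>p. E1 v h (lsub M p)) = E1 (act M v) (\<lambda>p. h (lsub M p))"
proof (rule lin_ext_xs)
  show "lin (\<lambda>p. E1 v h (lsub M p))" unfolding E1_def by (rule lin_comp[OF lin_cons lin_lsub])
  show "lin (E1 (act M v) (\<lambda>p. h (lsub M p)))" unfolding E1_def by (rule lin_cons)
  fix S :: "ix set" and m :: "ix \<Rightarrow> nat"
  let ?h = "\<lambda>p. h (lsub M p)"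
  let ?G = "\<lambda>i. if i \<in> act M v then ?h else 0"
  have linG: "lin (?G i)" for i using lin_comp[OF h lin_lsub] by (simp add: lin_zero_fun)
  have S: "card S \<le> 4" using card_mono[of UNIV S] by (simp add: card_ix)
  have "E1 v h (lsub M (xs S * mon m ^ 2)) = coord v (lsub M (xs S)) * ?h (mon m)"
    unfolding lsub_mult lsub_power by (rule E1_square_mult[OF homog_lsub_xs S h])
  also have "\<dots> = E1 (act M v) ?h (xs S * mon m ^ 2)"
  proof (cases "card S = 3")
    case True
    then obtain i where i: "S = - {i}" using card_3_compl by blast
    have "E1 (act M v) ?h (xs S * mon m ^ 2) = ?G i (mon m)"
      unfolding E1_def i by (rule cons_xs_compl[OF linG])
    then show ?thesis by (cases "coord v (lsub M (xs S))") (simp_all add: act_def i zero_fun_apply)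
  next
    case False
    then have "coord v (lsub M (xs S)) = 0" by (rule coord_homog[OF homog_lsub_xs])
    then show ?thesis using cons_xs_other[OF linG False] by (simp add: E1_def)
  qed
  finally show "E1 v h (lsub M (xs S * mon m ^ 2)) = E1 (act M v) ?h (xs S * mon m ^ 2)" .
qed

lemma EE_lsub: "lin h \<Longrightarrow> (\<lambda>p. EE s v h (lsub M p)) = EE s (act M v) (\<lambda>p. h (lsub M p))"
  by (induction s) (simp_all add: EE_Suc E1_lsub lin_EE)

lemma KK_lsub:
  assumes h: "h \<in> KK d v"
  shows "(\<lambda>p. h (lsub M p)) \<in> KK d (act M v)"
proof -
  let ?h = "\<lambda>p. h (lsub M p)" and ?v = "act M v"
  note lin_h = paD(1)[OF KKD(1)[OF h]]
  have h': "?h \<in> pa d" by (rule pa_lsub[OF KKD(1)[OF h]])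
  note lin_h' = paD(1)[OF h']
  have "E1 v h \<in> step (pa d)" using EE_SS[OF h, of "Suc 0"] by (simp add: SS_Suc EE_Suc)
  then have "(\<lambda>p. E1 v h (lsub M p)) \<in> pa (2 * d + 3)" by (intro pa_lsub step_pa)
  then have E: "E1 ?v ?h \<in> pa (2 * d + 3)" unfolding E1_lsub[OF lin_h] .
  have "E1 ?v ?h \<in> step (pa d)"
  proof (rule stepI[OF E])
    fix i m
    have "X i = xs {i}" by (simp add: xs_def)
    then show "E1 ?v ?h (X i * mon m ^ 2) = 0"
      unfolding E1_def by (simp only:) (rule cons_xs_other; simp add: lin_h' lin_zero_fun)
  qed
  then have "E1 ?v ?h \<in> SS d (Suc 0)" by (simp add: SS_Suc)
  from SS_SucE(3)[OF this] have "?h (lform ?v * p) = 0" for p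
    by (simp add: comp_E1[OF lin_h'] lin_lform[OF lin_h'] sum_if_mem_ix)
  then show ?thesis using h' by (simp add: KK_def)
qed

lemma pt_7_eq_0_iff: "pt 7 u = 0 \<longleftrightarrow> u = {}"
proof
  assume 0: "pt 7 u = 0"
  show "u = {}"
  proof (rule ccontr)
    assume "u \<noteq> {}"
    then obtain a where "a \<in> u" by blast
    then have "pt 7 u (X a * (X a * X a * X a) ^ 2) = 1" by (subst pt_7_X_cubic_square) simp
    then show False by (simp add: 0 zero_fun_apply)
  qed
qed (simp add: pt_7_empty)

lemma EE_eq_0_iff:
  assumes h: "lin h"
  shows "EE (Suc s) v h = 0 \<longleftrightarrow> v = {} \<or> h = 0"
proof (cases "v = {}")
  case False
  then obtain i where i: "i \<in> v" by blast
  show ?thesis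
  proof (induction s)
    case 0
    have "comp i (EE (Suc 0) v h) = h" using i by (simp add: EE_Suc comp_E1[OF h])
    then show ?case using False by (metis EE_zero comp_0)
  next
    case (Suc s)
    have "comp i (EE (Suc (Suc s)) v h) = EE (Suc s) v h"
      using i by (simp add: EE_Suc[of "Suc s"] comp_E1[OF lin_EE[OF h]])
    then have "EE (Suc (Suc s)) v h = 0 \<Longrightarrow> EE (Suc s) v h = 0" by (simp add: comp_0)
    then show ?case using Suc False by (auto simp: EE_zero)
  qed
qed (simp add: EE_empty)

lemma KK_pt_7D:
  assumes "pt 7 u \<in> KK 7 v" "u \<noteq> {}"
  shows "even (card (v \<inter> u))"
proof -
  obtain a where a: "a \<in> u" using assms(2) by blast
  let ?p = "(X a * X a * X a) ^ 2"
  have "pt 7 u (lform v * ?p) = (\<Sum>i\<in>v. of_bool (i \<in> u))"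
    using a by (simp add: lform_def sum_distrib_right lin_sum[OF lin_pt] pt_7_X_cubic_square)
  also have "\<dots> = of_bool (odd (card (v \<inter> u)))"
    by (subst bit_sum_card) (simp_all add: Int_def)
  finally show ?thesis using KKD(2)[OF assms(1)] by simp
qed

lemma rep_lsub:
  assumes "rep (Suc s) F b"
  shows "\<exists>b'. rep (Suc s) (\<lambda>p. F (lsub M p)) b' \<and> ((\<exists>N. \<forall>p. lsub M (lsub N p) = p) \<longrightarrow> b' = b)"
  using assms
proof (induction rule: rep.induct)
  case zero
  have "(\<lambda>p. 0 (lsub M p)) = (0 :: pol \<Rightarrow> bit)" by (simp add: fun_eq_iff zero_fun_apply)
  then show ?case using rep.zero[of "Suc s"] by (simp only:) blast
next
  case (flag F b v u)
  let ?v = "act M v" and ?u = "{i. odd (card (M i \<inter> u))}"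
  obtain b' where b': "rep (Suc s) (\<lambda>p. F (lsub M p)) b'" "(\<exists>N. \<forall>p. lsub M (lsub N p) = p) \<longrightarrow> b' = b"
    using flag.IH by blast
  have pt: "(\<lambda>p. pt 7 u (lsub M p)) = pt 7 ?u" by (simp add: fun_eq_iff pt_lsub)
  have E: "(\<lambda>p. EE (Suc s) v (pt 7 u) (lsub M p)) = EE (Suc s) ?v (pt 7 ?u)"
    unfolding EE_lsub[OF lin_pt] pt ..
  have plus: "(\<lambda>p. (F + EE (Suc s) v (pt 7 u)) (lsub M p)) = (\<lambda>p. F (lsub M p)) + EE (Suc s) ?v (pt 7 ?u)"
    unfolding E[symmetric] by (simp add: fun_eq_iff plus_fun_apply)
  show ?case
  proof (cases "?v = {} \<or> ?u = {}")
    case True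
    then have E0: "EE (Suc s) ?v (pt 7 ?u) = 0" by (auto simp: EE_empty pt_7_empty EE_zero)
    have noinv: "\<not> (\<forall>p. lsub M (lsub N p) = p)" for N
    proof
      assume inv: "\<forall>p. lsub M (lsub N p) = p"
      have "EE (Suc s) v (pt 7 u) = 0"
      proof
        fix p
        show "EE (Suc s) v (pt 7 u) p = 0 p"
          using fun_cong[OF E[unfolded E0], of "lsub N p"] inv by (simp add: zero_fun_apply)
      qed
      then show False using flag.hyps by (simp add: EE_eq_0_iff[OF lin_pt] pt_7_eq_0_iff)
    qed
    show ?thesis unfolding plus E0 add.right_neutral using b'(1) noinv by blast
  next
    case False
    have "pt 7 ?u \<in> KK 7 ?v" unfolding pt[symmetric] by (intro KK_lsub pt_7_KK flag.hyps)
    then have "even (card (?v \<inter> ?u))" using False by (intro KK_pt_7D) simp_all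
    then have "rep (Suc s) ((\<lambda>p. F (lsub M p)) + EE (Suc s) ?v (pt 7 ?u)) (b' + 1)"
      using False by (intro rep.flag b'(1)) simp_all
    then show ?thesis unfolding plus using b'(2) by (intro exI[of _ "b' + 1"]) auto
  qed
next
  case (low F b v l)
  let ?v = "act M v" and ?l = "\<lambda>p. l (lsub M p)"
  obtain b' where b': "rep (Suc s) (\<lambda>p. F (lsub M p)) b'" "(\<exists>N. \<forall>p. lsub M (lsub N p) = p) \<longrightarrow> b' = b"
    using low.IH by blast
  have E: "(\<lambda>p. EE (Suc (Suc s)) v l (lsub M p)) = EE (Suc (Suc s)) ?v ?l"
    by (rule EE_lsub[OF paD(1)[OF KKD(1)[OF low.hyps(3)]]])
  have plus: "(\<lambda>p. (F + EE (Suc (Suc s)) v l) (lsub M p)) = (\<lambda>p. F (lsub M p)) + EE (Suc (Suc s)) ?v ?l"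
    unfolding E[symmetric] by (simp add: fun_eq_iff plus_fun_apply)
  show ?case
  proof (cases "?v = {}")
    case True
    then have "EE (Suc (Suc s)) ?v ?l = 0" by (simp add: EE_empty)
    then show ?thesis unfolding plus using b' by auto
  next
    case False
    then have "rep (Suc s) ((\<lambda>p. F (lsub M p)) + EE (Suc (Suc s)) ?v ?l) b'"
      by (intro rep.low b'(1) KK_lsub low.hyps(3))
    then show ?thesis unfolding plus using b'(2) by blast
  qed
qed

definition GLm :: "(ix \<Rightarrow> ix set) \<Rightarrow> bool" where
  "GLm M \<longleftrightarrow> (\<exists>N. \<forall>i k. odd (card {j. i \<in> M j \<and> j \<in> N k}) \<longleftrightarrow> i = k)"

lemma lform_conv_UNIV: "lform A = (\<Sum>i\<in>UNIV. if i \<in> A then X i else 0)"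
  by (simp add: lform_def sum.If_cases)

lemma lsub_inverse:
  assumes "\<And>i k. odd (card {j. i \<in> M j \<and> j \<in> N k}) \<longleftrightarrow> i = k"
  shows "lsub M (lsub N p) = p"
proof -
  have "lsub M (lform (N k)) = X k" for k
  proof -
    have "lsub M (lform (N k)) = (\<Sum>j\<in>N k. \<Sum>i\<in>UNIV. if i \<in> M j then X i else 0)"
      by (simp add: lsub_lform lform_conv_UNIV[of "M _"])
    also have "\<dots> = (\<Sum>i\<in>UNIV. \<Sum>j\<in>N k. if i \<in> M j then X i else 0)"
      by (rule sum.swap)
    also have "\<dots> = (\<Sum>i\<in>UNIV. \<Sum>j | i \<in> M j \<and> j \<in> N k. X i)"
      by (intro sum.cong refl sum.mono_neutral_cong_right) auto
    also have "\<dots> = (\<Sum>i\<in>UNIV. if i = k then X i else 0)"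
      by (simp only: sum_const_pol assms)
    finally show ?thesis by simp
  qed
  then have "lsub M (lsub N p) = subst X p" by (simp add: lsub_def subst_subst)
  moreover have "subst X p = p"
  proof (rule lin_ext_mon[OF lin_subst])
    show "lin (\<lambda>p::pol. p)" by (simp add: lin_def)
    show "subst X (mon e) = mon e" for e by (simp add: subst_mon flip: mon_eq_prod)
  qed
  ultimately show ?thesis by simp
qed

lemma GLm_inverse: "GLm M \<Longrightarrow> \<exists>N. \<forall>p. lsub M (lsub N p) = p"
  unfolding GLm_def using lsub_inverse by blast

inductive_set relf :: "nat \<Rightarrow> (pol \<Rightarrow> bit) set" for n where
  zero: "0 \<in> relf n"
| add: "F \<in> relf n \<Longrightarrow> G \<in> pa n \<Longrightarrow> GLm M \<Longrightarrow> F + ((\<lambda>p. G (lsub M p)) + G) \<in> relf n"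

lemma relf_gen: "G \<in> pa n \<Longrightarrow> GLm M \<Longrightarrow> (\<lambda>p. G (lsub M p)) + G \<in> relf n"
  using relf.add[OF relf.zero, of G n M] by (metis add_0)

lemma relf_plus: "F \<in> relf n \<Longrightarrow> H \<in> relf n \<Longrightarrow> F + H \<in> relf n"
proof (induction rule: relf.induct)
  case (add F G M)
  then show ?case using relf.add[of "F + H" n G M] by (simp add: ac_simps)
qed simp

lemma relf_sum: "(\<And>i. i \<in> A \<Longrightarrow> F i \<in> relf n) \<Longrightarrow> (\<Sum>i\<in>A. F i) \<in> relf n"
  by (induction A rule: infinite_finite_induct) (auto simp: relf.zero relf_plus)

lemma relf_trans: "F + G \<in> relf n \<Longrightarrow> G + H \<in> relf n \<Longrightarrow> F + H \<in> relf n"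
  using relf_plus[of "F + G" n "G + H"] by (simp add: add.assoc)

text \<open>The transvection sending the variable i to itself plus the linear form of b if i is in a.\<close>

definition trv :: "ix set \<Rightarrow> ix set \<Rightarrow> ix \<Rightarrow> ix set" where
  "trv a b i = {j. (j = i) \<noteq> (i \<in> a \<and> j \<in> b)}"

lemma sum_of_bool_mem: "(\<Sum>i\<in>UNIV. of_bool (i \<in> A) :: bit) = of_bool (odd (card A))" for A :: "ix set"
proof -
  have "(\<Sum>i\<in>UNIV. of_bool (i \<in> A) :: bit) = (\<Sum>i\<in>A. 1)"
    by (rule sum.mono_neutral_cong_right) auto
  then show ?thesis by (simp only: sum_const_bit mult_1_right)
qed

lemma odd_card_eq: "odd (card A) \<longleftrightarrow> (\<Sum>i\<in>UNIV. of_bool (i \<in> A) :: bit) = 1" for A :: "ix set"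
  by (simp only: sum_of_bool_mem) simp

lemma all_ix: "(\<forall>x. P x) \<longleftrightarrow> P I0 \<and> P I1 \<and> P I2 \<and> P I3"
  by (metis ix.exhaust)

lemma even_card_trv_Int: "odd (card (trv a b i \<inter> u)) \<longleftrightarrow> (i \<in> u) \<noteq> (i \<in> a \<and> odd (card (b \<inter> u)))"
proof -
  have "(\<Sum>j\<in>UNIV. of_bool (j \<in> trv a b i \<inter> u) :: bit)
      = (\<Sum>j\<in>UNIV. of_bool (j = i) * of_bool (j \<in> u)) + of_bool (i \<in> a) * (\<Sum>j\<in>UNIV. of_bool (j \<in> b \<inter> u))"
    unfolding sum_distrib_left sum.distrib[symmetric]
    by (intro sum.cong refl) (auto simp: trv_def)
  also have "(\<Sum>j\<in>UNIV. of_bool (j = i) * of_bool (j \<in> u) :: bit) = of_bool (i \<in> u)"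
    by (subst sum.mono_neutral_right[of UNIV "{i}"]) auto
  also have "(\<Sum>j\<in>UNIV. of_bool (j \<in> b \<inter> u) :: bit) = of_bool (odd (card (b \<inter> u)))"
    by (rule sum_of_bool_mem)
  finally show ?thesis unfolding odd_card_eq[of "trv a b i \<inter> u"] by (auto simp: of_bool_def)
qed

lemma GLm_trv:
  assumes "even (card (a \<inter> b))"
  shows "GLm (trv a b)"
proof -
  have "odd (card {j. i \<in> trv a b j \<and> j \<in> trv a b k}) \<longleftrightarrow> i = k" for i k
  proof -
    let ?u = "{j. i \<in> trv a b j}"
    have "odd (card (b \<inter> ?u)) \<longleftrightarrow> i \<in> b"
    proof -
      have "(\<Sum>j\<in>UNIV. of_bool (j \<in> b \<inter> ?u) :: bit)
        = (\<Sum>j\<in>UNIV. of_bool (j = i) * of_bool (j \<in> b)) + of_bool (i \<in> b) * (\<Sum>j\<in>UNIV. of_bool (j \<in> a \<inter> b))"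
        unfolding sum_distrib_left sum.distrib[symmetric]
        by (intro sum.cong refl) (auto simp: trv_def)
      also have "(\<Sum>j\<in>UNIV. of_bool (j = i) * of_bool (j \<in> b) :: bit) = of_bool (i \<in> b)"
        by (subst sum.mono_neutral_right[of UNIV "{i}"]) auto
      also have "(\<Sum>j\<in>UNIV. of_bool (j \<in> a \<inter> b) :: bit) = 0"
        using assms by (simp only: sum_of_bool_mem) simp
      finally show ?thesis unfolding odd_card_eq[of "b \<inter> ?u"] by (auto simp: of_bool_def)
    qed
    moreover have "{j. i \<in> trv a b j \<and> j \<in> trv a b k} = trv a b k \<inter> ?u" by auto
    ultimately have "odd (card {j. i \<in> trv a b j \<and> j \<in> trv a b k}) \<longleftrightarrow> (k \<in> ?u) \<noteq> (k \<in> a \<and> i \<in> b)"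
      by (simp only: even_card_trv_Int)
    then show ?thesis by (auto simp: trv_def)
  qed
  then show ?thesis unfolding GLm_def by blast
qed

definition symd :: "ix set \<Rightarrow> ix set \<Rightarrow> ix set" where
  "symd a b = {i. (i \<in> a) \<noteq> (i \<in> b)}"

lemma even_card_symd: "odd (card (symd a b \<inter> u)) \<longleftrightarrow> odd (card (a \<inter> u)) \<noteq> odd (card (b \<inter> u))"
proof -
  have "(\<Sum>j\<in>UNIV. of_bool (j \<in> symd a b \<inter> u) :: bit)
      = (\<Sum>j\<in>UNIV. of_bool (j \<in> a \<inter> u)) + (\<Sum>j\<in>UNIV. of_bool (j \<in> b \<inter> u))"
    unfolding sum.distrib[symmetric] by (intro sum.cong refl) (auto simp: symd_def)
  then show ?thesis unfolding sum_of_bool_mem by (auto simp: of_bool_def split: if_splits)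
qed

lemma pt_trv: "pt d u (lsub (trv a b) p) = pt d (if odd (card (b \<inter> u)) then symd u a else u) p"
  unfolding pt_lsub even_card_trv_Int by (rule arg_cong[of _ _ "\<lambda>u. pt d u p"]) (auto simp: symd_def)

lemma coord_X3: "coord v (X a * X b * X c) = of_bool (distinct [a, b, c] \<and> (\<exists>i\<in>v. i \<notin> {a, b, c}))"
proof -
  have X: "X a * X b * X c = mon (unit a + unit b + unit c)" by (simp add: X_def mon_add)
  have odd: "{j. odd ((unit a + unit b + unit c) j)} = - {i} \<longleftrightarrow> distinct [a, b, c, i]" for i
    by (cases a; cases b; cases c; cases i) (simp_all add: plus_fun_apply unit_def set_eq_iff all_ix)
  show ?thesis unfolding X coord_def lift_mon odd by (auto simp: of_bool_def)
qed

lemma coord_square: "coord v (X a * X a * X c) = 0"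
  by (simp add: coord_X3)

lemma lform_trv: "lform (trv a b i) = X i + (if i \<in> a then lform b else 0)"
proof -
  have "lform (trv a b i) = (\<Sum>j\<in>UNIV. (if j = i then X j else 0) + (if i \<in> a \<and> j \<in> b then X j else 0))"
    unfolding lform_conv_UNIV by (intro sum.cong refl) (auto simp: trv_def)
  then show ?thesis by (auto simp: sum.distrib lform_conv_UNIV)
qed

lemma act_trv:
  assumes ab: "even (card (a \<inter> b))"
  shows "act (trv a b) v = (if odd (card (a \<inter> v)) then symd v b else v)"
proof -
  have "coord v (lsub (trv a b) (xs (- {i}))) = of_bool (i \<in> v) + of_bool (i \<in> b) * of_bool (odd (card (a \<inter> v)))" for i
  proof -
    obtain j k l where ijkl: "distinct [i, j, k, l]" by (rule obtain_distinct_ix)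
    have compl: "- {i} = {j, k, l}" using distinct_ix_UNIV[OF ijkl] ijkl by auto
    let ?B = "lform b"
    define c where "c x = (if x \<in> a then 1 else 0 :: pol)" for x
    have lt: "lform (trv a b x) = X x + c x * ?B" for x by (simp add: lform_trv c_def)
    have "lsub (trv a b) (xs (- {i})) = (X j + c j * ?B) * (X k + c k * ?B) * (X l + c l * ?B)"
      using ijkl by (simp add: compl xs_def lsub_mult lt mult.assoc)
    also have "\<dots> = X j * X k * X l + c j * (?B * X k * X l) + c k * (?B * X j * X l) + c l * (?B * X j * X k)
        + c j * c k * (?B * ?B * X l) + c j * c l * (?B * ?B * X k) + c k * c l * (?B * ?B * X j)
        + c j * c k * c l * (?B * ?B * ?B)"
      by (simp add: algebra_simps)
    finally have expand: "lsub (trv a b) (xs (- {i})) = \<dots>" .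
    have cc: "coord v (c x * p) = of_bool (x \<in> a) * coord v p" for x p
      by (simp add: c_def lin_0[OF lin_coord])
    have BB: "coord v (?B * ?B * X x) = 0" for x
    proof -
      have "?B * ?B * X x = (\<Sum>i\<in>b. X i * X i * X x)"
        using pol_square_sum[of X b] by (simp add: lform_def power2_eq_square sum_distrib_right)
      then show ?thesis by (simp add: lin_sum[OF lin_coord] coord_square)
    qed
    have BBB: "coord v (?B * ?B * ?B) = 0"
    proof -
      have "?B * ?B * ?B = (\<Sum>x\<in>b. ?B * ?B * X x)" by (simp add: lform_def sum_distrib_left)
      then show ?thesis by (simp add: lin_sum[OF lin_coord] BB)
    qed
    have B1: "coord v (?B * X y * X z) = of_bool (x \<in> b \<and> i \<in> v) + of_bool (i \<in> b \<and> x \<in> v)"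
      if xyz: "distinct [i, x, y, z]" for x y z
    proof -
      have U: "UNIV = {i, x, y, z}" using distinct_ix_UNIV[OF xyz] by simp
      have "?B * X y * X z = (\<Sum>w\<in>UNIV. (if w \<in> b then X w * X y * X z else 0))"
        by (simp add: lform_conv_UNIV sum_distrib_right if_distrib[of "\<lambda>p. p * _"] cong: if_cong)
      then have "coord v (?B * X y * X z) = (\<Sum>w\<in>UNIV. of_bool (w \<in> b) * coord v (X w * X y * X z))"
        by (simp only: lin_sum[OF lin_coord]) (intro sum.cong refl, simp add: lin_0[OF lin_coord])
      also have "\<dots> = of_bool (i \<in> b) * coord v (X i * X y * X z) + of_bool (x \<in> b) * coord v (X x * X y * X z)"
        using xyz by (simp add: sum_distinct_ix[OF xyz] coord_X3)
      also have "coord v (X i * X y * X z) = of_bool (x \<in> v)"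
        using xyz U by (auto simp: coord_X3 of_bool_def)
      also have "coord v (X x * X y * X z) = of_bool (i \<in> v)"
        using xyz U by (auto simp: coord_X3 of_bool_def)
      finally show ?thesis by (auto simp: of_bool_def add.commute)
    qed
    have perm: "distinct [i, j, k, l]" "distinct [i, k, j, l]" "distinct [i, l, j, k]" using ijkl by auto
    have top: "coord v (X j * X k * X l) = of_bool (i \<in> v)"
      using ijkl distinct_ix_UNIV[OF ijkl] by (auto simp: coord_X3 of_bool_def)
    have "coord v (lsub (trv a b) (xs (- {i}))) = of_bool (i \<in> v)
        + of_bool (j \<in> a) * (of_bool (j \<in> b \<and> i \<in> v) + of_bool (i \<in> b \<and> j \<in> v))
        + of_bool (k \<in> a) * (of_bool (k \<in> b \<and> i \<in> v) + of_bool (i \<in> b \<and> k \<in> v))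
        + of_bool (l \<in> a) * (of_bool (l \<in> b \<and> i \<in> v) + of_bool (i \<in> b \<and> l \<in> v))"
      unfolding expand lin_add[OF lin_coord] mult.assoc[of "c _" "c _" "_"] mult.assoc[of "c _ * c _"] cc top B1[OF perm(1)] B1[OF perm(2)] B1[OF perm(3)]
      using BB BBB by (simp add: mult.assoc cc)
    also have "\<dots> = of_bool (i \<in> v) * (1 + (of_bool (i \<in> a \<inter> b) + (\<Sum>x\<in>UNIV. of_bool (x \<in> a \<inter> b))))
        + of_bool (i \<in> b) * (of_bool (i \<in> a \<inter> v) + (\<Sum>x\<in>UNIV. of_bool (x \<in> a \<inter> v)))"
      unfolding sum_distinct_ix[OF ijkl]
      by (cases "i \<in> v"; cases "i \<in> b"; simp add: of_bool_conj algebra_simps)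
    also have "\<dots> = of_bool (i \<in> v) * (1 + of_bool (i \<in> a \<inter> b)) + of_bool (i \<in> b) * (of_bool (i \<in> a \<inter> v) + of_bool (odd (card (a \<inter> v))))"
      using ab by (simp only: sum_of_bool_mem) simp
    also have "\<dots> = of_bool (i \<in> v) + of_bool (i \<in> b) * of_bool (odd (card (a \<inter> v)))"
      by (auto simp: of_bool_def)
    finally show ?thesis .
  qed
  then show ?thesis unfolding act_def by (auto simp: symd_def)
qed

definition wedge :: "ix set \<Rightarrow> ix set \<Rightarrow> pol \<Rightarrow> bit" where
  "wedge U W = pt 2 (symd U W) + pt 2 U + pt 2 W"

lemma lin_wedge: "lin (wedge U W)"
  unfolding wedge_def by (intro lin_plus_fun lin_pt)

lemma pt_2_XX: "pt 2 U (X a * X b) = of_bool (a \<in> U) * of_bool (b \<in> U)"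
  using pt_X_mult[of 1 U a "X b"] pt_X[of U b] by (simp add: eval_nat_numeral)

lemma wedge_XX: "wedge U W (X a * X b) = of_bool (a \<in> U) * of_bool (b \<in> W) + of_bool (b \<in> U) * of_bool (a \<in> W)"
  unfolding wedge_def plus_fun_apply pt_2_XX symd_def by (auto simp: of_bool_def)

lemma wedge_pa: "wedge U W \<in> pa 2"
proof -
  have "supported 2 (wedge U W)"
    using supported_pt[of 2] by (simp add: wedge_def supported_def plus_fun_apply)
  then show ?thesis by (simp add: pa_2_iff lin_wedge wedge_XX)
qed

lemma wedge_KK:
  assumes "even (card (v \<inter> U))" "even (card (v \<inter> W))"
  shows "wedge U W \<in> KK 2 v"
proof -
  have "even (card (v \<inter> symd U W))"
    using assms even_card_symd[of U W v] by (simp add: Int_commute)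
  then show ?thesis using assms
    by (simp add: KK_def wedge_pa) (simp add: wedge_def plus_fun_apply pt_lform_mult)
qed

lemma wedge_symd: "wedge U (symd W W') = wedge U W + wedge U W'"
proof (rule pa_2_ext[OF wedge_pa pa_add[OF wedge_pa wedge_pa]])
  show "wedge U (symd W W') (X a * X b) = (wedge U W + wedge U W') (X a * X b)" for a b
    by (auto simp: plus_fun_apply wedge_XX symd_def of_bool_def)
qed

definition nd :: "nat \<Rightarrow> nat \<Rightarrow> nat" where
  "nd d s = 2 ^ s * (d + 3) - 3"

lemma EE_pa: "h \<in> KK d v \<Longrightarrow> EE s v h \<in> pa (nd d s)"
  using EE_SS[of h d v s] SS_pa[of d s] by (auto simp: nd_def)

lemma nd_2_Suc: "nd 2 (Suc s) = nd 7 s"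
  by (simp add: nd_def)

lemma EE_trv:
  assumes "lin h" "even (card (a \<inter> b))"
  shows "(\<lambda>p. EE s v h (lsub (trv a b) p)) = EE s (if odd (card (a \<inter> v)) then symd v b else v) (\<lambda>p. h (lsub (trv a b) p))"
  unfolding EE_lsub[OF assms(1)] act_trv[OF assms(2)] ..

text \<open>A transvection moving u2 to u2 + u3 and fixing u1 and v exhibits the element of u1 \<and> u3 as a difference.\<close>

lemma EE_wedge_relf:
  assumes U1: "even (card (v \<inter> U1))" and U2: "even (card (v \<inter> U2))" and U3: "even (card (v \<inter> U3))"
    and c: "c \<notin> U1" "c \<in> U2" "c \<notin> U3"
  shows "EE s v (wedge U1 U3) \<in> relf (nd 2 s)"
proof -
  let ?M = "trv U3 {c}"
  have ab: "even (card (U3 \<inter> {c}))" using c by simp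
  have v: "\<not> odd (card (U3 \<inter> v))" using U3 by (simp add: Int_commute)
  have c2: "c \<in> symd U1 U2" using c by (simp add: symd_def)
  have sy: "symd (symd U1 U2) U3 = symd U1 (symd U2 U3)" by (auto simp: symd_def)
  have w: "(\<lambda>p. wedge U1 U2 (lsub ?M p)) = wedge U1 (symd U2 U3)"
    unfolding wedge_def using c c2 by (simp add: fun_eq_iff plus_fun_apply pt_trv sy)
  have "(\<lambda>p. EE s v (wedge U1 U2) (lsub ?M p)) + EE s v (wedge U1 U2) \<in> relf (nd 2 s)"
    by (intro relf_gen EE_pa wedge_KK U1 U2 GLm_trv ab)
  moreover have "(\<lambda>p. EE s v (wedge U1 U2) (lsub ?M p)) = EE s v (wedge U1 U2) + EE s v (wedge U1 U3)"
    unfolding EE_trv[OF lin_wedge ab] w using v by (simp add: wedge_symd EE_add)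
  ultimately show ?thesis by (simp add: ac_simps)
qed

lemma KK_2_relf:
  assumes l: "l \<in> KK 2 v" and v: "v \<noteq> {}"
  shows "EE s v l \<in> relf (nd 2 s)"
proof -
  obtain k where k: "k \<in> v" using v by blast
  obtain a b c where kabc: "distinct [k, a, b, c]" by (rule obtain_distinct_ix)
  have UNIV: "UNIV = {k, a, b, c}" using distinct_ix_UNIV[OF kabc] by simp
  define e where "e x = insert x (if x \<in> v then {k} else {})" for x
  have ev: "even (card (v \<inter> e x))" if "x \<noteq> k" for x
  proof -
    have "v \<inter> e x = (if x \<in> v then {x, k} else {})" using k by (auto simp: e_def)
    then show ?thesis using that by simp
  qed
  have rel: "EE s v (wedge (e x) (e y)) \<in> relf (nd 2 s)" if "distinct [k, x, y, z]" for x y z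
  proof (rule EE_wedge_relf[where ?U2.0 = "e z" and c = z])
    show "even (card (v \<inter> e x))" "even (card (v \<inter> e y))" "even (card (v \<inter> e z))"
      using that by (auto intro!: ev)
    show "z \<notin> e x" "z \<in> e z" "z \<notin> e y" using that by (auto simp: e_def)
  qed
  define L where "L x y = sc (l (X x * X y)) (wedge (e x) (e y))" for x y
  have relL: "EE s v (L x y) \<in> relf (nd 2 s)" if "distinct [k, x, y, z]" for x y z
    unfolding L_def EE_sc using rel[OF that] by (cases "l (X x * X y)") (simp_all add: relf.zero)
  have pa_l: "l \<in> pa 2" by (rule KKD(1)[OF l])
  have l_eq: "l = L a b + L a c + L b c"
  proof (rule pa_2_ext[OF pa_l])
    show "L a b + L a c + L b c \<in> pa 2" unfolding L_def by (intro pa_add sc_pa wedge_pa)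
    fix x y :: ix assume xy: "x \<noteq> y"
    have lk: "l (X k * X y) = of_bool (a \<in> v) * l (X a * X y) + of_bool (b \<in> v) * l (X b * X y) + of_bool (c \<in> v) * l (X c * X y)" for y
    proof -
      have "0 = (\<Sum>i\<in>v. l (X i * X y))" using KKD(2)[OF l, of "X y"] by (simp add: lin_lform[OF paD(1)[OF pa_l]])
      also have "\<dots> = (\<Sum>i\<in>UNIV. of_bool (i \<in> v) * l (X i * X y))"
        by (rule sum.mono_neutral_cong_left) auto
      finally show ?thesis using k by (simp add: sum_distinct_ix[OF kabc] add.assoc bit_add_eq_0_iff)
    qed
    have ll: "l (X i * X i) = 0" for i using pa_l by (simp add: pa_2_iff)
    have ne: "k \<noteq> a" "k \<noteq> b" "k \<noteq> c" "a \<noteq> k" "b \<noteq> k" "c \<noteq> k" "a \<noteq> b" "a \<noteq> c" "b \<noteq> c" "b \<noteq> a" "c \<noteq> a" "c \<noteq> b"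
      using kabc by auto
    have mem: "i \<in> e j \<longleftrightarrow> i = j \<or> i = k \<and> j \<in> v" for i j by (auto simp: e_def)
    have com: "l (X y * X k) = l (X k * X y)" "l (X b * X a) = l (X a * X b)" "l (X c * X a) = l (X a * X c)" "l (X c * X b) = l (X b * X c)" for y
      by (simp_all add: mult.commute)
    have "x = k \<or> x = a \<or> x = b \<or> x = c" "y = k \<or> y = a \<or> y = b \<or> y = c"
      using UNIV UNIV_I[of x] UNIV_I[of y] by auto
    then show "l (X x * X y) = (L a b + L a c + L b c) (X x * X y)"
      unfolding L_def plus_fun_apply sc_def wedge_XX mem
      using xy by (elim disjE; simp only: ne com lk ll simp_thms; cases "a \<in> v"; cases "b \<in> v"; cases "c \<in> v"; simp)
  qed
  have "EE s v l = EE s v (L a b) + EE s v (L a c) + EE s v (L b c)"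
    using arg_cong[OF l_eq, of "EE s v"] by (simp only: EE_add)
  moreover have "EE s v (L a b) \<in> relf (nd 2 s)" "EE s v (L a c) \<in> relf (nd 2 s)" "EE s v (L b c) \<in> relf (nd 2 s)"
    using kabc by (auto intro!: relL[of a b c] relL[of a c b] relL[of b c a])
  ultimately show ?thesis by (simp add: relf_plus)
qed

lemma exists_odd_even:
  assumes "u \<noteq> {}" "w \<noteq> {}" "u \<noteq> (w :: ix set)"
  obtains b where "odd (card (b \<inter> u))" "odd (card (b \<inter> w))"
proof (cases "u \<inter> w = {}")
  case False
  then obtain x where "x \<in> u" "x \<in> w" by blast
  then show ?thesis using that[of "{x}"] by simp
next
  case True
  obtain x y where xy: "x \<in> u" "y \<in> w" using assms by blast
  then have "{x, y} \<inter> u = {x}" "{x, y} \<inter> w = {y}" using True by auto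
  then show ?thesis using that[of "{x, y}"] by simp
qed

definition flagE :: "nat \<Rightarrow> ix set \<Rightarrow> ix set \<Rightarrow> pol \<Rightarrow> bit" where
  "flagE s v u = EE s v (pt 7 u)"

lemma symd_symd: "symd u (symd u w) = w"
  by (auto simp: symd_def)

lemma flagE_move_u:
  assumes "even (card (v \<inter> u))" "even (card (v \<inter> w))" "u \<noteq> {}" "w \<noteq> {}"
  shows "flagE s v u + flagE s v w \<in> relf (nd 7 s)"
proof (cases "u = w")
  case False
  obtain b where b: "odd (card (b \<inter> u))" "odd (card (b \<inter> w))"
    using exists_odd_even[OF assms(3,4) False] by blast
  let ?a = "symd u w"
  have ab: "even (card (?a \<inter> b))" using even_card_symd[of u w b] b by (simp add: Int_commute)
  have av: "\<not> odd (card (?a \<inter> v))" using even_card_symd[of u w v] assms(1,2) by (simp add: Int_commute)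
  have "(\<lambda>p. flagE s v u (lsub (trv ?a b) p)) = flagE s v w"
    unfolding flagE_def EE_trv[OF lin_pt ab] pt_trv using av b by (simp add: symd_symd)
  then show ?thesis
    using relf_gen[OF EE_pa[OF pt_7_KK[OF assms(1)]] GLm_trv[OF ab], of s] by (simp add: flagE_def add.commute)
qed (simp add: relf.zero)

lemma flagE_move_v:
  assumes "even (card (v \<inter> u))" "even (card (w \<inter> u))" "v \<noteq> {}" "w \<noteq> {}"
  shows "flagE s v u + flagE s w u \<in> relf (nd 7 s)"
proof (cases "v = w")
  case False
  obtain a where a: "odd (card (a \<inter> v))" "odd (card (a \<inter> w))"
    using exists_odd_even[OF assms(3,4) False] by blast
  let ?b = "symd v w"
  have ab: "even (card (a \<inter> ?b))" using even_card_symd[of v w a] a by (simp add: Int_commute)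
  have bu: "\<not> odd (card (?b \<inter> u))" using even_card_symd[of v w u] assms(1,2) by simp
  have "(\<lambda>p. flagE s v u (lsub (trv a ?b) p)) = flagE s w u"
    unfolding flagE_def EE_trv[OF lin_pt ab] pt_trv using a bu by (simp add: symd_symd)
  then show ?thesis
    using relf_gen[OF EE_pa[OF pt_7_KK[OF assms(1)]] GLm_trv[OF ab], of s] by (simp add: flagE_def add.commute)
qed (simp add: relf.zero)

lemma common_orthogonal:
  obtains U where "U \<noteq> {}" "even (card (v \<inter> U))" "even (card (w \<inter> (U :: ix set)))"
proof (cases "\<exists>i. i \<notin> v \<and> i \<notin> w")
  case True
  then obtain i where "i \<notin> v" "i \<notin> w" by blast
  then show ?thesis using that[of "{i}"] by simp
next
  case False
  have "\<not> inj (\<lambda>i. (i \<in> v, i \<in> w))"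
  proof
    assume "inj (\<lambda>i. (i \<in> v, i \<in> w))"
    then have "card (UNIV :: ix set) = card (range (\<lambda>i. (i \<in> v, i \<in> w)))" by (simp add: card_image)
    also have "\<dots> \<le> card {(True, True), (True, False), (False, True)}"
      using False by (intro card_mono) auto
    finally show False by (simp add: card_ix)
  qed
  then obtain i j where ij: "i \<noteq> j" "(i \<in> v) = (j \<in> v)" "(i \<in> w) = (j \<in> w)"
    unfolding inj_def by blast
  have "v \<inter> {i, j} = (if i \<in> v then {i, j} else {})" "w \<inter> {i, j} = (if i \<in> w then {i, j} else {})"
    using ij by auto
  then show ?thesis using that[of "{i, j}"] ij(1) by simp
qed

lemma flagE_equiv:
  assumes "even (card (v \<inter> u))" "even (card (w \<inter> x))" "v \<noteq> {}" "w \<noteq> {}" "u \<noteq> {}" "x \<noteq> {}"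
  shows "flagE s v u + flagE s w x \<in> relf (nd 7 s)"
proof -
  obtain U where U: "U \<noteq> {}" "even (card (v \<inter> U))" "even (card (w \<inter> U))" by (rule common_orthogonal)
  have "flagE s v u + flagE s v U \<in> relf (nd 7 s)" by (intro flagE_move_u assms U)
  moreover have "flagE s v U + flagE s w U \<in> relf (nd 7 s)" by (intro flagE_move_v assms U)
  moreover have "flagE s w U + flagE s w x \<in> relf (nd 7 s)" by (intro flagE_move_u assms U)
  ultimately show ?thesis using relf_trans by blast
qed

lemma rep_relf:
  assumes "rep s F b" and w: "even (card (v \<inter> u))" "v \<noteq> {}" "u \<noteq> {}"
  shows "F + sc b (flagE s v u) \<in> relf (nd 7 s)"
  using assms(1)
proof (induction rule: rep.induct)
  case zero
  show ?case using relf.zero by simp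
next
  case (flag F b v' u')
  have "flagE s v' u' + flagE s v u \<in> relf (nd 7 s)" by (intro flagE_equiv flag.hyps w)
  then have "(F + sc b (flagE s v u)) + (flagE s v' u' + flagE s v u) \<in> relf (nd 7 s)"
    by (rule relf_plus[OF flag.IH])
  moreover have "sc (b + 1) (flagE s v u) = sc b (flagE s v u) + flagE s v u"
    by (cases b) simp_all
  ultimately show ?case by (simp add: flagE_def ac_simps)
next
  case (low F b v' l)
  have "EE (Suc s) v' l \<in> relf (nd 7 s)" using KK_2_relf[OF low.hyps(3,2), of "Suc s"] by (simp add: nd_2_Suc)
  then have "(F + sc b (flagE s v u)) + EE (Suc s) v' l \<in> relf (nd 7 s)"
    by (rule relf_plus[OF low.IH])
  then show ?case by (simp add: ac_simps)
qed

lemma relf_cancel: "F + G \<in> relf n \<Longrightarrow> G \<in> relf n \<Longrightarrow> F \<in> relf n"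
  using relf_plus[of "F + G" n G] by (simp add: add.assoc)

lemma flagE_1_relf: "flagE (Suc 0) {I0} {I3} \<in> relf (nd 7 (Suc 0))"
proof -
  let ?f = "\<lambda>v. flagE (Suc 0) v {I3}"
  have "?f {I0, I1} = ?f {I0} + ?f {I1}"
    unfolding flagE_def EE_Suc EE_0 E1_def cons_add[symmetric] by (rule arg_cong[of _ _ cons]) (auto simp: fun_eq_iff plus_fun_apply zero_fun_apply)
  moreover have "?f {I0, I1} + ?f {I1} \<in> relf (nd 7 (Suc 0))" by (rule flagE_move_v) simp_all
  ultimately show ?thesis by (simp add: add.assoc)
qed

lemma flagE_2_relf: "flagE (Suc (Suc 0)) {I0} {I3} \<in> relf (nd 7 (Suc (Suc 0)))"
proof -
  let ?f = "\<lambda>v. flagE (Suc (Suc 0)) v {I3}" and ?R = "relf (nd 7 (Suc (Suc 0)))"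
  let ?S = "?f {I0, I1, I2} + ?f {I0, I1} + ?f {I0, I2} + ?f {I1, I2} + ?f {I0} + ?f {I1} + ?f {I2}"
  have mem: "?f v \<in> SS 7 (Suc (Suc 0))" if "I3 \<notin> v" for v
    unfolding flagE_def using that by (intro EE_SS pt_7_KK) simp
  have "?S = 0"
  proof (rule comp2_eq_0)
    show "?S \<in> SS 7 (Suc (Suc 0))" by (intro SS_add mem) simp_all
    show "comp2 ?S i j = 0" for i j
      unfolding comp2_add flagE_def comp2_EE[OF lin_pt]
      by (cases i; cases j) simp_all
  qed
  moreover have eq: "?f v + ?f {I0} \<in> ?R" if "v \<noteq> {}" "I3 \<notin> v" for v
    using that by (intro flagE_move_v) simp_all
  have "(?f {I0, I1, I2} + ?f {I0}) + ((?f {I0, I1} + ?f {I0}) + (?f {I0, I2} + ?f {I0})) + ((?f {I1, I2} + ?f {I0}) + (?f {I1} + ?f {I0})) + (?f {I2} + ?f {I0}) \<in> ?R"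
    by (intro relf_plus eq) simp_all
  then have "?S + ?f {I0} \<in> ?R"
    by (simp add: ac_simps)
  ultimately show ?thesis by (simp only: add_0)
qed

section \<open>Nontriviality of the class of a flag\<close>

lemma nd_7_Suc: "nd 7 (Suc s) = 2 * nd 7 s + 3"
proof -
  have "3 \<le> 2 ^ s * (10::nat)" using mult_le_mono[of 1 "2 ^ s" 3 "10::nat"] by simp
  then show ?thesis by (simp add: nd_def)
qed

lemma pa_SS: "F \<in> pa (nd 7 s) \<Longrightarrow> F \<in> SS 7 s"
proof (induction s arbitrary: F)
  case (Suc s)
  have "nd 7 s + 2 \<noteq> 2 ^ k" for k
  proof
    have "10 \<le> 2 ^ s * (10::nat)" by simp
    moreover have "nd 7 s = 2 ^ s * 10 - 3" "2 * (2 ^ s * 5) = 2 ^ s * (10::nat)" by (simp_all add: nd_def)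
    ultimately have eq: "nd 7 s + 2 = 2 * (2 ^ s * 5) - 1" and "9 \<le> nd 7 s + 2" by linarith+
    moreover have "odd (2 * (2 ^ s * 5) - (1::nat))" by simp
    ultimately have "odd (nd 7 s + 2)" "nd 7 s + 2 \<noteq> 1" by (simp_all only:) simp_all
    moreover assume k: "nd 7 s + 2 = 2 ^ k"
    ultimately have "k \<noteq> 0" by (metis power_0)
    then have "even (nd 7 s + 2)" unfolding k by simp
    then show False using \<open>odd (nd 7 s + 2)\<close> by blast
  qed
  then have "F \<in> step (pa (nd 7 s))" using Suc.prems unfolding nd_7_Suc by (intro pa_step)
  moreover have "step (pa (nd 7 s)) \<subseteq> step (SS 7 s)" by (intro step_mono subsetI Suc.IH)
  ultimately show ?case by (auto simp: SS_Suc)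
qed (simp add: nd_def)

definition aug :: "(pol \<Rightarrow> bit) \<Rightarrow> bit" where
  "aug h = (\<Sum>U\<in>UNIV - {{}}. h (mU U))"

lemma aug_add: "aug (F + G) = aug F + aug G"
  by (simp add: aug_def plus_fun_apply sum.distrib)

lemma aug_0: "aug 0 = 0"
  by (simp add: aug_def zero_fun_apply)

lemma aug_pt: "u \<noteq> {} \<Longrightarrow> aug (pt 7 u) = 1"
proof -
  assume u: "u \<noteq> {}"
  have "aug (pt 7 u) = (\<Sum>U\<in>UNIV - {{}}. of_bool (U \<subseteq> u))"
    unfolding aug_def by (intro sum.cong refl pt_7_mU) auto
  moreover have "(\<Sum>U\<in>UNIV. of_bool (U \<subseteq> u) :: bit) = 0"
    using sum_between_sets[of "{}" u] u by simp
  then have "(\<Sum>U\<in>UNIV - {{}}. of_bool (U \<subseteq> u) :: bit) = 1"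
    by (subst (asm) sum.remove[of _ "{}"]) (simp_all add: bit_add_eq_0_iff)
  ultimately show ?thesis by simp
qed

lemma mU_X_square: "W \<noteq> {} \<Longrightarrow> \<exists>i p. mU W = X i * p ^ 2"
proof -
  assume "W \<noteq> {}"
  then have "W \<inter> {I0, I1, I2, I3} \<noteq> {}" using UNIV_ix by auto
  then show ?thesis
    by (cases "I0 \<in> W"; cases "I1 \<in> W"; cases "I2 \<in> W"; cases "I3 \<in> W") (auto simp: mU_def)
qed

lemma SS_mU: "F \<in> SS d (Suc s) \<Longrightarrow> W \<noteq> {} \<Longrightarrow> F (mU W) = 0"
  using mU_X_square[of W] SS_X_square[of F d s] by auto

lemma aug_SS: "F \<in> SS d (Suc s) \<Longrightarrow> aug F = 0"
  by (auto simp: aug_def SS_mU intro!: sum.neutral)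

text \<open>The nonvanishing of v is a polynomial of degree 4 in v; on the hyperplane orthogonal to u its top term
  can be lowered to degree 3, which gives a functional equal to 1 on all flags.\<close>

definition Phi :: "(pol \<Rightarrow> bit) \<Rightarrow> bit" where
  "Phi F = aug (comp3 F I0 I0 I0) + aug (comp3 F I1 I1 I1) + aug (comp3 F I2 I2 I2) + aug (comp3 F I3 I3 I3)
     + aug (comp3 F I0 I0 I1) + aug (comp3 F I0 I0 I2) + aug (comp3 F I0 I0 I3)
     + aug (comp3 F I1 I1 I2) + aug (comp3 F I1 I1 I3) + aug (comp3 F I2 I2 I3)
     + aug (comp3 F I0 I1 I2) + aug (comp3 F I0 I1 I3) + aug (comp3 F I0 I2 I3) + aug (comp3 F I1 I2 I3)
     + comp3 F I0 I1 I2 (mU {I0, I3}) + comp3 F I0 I1 I2 (mU {I1, I3}) + comp3 F I0 I1 I2 (mU {I2, I3})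
     + comp3 F I0 I1 I3 (mU {I0, I2}) + comp3 F I0 I1 I3 (mU {I1, I2})
     + comp3 F I0 I1 I3 (mU {I0, I2, I3}) + comp3 F I0 I1 I3 (mU {I1, I2, I3})
     + comp3 F I0 I2 I3 (mU {I0, I1}) + comp3 F I0 I2 I3 (mU {I0, I1, I2})
     + comp3 F I0 I2 I3 (mU {I0, I1, I3}) + comp3 F I0 I2 I3 (mU {I0, I1, I2, I3})"

lemma Phi_add: "Phi (F + G) = Phi F + Phi G"
  unfolding Phi_def comp3_add aug_add plus_fun_apply by (simp add: algebra_simps)

lemma Phi_0: "Phi 0 = 0"
  by (simp add: Phi_def comp3_def comp_0 aug_0 zero_fun_apply)

lemma flag_polynomial:
  fixes v0 v1 v2 v3 u0 u1 u2 u3 :: bool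
  assumes "v0 \<or> v1 \<or> v2 \<or> v3" "u0 \<or> u1 \<or> u2 \<or> u3"
    and "of_bool (v0 \<and> u0) + of_bool (v1 \<and> u1) + of_bool (v2 \<and> u2) + of_bool (v3 \<and> u3) = (0::bit)"
  shows "of_bool (v0 \<and> v0 \<and> v0)
     + of_bool (v1 \<and> v1 \<and> v1)
     + of_bool (v2 \<and> v2 \<and> v2)
     + of_bool (v3 \<and> v3 \<and> v3)
     + of_bool (v0 \<and> v0 \<and> v1)
     + of_bool (v0 \<and> v0 \<and> v2)
     + of_bool (v0 \<and> v0 \<and> v3)
     + of_bool (v1 \<and> v1 \<and> v2)
     + of_bool (v1 \<and> v1 \<and> v3)
     + of_bool (v2 \<and> v2 \<and> v3)
     + of_bool (v0 \<and> v1 \<and> v2)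
     + of_bool (v0 \<and> v1 \<and> v3)
     + of_bool (v0 \<and> v2 \<and> v3)
     + of_bool (v1 \<and> v2 \<and> v3)
     + of_bool (v0 \<and> v1 \<and> v2) * of_bool (u0 \<and> u3)
     + of_bool (v0 \<and> v1 \<and> v2) * of_bool (u1 \<and> u3)
     + of_bool (v0 \<and> v1 \<and> v2) * of_bool (u2 \<and> u3)
     + of_bool (v0 \<and> v1 \<and> v3) * of_bool (u0 \<and> u2)
     + of_bool (v0 \<and> v1 \<and> v3) * of_bool (u1 \<and> u2)
     + of_bool (v0 \<and> v1 \<and> v3) * of_bool (u0 \<and> u2 \<and> u3)
     + of_bool (v0 \<and> v1 \<and> v3) * of_bool (u1 \<and> u2 \<and> u3)
     + of_bool (v0 \<and> v2 \<and> v3) * of_bool (u0 \<and> u1)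
     + of_bool (v0 \<and> v2 \<and> v3) * of_bool (u0 \<and> u1 \<and> u2)
     + of_bool (v0 \<and> v2 \<and> v3) * of_bool (u0 \<and> u1 \<and> u3)
     + of_bool (v0 \<and> v2 \<and> v3) * of_bool (u0 \<and> u1 \<and> u2 \<and> u3) = (1::bit)"
  using assms
  by (cases v0; cases v1; cases v2; cases v3; simp) (cases u0; cases u1; cases u2; cases u3; simp)+

lemma Phi_flag:
  assumes v: "v \<noteq> {}" and u: "u \<noteq> {}" and even: "even (card (v \<inter> u))"
  shows "Phi (EE (Suc (Suc (Suc 0))) v (pt 7 u)) = 1"
proof -
  have ne: "w \<noteq> {} \<Longrightarrow> I0 \<in> w \<or> I1 \<in> w \<or> I2 \<in> w \<or> I3 \<in> w" for w
    by (metis ex_in_conv ix.exhaust)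
  have ev: "of_bool (I0 \<in> v \<and> I0 \<in> u) + of_bool (I1 \<in> v \<and> I1 \<in> u) + of_bool (I2 \<in> v \<and> I2 \<in> u) + of_bool (I3 \<in> v \<and> I3 \<in> u) = (0::bit)"
    using sum_of_bool_mem[of "v \<inter> u"] even by (simp add: sum_UNIV_ix)
  have aug_if: "aug (if P then pt 7 u else 0) = of_bool P" for P
    by (simp add: aug_pt[OF u] aug_0)
  have mU_if: "(if P then pt 7 u else 0) (mU W) = of_bool P * of_bool (W \<subseteq> u)" if "W \<noteq> {}" for P W
    using that by (simp add: pt_7_mU zero_fun_apply)
  show ?thesis
    using flag_polynomial[OF ne[OF v] ne[OF u] ev]
    unfolding Phi_def comp3_EE[OF lin_pt] aug_if by (simp only: mU_if insert_not_empty not_False_eq_True insert_subset empty_subsetI simp_thms)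
qed

lemma Phi_low:
  assumes l: "l \<in> KK 2 v"
  shows "Phi (EE (Suc (Suc (Suc (Suc 0)))) v l) = 0"
proof -
  have E1: "E1 v l \<in> SS 2 (Suc 0)" using EE_SS[OF l, of "Suc 0"] by (simp add: EE_Suc)
  show ?thesis
    unfolding EE_Suc_right[of "Suc (Suc (Suc 0))"] Phi_def comp3_EE[OF SS_lin[OF E1]]
    by (simp add: aug_0 aug_SS[OF E1] SS_mU[OF E1] zero_fun_apply)
qed

lemma rep_Phi: "rep (Suc (Suc (Suc 0))) F b \<Longrightarrow> Phi F = b"
  by (induction rule: rep.induct) (simp_all add: Phi_0 Phi_add Phi_flag Phi_low)

lemma rep_diag: "rep (Suc (Suc s)) F b \<Longrightarrow> rep (Suc s) (diag F) b"
proof (induction rule: rep.induct)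
  case zero
  show ?case by (simp add: diag_0 rep.zero)
next
  case (flag F b v u)
  then show ?case unfolding diag_add diag_EE[OF lin_pt] by (intro rep.flag)
next
  case (low F b v l)
  then show ?case unfolding diag_add diag_EE[OF paD(1)[OF KKD(1)[OF low.hyps(3)]]] by (intro rep.low)
qed

lemma rep_unique:
  assumes "3 \<le> s" "rep s F b" "rep s F c"
  shows "b = c"
  using assms
proof (induction s arbitrary: F rule: dec_induct)
  case base
  then show ?case using rep_Phi by (metis numeral_3_eq_3)
next
  case (step s)
  then obtain r where "s = Suc r" by (cases s) auto
  then show ?case using step.IH[of "diag F"] step.prems rep_diag by blast
qed

lemma relf_rep:
  assumes s: "3 \<le> s" and F: "F \<in> relf (nd 7 s)"
  shows "rep s F 0"
  using F
proof (induction rule: relf.induct)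
  case (add F G M)
  obtain r where r: "s = Suc r" using s by (cases s) auto
  obtain b where b: "rep s G b" using SS_7_rep[OF pa_SS[OF add.hyps(2)] s] by blast
  then have "rep s (\<lambda>p. G (lsub M p)) b"
    using rep_lsub[of r G b M] GLm_inverse[OF add.hyps(3)] by (auto simp: r)
  then have "rep s ((\<lambda>p. G (lsub M p)) + G) (b + b)" using b by (rule rep_plus)
  then show ?case using rep_plus[OF add.IH] by fastforce
qed (rule rep.zero)

lemma flagE_notin_relf: "3 \<le> s \<Longrightarrow> flagE s {I0} {I3} \<notin> relf (nd 7 s)"
  using relf_rep[of s "flagE s {I0} {I3}"] rep_unique[of s "flagE s {I0} {I3}" 1 0] rep_flag1[of "{I0}" "{I3}" s]
  by (auto simp: flagE_def)

lemma alpha_add: "alpha (F + G) = alpha F + alpha G"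
  by (simp add: alpha_def comp_add plus_fun_apply sum.distrib)

lemma alpha_0: "alpha 0 = 0"
  unfolding alpha_def comp_0 by (simp add: zero_fun_apply)

lemma rep_1_alpha: "rep (Suc 0) F b \<Longrightarrow> alpha F = 0"
proof (induction rule: rep.induct)
  case zero
  show ?case by (rule alpha_0)
next
  case (flag F b v u)
  have "alpha (EE (Suc 0) v (pt 7 u)) = (\<Sum>i\<in>UNIV. of_bool (i \<in> v) * of_bool (UNIV \<subseteq> u))"
    unfolding alpha_def
    by (intro sum.cong refl) (simp add: EE_Suc comp_E1[OF lin_pt] pt_7_mU zero_fun_apply)
  also have "\<dots> = of_bool (odd (card v)) * of_bool (UNIV \<subseteq> u)"
    by (simp only: sum_of_bool_mem flip: sum_distrib_right)
  also have "\<dots> = 0"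
  proof (cases "u = UNIV")
    case True
    then show ?thesis using flag.hyps(4) by simp
  next
    case False
    then show ?thesis by (auto simp: of_bool_def)
  qed
  finally show ?case using flag.IH by (simp add: alpha_add)
next
  case (low F b v l)
  have E1: "E1 v l \<in> SS 2 (Suc 0)" using EE_SS[OF low.hyps(3), of "Suc 0"] by (simp add: EE_Suc)
  have "comp i (EE (Suc (Suc 0)) v l) (mU UNIV) = 0" for i
    using SS_mU[OF E1, of UNIV] comp_E1[OF SS_lin[OF E1], of i v] by (simp add: EE_Suc zero_fun_apply)
  then have "alpha (EE (Suc (Suc 0)) v l) = 0" by (simp add: alpha_def)
  then show ?case using low.IH by (simp add: alpha_add)
qed

lemma relf_1_alpha:
  assumes F: "F \<in> relf (nd 7 (Suc 0))"
  shows "alpha F = 0"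
  using F
proof (induction rule: relf.induct)
  case zero
  show ?case by (rule alpha_0)
next
  case (add F G M)
  let ?g = "\<lambda>p. G (lsub M p)"
  obtain N where N: "\<And>p. lsub M (lsub N p) = p" using GLm_inverse[OF add.hyps(3)] by blast
  have G: "G \<in> SS 7 (Suc 0)" and g: "?g \<in> SS 7 (Suc 0)"
    using add.hyps(2) by (auto intro: pa_SS pa_lsub)
  have iff: "alpha H = 0 \<longleftrightarrow> (\<exists>b. rep (Suc 0) H b)" if "H \<in> SS 7 (Suc 0)" for H
    using SS_7_1_rep[OF that] rep_1_alpha by blast
  have "alpha ?g = 0 \<longleftrightarrow> alpha G = 0"
  proof
    assume "alpha ?g = 0"
    then obtain b where "rep (Suc 0) ?g b" using iff[OF g] by blast
    from rep_lsub[OF this, of N] have "\<exists>b. rep (Suc 0) G b" using N by auto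
    then show "alpha G = 0" using iff[OF G] by blast
  next
    assume "alpha G = 0"
    then obtain b where "rep (Suc 0) G b" using iff[OF G] by blast
    from rep_lsub[OF this, of M] show "alpha ?g = 0" using iff[OF g] by blast
  qed
  then have "alpha ?g = alpha G" by (metis bit_not_zero_iff)
  then show ?case using add.IH by (simp add: alpha_add)
qed

section \<open>Exponent vectors\<close>

fun xi :: "ix \<Rightarrow> nat" where
  "xi I0 = 0" | "xi I1 = 1" | "xi I2 = 2" | "xi I3 = 3"

lemma xi_inj: "xi i = xi j \<longleftrightarrow> i = j"
  by (cases i; cases j) simp_all

lemma xi_less: "xi i < 4"
  by (cases i) simp_all

lemma less_4_xi: "n < 4 \<Longrightarrow> \<exists>i. n = xi i"
proof -
  assume "n < 4"
  then have "n = 0 \<or> n = 1 \<or> n = 2 \<or> n = 3" by auto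
  then show ?thesis by (metis xi.simps)
qed

definition toe :: "expv \<Rightarrow> ix \<Rightarrow> nat" where
  "toe e = (\<lambda>i. e ! xi i)"

definition froe :: "(ix \<Rightarrow> nat) \<Rightarrow> expv" where
  "froe f = [f I0, f I1, f I2, f I3]"

lemma toe_froe [simp]: "toe (froe f) = f"
proof
  show "toe (froe f) i = f i" for i by (cases i) (simp_all add: toe_def froe_def)
qed

lemma length_froe [simp]: "length (froe f) = 4"
  by (simp add: froe_def)

lemma froe_toe [simp]: "length e = 4 \<Longrightarrow> froe (toe e) = e"
  by (auto simp: froe_def toe_def numeral_eq_Suc length_Suc_conv)

lemma froe_inj: "froe f = froe g \<longleftrightarrow> f = g"
  by (metis toe_froe)

lemma sum_list_froe: "sum_list (froe f) = tot f"
  by (simp add: froe_def tot_def sum_UNIV_ix add.assoc)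

lemma tot_toe: "length e = 4 \<Longrightarrow> tot (toe e) = sum_list e"
  by (metis froe_toe sum_list_froe)

lemma froe_Mon: "froe f \<in> Mon n \<longleftrightarrow> tot f = n"
  by (simp add: Mon_def sum_list_froe)

definition L4 :: "expv set" where
  "L4 = {e. length e = 4}"

lemma Mon_L4: "Mon n \<subseteq> L4"
  by (auto simp: Mon_def L4_def)

definition pol_of :: "expv set \<Rightarrow> pol" where
  "pol_of P = (\<Sum>e\<in>P. mon (toe e))"

definition Fn :: "expv set \<Rightarrow> pol \<Rightarrow> bit" where
  "Fn f = lift (\<lambda>e. of_bool (froe e \<in> f))"

lemma lin_Fn: "lin (Fn f)"
  unfolding Fn_def by (rule lin_lift_bit)

lemma Fn_mon: "Fn f (mon e) = of_bool (froe e \<in> f)"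
  by (simp add: Fn_def)

lemma Fn_pol_of:
  assumes "finite P" "P \<subseteq> L4"
  shows "Fn f (pol_of P) = of_bool (odd (card (f \<inter> P)))"
proof -
  have "Fn f (pol_of P) = (\<Sum>e\<in>P. of_bool (e \<in> f))"
    unfolding pol_of_def lin_sum[OF lin_Fn] Fn_mon
    by (intro sum.cong refl) (use assms in \<open>auto simp: L4_def\<close>)
  also have "\<dots> = of_bool (odd (card {e \<in> P. (of_bool (e \<in> f) :: bit) = 1}))"
    by (rule bit_sum_card[OF assms(1)])
  also have "{e \<in> P. (of_bool (e \<in> f) :: bit) = 1} = f \<inter> P" by auto
  finally show ?thesis .
qed

lemma lookup_sum_mon: "finite A \<Longrightarrow> lookup (\<Sum>a\<in>A. mon (toe (g a))) k = of_bool (odd (card {a \<in> A. toe (g a) = k}))"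
  by (subst lookup_sum, subst bit_sum_card) (simp_all add: lookup_mon)

lemma pol_of_parity:
  assumes A: "finite A" and g: "\<And>a. a \<in> A \<Longrightarrow> length (g a) = 4"
  shows "(\<Sum>a\<in>A. mon (toe (g a))) = pol_of {m. odd (card {a \<in> A. g a = m})}"
    and "finite {m. odd (card {a \<in> A. g a = m})}" and "{m. odd (card {a \<in> A. g a = m})} \<subseteq> L4"
proof -
  let ?S = "{m. odd (card {a \<in> A. g a = m})}"
  have ex: "\<exists>a\<in>A. g a = m" if "m \<in> ?S" for m
  proof (rule ccontr)
    assume "\<not> (\<exists>a\<in>A. g a = m)"
    then have "{a \<in> A. g a = m} = {}" by blast
    then show False using that by (metis (mono_tags, lifting) card.empty even_zero mem_Collect_eq)
  qed
  then have "?S \<subseteq> g ` A" by blast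
  then show fin: "finite ?S" using A by (meson finite_imageI finite_subset)
  show sub: "?S \<subseteq> L4" using ex g by (fastforce simp: L4_def)
  show "(\<Sum>a\<in>A. mon (toe (g a))) = pol_of ?S"
  proof (rule poly_mapping_eqI)
    fix k
    have "{a \<in> A. toe (g a) = k} = {a \<in> A. g a = froe k}"
      using g by (metis froe_toe toe_froe)
    then have "lookup (\<Sum>a\<in>A. mon (toe (g a))) k = of_bool (froe k \<in> ?S)"
      by (simp add: lookup_sum_mon[OF A])
    moreover have "{m \<in> ?S. toe m = k} = (if froe k \<in> ?S then {froe k} else {})"
      using sub by (auto simp: L4_def)
    then have "lookup (pol_of ?S) k = of_bool (froe k \<in> ?S)"
      unfolding pol_of_def using lookup_sum_mon[OF fin, of "\<lambda>x. x" k] by simp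
    ultimately show "lookup (\<Sum>a\<in>A. mon (toe (g a))) k = lookup (pol_of ?S) k" by simp
  qed
qed

lemma toe_map2: "length p = 4 \<Longrightarrow> length q = 4 \<Longrightarrow> toe (map2 (+) p q) = toe p + toe q"
  using xi_less by (auto simp: fun_eq_iff toe_def plus_fun_apply)

lemma pmult_pol_of:
  assumes P: "finite P" "P \<subseteq> L4" and Q: "finite Q" "Q \<subseteq> L4"
  shows "pol_of (pmult P Q) = pol_of P * pol_of Q" "finite (pmult P Q)" "pmult P Q \<subseteq> L4"
proof -
  let ?g = "\<lambda>(p, q). map2 (+) p q"
  have len: "length (?g a) = 4" if "a \<in> P \<times> Q" for a
    using that P Q by (fastforce simp: L4_def)
  have fin: "finite (P \<times> Q)" using P Q by simp
  have "{(p, q). p \<in> P \<and> q \<in> Q \<and> map2 (+) p q = m} = {a \<in> P \<times> Q. ?g a = m}" for m by auto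
  then have eq: "pmult P Q = {m. odd (card {a \<in> P \<times> Q. ?g a = m})}" by (simp add: pmult_def)
  have "pol_of P * pol_of Q = (\<Sum>(p, q)\<in>P \<times> Q. mon (toe p) * mon (toe q))"
    by (simp add: pol_of_def sum_product sum.cartesian_product)
  also have "\<dots> = (\<Sum>a\<in>P \<times> Q. mon (toe (?g a)))"
  proof (rule sum.cong)
    fix a assume "a \<in> P \<times> Q"
    then have "length (fst a) = 4" "length (snd a) = 4" using P Q by (auto simp: L4_def)
    then show "(case a of (p, q) \<Rightarrow> mon (toe p) * mon (toe q)) = mon (toe (?g a))"
      by (cases a) (simp add: toe_map2 mon_add)
  qed simp
  finally show "pol_of (pmult P Q) = pol_of P * pol_of Q"
    unfolding eq using pol_of_parity(1)[of "P \<times> Q" ?g, OF fin len] by simp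
  show "finite (pmult P Q)" "pmult P Q \<subseteq> L4"
    unfolding eq using pol_of_parity(2,3)[of "P \<times> Q" ?g, OF fin len] by auto
qed

lemma pone_pol_of: "pol_of pone = 1" "finite pone" "pone \<subseteq> L4"
proof -
  have "toe [0, 0, 0, 0] = 0"
    using toe_froe[of 0] by (simp add: froe_def zero_fun_apply)
  then show "pol_of pone = 1" by (simp add: pone_def pol_of_def)
qed (simp_all add: pone_def L4_def)

lemma ppow_pol_of:
  assumes P: "finite P" "P \<subseteq> L4"
  shows "pol_of (ppow P k) = pol_of P ^ k \<and> finite (ppow P k) \<and> ppow P k \<subseteq> L4"
  by (induction k) (simp_all add: pone_pol_of pmult_pol_of[OF P])

definition matM :: "(nat \<Rightarrow> nat \<Rightarrow> bool) \<Rightarrow> ix \<Rightarrow> ix set" where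
  "matM g i = {j. g (xi j) (xi i)}"

lemma unitv_xi: "unitv (xi j) = froe (unit j)"
  by (cases j) (simp_all add: unitv_def froe_def unit_def)

lemma linf_pol_of: "pol_of (linf g (xi i)) = lform (matM g i)" "finite (linf g (xi i))" "linf g (xi i) \<subseteq> L4"
proof -
  have eq: "linf g (xi i) = (\<lambda>j. froe (unit j)) ` matM g i"
  proof -
    have "linf g (xi i) = {unitv (xi j) | j. g (xi j) (xi i)}"
      unfolding linf_def using less_4_xi xi_less by blast
    then show ?thesis by (auto simp: matM_def unitv_xi)
  qed
  have inj: "inj_on (\<lambda>j. froe (unit j)) (matM g i)"
    by (rule inj_onI) (metis froe_inj unit_def zero_neq_one)
  show "pol_of (linf g (xi i)) = lform (matM g i)"
    unfolding eq pol_of_def sum.reindex[OF inj] by (simp add: lform_def X_def)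
  show "finite (linf g (xi i))" unfolding eq by simp
  show "linf g (xi i) \<subseteq> L4" unfolding eq by (auto simp: L4_def)
qed

lemma gmon_pol_of:
  assumes "length e = 4"
  shows "pol_of (gmon g e) = lsub (matM g) (mon (toe e))" "finite (gmon g e)" "gmon g e \<subseteq> L4"
proof -
  let ?P = "\<lambda>i. ppow (linf g (xi i)) (e ! xi i)"
  note pp = ppow_pol_of[OF linf_pol_of(2,3)]
  note fin = pp[THEN conjunct2, THEN conjunct1] and sub = pp[THEN conjunct2, THEN conjunct2] and pol = pp[THEN conjunct1]
  have eq: "gmon g e = pmult (?P I0) (pmult (?P I1) (pmult (?P I2) (pmult (?P I3) pone)))"
    by (simp add: gmon_def numeral_eq_Suc)
  note m3 = pmult_pol_of[OF fin sub pone_pol_of(2,3)]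
  note m2 = pmult_pol_of[OF fin sub m3(2,3)]
  note m1 = pmult_pol_of[OF fin sub m2(2,3)]
  note m0 = pmult_pol_of[OF fin sub m1(2,3)]
  show "finite (gmon g e)" "gmon g e \<subseteq> L4" unfolding eq by (rule m0(2), rule m0(3))
  show "pol_of (gmon g e) = lsub (matM g) (mon (toe e))"
    unfolding eq m0(1) m1(1) m2(1) m3(1) pol linf_pol_of(1) pone_pol_of(1)
    by (simp add: lsub_def subst_mon UNIV_ix toe_def mult.assoc)
qed

lemma of_nat_pol: "(of_nat n :: pol) = (if odd n then 1 else 0)"
  by (induction n) auto

lemma X_plus_square_power:
  "(X i + X i ^ 2) ^ n = (\<Sum>k\<le>n. if odd (n choose k) then X i ^ (n + k) else 0)"
proof -
  have "(X i + X i ^ 2) ^ n = (X i ^ 2 + X i) ^ n" by (simp add: add.commute)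
  also have "\<dots> = (\<Sum>k\<le>n. of_nat (n choose k) * (X i ^ 2) ^ k * X i ^ (n - k))"
    by (rule binomial_ring)
  also have "\<dots> = (\<Sum>k\<le>n. if odd (n choose k) then X i ^ (n + k) else 0)"
    by (intro sum.cong refl) (auto simp: of_nat_pol add.commute simp flip: power_mult power_add)
  finally show ?thesis .
qed

lemma lookup_Sq_mon:
  "lookup (Sq (mon e)) k = of_bool (\<forall>i. e i \<le> k i \<and> odd (e i choose (k i - e i)))"
proof -
  let ?C = "PiE UNIV (\<lambda>i. {..e i})"
  have prod0: "(\<Prod>i\<in>UNIV. if P i then f i else 0) = (if \<forall>i. P i then \<Prod>i\<in>UNIV. f i else (0::pol))" for P and f :: "ix \<Rightarrow> pol"
    by (auto intro!: prod_zero prod.cong)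
  have "Sq (mon e) = (\<Prod>i\<in>UNIV. \<Sum>k\<le>e i. if odd (e i choose k) then X i ^ (e i + k) else 0)"
    unfolding mon_eq_prod Sq_prod Sq_power Sq_X X_plus_square_power ..
  also have "\<dots> = (\<Sum>c\<in>?C. \<Prod>i\<in>UNIV. if odd (e i choose c i) then X i ^ (e i + c i) else 0)"
    by (rule prod_sum_PiE) simp_all
  also have "\<dots> = (\<Sum>c\<in>?C. if \<forall>i. odd (e i choose c i) then mon (\<lambda>i. e i + c i) else 0)"
    unfolding prod0 mon_eq_prod[symmetric] ..
  finally have "lookup (Sq (mon e)) k = (\<Sum>c\<in>?C. of_bool ((\<forall>i. odd (e i choose c i)) \<and> (\<lambda>i. e i + c i) = k))"
    by (simp add: lookup_sum) (intro sum.cong refl, auto simp: lookup_mon)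
  also have "\<dots> = of_bool (odd (card {c \<in> ?C. (\<forall>i. odd (e i choose c i)) \<and> (\<lambda>i. e i + c i) = k}))"
    by (subst bit_sum_card) (simp_all add: finite_PiE)
  also have "{c \<in> ?C. (\<forall>i. odd (e i choose c i)) \<and> (\<lambda>i. e i + c i) = k} =
    (if \<forall>i. e i \<le> k i \<and> odd (e i choose (k i - e i)) then {\<lambda>i. k i - e i} else {})"
  proof -
    have "c \<in> ?C \<and> (\<forall>i. odd (e i choose c i)) \<and> (\<lambda>i. e i + c i) = k \<longleftrightarrow>
      (\<forall>i. e i \<le> k i \<and> odd (e i choose (k i - e i))) \<and> c = (\<lambda>i. k i - e i)" for c
    proof
      assume c: "c \<in> ?C \<and> (\<forall>i. odd (e i choose c i)) \<and> (\<lambda>i. e i + c i) = k"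
      then have k: "k i = e i + c i" for i by auto
      show "(\<forall>i. e i \<le> k i \<and> odd (e i choose (k i - e i))) \<and> c = (\<lambda>i. k i - e i)" using c by (simp add: k)
    next
      assume c: "(\<forall>i. e i \<le> k i \<and> odd (e i choose (k i - e i))) \<and> c = (\<lambda>i. k i - e i)"
      then have "odd (e i choose c i)" for i by simp
      moreover from this have "c i \<le> e i" for i by (metis binomial_eq_0 even_zero not_le)
      moreover have "(\<lambda>i. e i + c i) = k" using c by (auto simp: fun_eq_iff)
      ultimately show "c \<in> ?C \<and> (\<forall>i. odd (e i choose c i)) \<and> (\<lambda>i. e i + c i) = k" by auto
    qed
    then show ?thesis by (auto simp only: split: if_splits)
  qed
  finally show ?thesis by simp
qed

lemma all_less_4: "(\<forall>j<4. P j) \<longleftrightarrow> (\<forall>i. P (xi i))" for P :: "nat \<Rightarrow> bool"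
  using less_4_xi xi_less by blast

lemma Fn_Sq:
  assumes b: "length b = 4" and f: "f \<subseteq> Mon (sum_list b + i)"
  shows "Fn f (Sq (mon (toe b))) = of_bool (odd (card (f \<inter> sq_mon i b)))"
proof -
  let ?q = "Sq (mon (toe b))"
  have mem: "froe k \<in> sq_mon i b \<longleftrightarrow> k \<in> keys ?q" if "froe k \<in> f" for k
  proof -
    have "(\<Prod>j<4. b ! j choose (froe k ! j - b ! j)) = (\<Prod>j\<in>UNIV. toe b j choose (k j - toe b j))"
      by (simp add: UNIV_ix toe_def froe_def numeral_eq_Suc lessThan_Suc ac_simps)
    moreover have "odd (\<Prod>j\<in>UNIV. toe b j choose (k j - toe b j)) \<longleftrightarrow> (\<forall>j. odd (toe b j choose (k j - toe b j)))"
      by (auto simp: UNIV_ix all_ix)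
    moreover have "list_all2 (\<le>) b (froe k) \<longleftrightarrow> (\<forall>j. toe b j \<le> k j)"
      using b all_less_4[of "\<lambda>j. b ! j \<le> froe k ! j"]
      by (simp add: list_all2_conv_all_nth) (simp add: toe_def all_ix froe_def)
    ultimately show ?thesis
      using f that by (auto simp: sq_mon_def in_keys_iff lookup_Sq_mon split: if_splits)
  qed
  have "Fn f ?q = (\<Sum>k\<in>keys ?q. of_bool (froe k \<in> f))" by (simp add: Fn_def lift_def)
  also have "\<dots> = of_bool (odd (card {k \<in> keys ?q. (of_bool (froe k \<in> f) :: bit) = 1}))"
    by (rule bit_sum_card) simp
  also have "card {k \<in> keys ?q. (of_bool (froe k \<in> f) :: bit) = 1} = card (f \<inter> sq_mon i b)"
  proof (rule bij_betw_same_card[of froe], rule bij_betw_imageI)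
    show "inj_on froe {k \<in> keys ?q. (of_bool (froe k \<in> f) :: bit) = 1}" by (auto simp: inj_on_def froe_inj)
    have "x \<in> froe ` {k \<in> keys ?q. froe k \<in> f}" if "x \<in> f" "x \<in> sq_mon i b" for x
    proof -
      have "x = froe (toe x)" using that f by (auto simp: Mon_def)
      then show ?thesis using that mem[of "toe x"] by (metis (mono_tags, lifting) imageI mem_Collect_eq)
    qed
    then show "froe ` {k \<in> keys ?q. (of_bool (froe k \<in> f) :: bit) = 1} = f \<inter> sq_mon i b"
      using mem by auto
  qed
  finally show ?thesis .
qed

lemma supported_Fn: "f \<subseteq> Mon n \<Longrightarrow> supported n (Fn f)"
  by (auto simp: supported_def Fn_mon froe_Mon)

lemma Fn_pa:
  assumes f: "f \<in> PA n"
  shows "Fn f \<in> pa n"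
proof -
  have sub: "f \<subseteq> Mon n" and sq: "\<And>i. 0 < i \<Longrightarrow> i \<le> n \<Longrightarrow> dsq n f i = {}" using f by (auto simp: PA_def)
  have "Fn f (Sq p) = Fn f p" for p
  proof (rule lin_ext_mon[OF lin_comp[OF lin_Fn lin_Sq] lin_Fn])
    fix e
    show "Fn f (Sq (mon e)) = Fn f (mon e)"
    proof (cases "tot e < n")
      case True
      let ?i = "n - tot e" and ?b = "froe e"
      have "?b \<in> Mon (n - ?i)" using True by (simp add: froe_Mon)
      moreover have "dsq n f ?i = {}" using True by (intro sq) auto
      ultimately have "even (card (f \<inter> sq_mon ?i ?b))" by (auto simp: dsq_def)
      moreover have "f \<subseteq> Mon (sum_list ?b + ?i)" using sub True by (simp add: sum_list_froe)
      ultimately have "Fn f (Sq (mon e)) = 0" using Fn_Sq[of ?b f ?i] by simp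
      then show ?thesis using supportedD[OF supported_Fn[OF sub], of e] True by simp
    next
      case False
      then have "Fn f (Sq (mon e) + mon e) = 0"
        using highdeg_Sq_mon[of e] by (intro supported_eq_0[OF lin_Fn supported_Fn[OF sub]]) (fastforce simp: highdeg_def)
      then show ?thesis by (simp add: lin_add[OF lin_Fn] bit_add_eq_0_iff)
    qed
  qed
  then show ?thesis using lin_Fn supported_Fn[OF sub] by (simp add: pa_def)
qed

definition setof :: "(pol \<Rightarrow> bit) \<Rightarrow> expv set" where
  "setof F = {e. length e = 4 \<and> F (mon (toe e)) = 1}"

lemma Fn_setof: "lin F \<Longrightarrow> Fn (setof F) = F"
proof
  assume F: "lin F"
  show "Fn (setof F) p = F p" for p
  proof (rule lin_ext_mon[OF lin_Fn F])
    show "Fn (setof F) (mon e) = F (mon e)" for e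
      by (cases "F (mon e)") (simp_all add: Fn_mon setof_def)
  qed
qed

lemma setof_Fn: "f \<subseteq> L4 \<Longrightarrow> setof (Fn f) = f"
  by (auto simp: setof_def Fn_mon L4_def)

lemma setof_PA:
  assumes F: "F \<in> pa n"
  shows "setof F \<in> PA n"
proof -
  note linF = paD(1)[OF F]
  have sub: "setof F \<subseteq> Mon n"
  proof
    fix e assume e: "e \<in> setof F"
    then have "tot (toe e) = n" using supportedD[OF paD(2)[OF F], of "toe e"] by (auto simp: setof_def)
    then show "e \<in> Mon n" using e by (simp add: setof_def Mon_def tot_toe)
  qed
  have "even (card (setof F \<inter> sq_mon i b))" if "0 < i" "i \<le> n" "b \<in> Mon (n - i)" for i b
  proof -
    have b: "length b = 4" "sum_list b + i = n" using that by (auto simp: Mon_def)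
    then have "of_bool (odd (card (setof F \<inter> sq_mon i b))) = F (Sq (mon (toe b)))"
      using Fn_Sq[of b "setof F" i] sub by (simp add: Fn_setof[OF linF])
    also have "\<dots> = F (mon (toe b))" by (rule paD(3)[OF F])
    also have "\<dots> = 0" using b that(1) by (intro supportedD[OF paD(2)[OF F]]) (simp add: tot_toe)
    finally show ?thesis by (simp add: of_bool_def split: if_splits)
  qed
  then show ?thesis using sub by (auto simp: PA_def dsq_def)
qed

lemma Fn_dact:
  assumes f: "f \<subseteq> Mon n"
  shows "Fn (dact n g f) = (\<lambda>p. Fn f (lsub (matM g) p))"
proof
  fix p
  show "Fn (dact n g f) p = Fn f (lsub (matM g) p)"
  proof (rule lin_ext_mon[OF lin_Fn lin_comp[OF lin_Fn lin_lsub]])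
    fix e
    have "Fn f (lsub (matM g) (mon e)) = of_bool (odd (card (f \<inter> gmon g (froe e))))"
      using gmon_pol_of[of "froe e" g] Fn_pol_of[of "gmon g (froe e)" f] by simp
    moreover have "Fn f (lsub (matM g) (mon e)) = 0" if "tot e \<noteq> n"
      using homog_lsub_mon[of e "matM g"] that
      by (intro supported_eq_0[OF lin_Fn supported_Fn[OF f]]) (auto simp: homog_def)
    ultimately show "Fn (dact n g f) (mon e) = Fn f (lsub (matM g) (mon e))"
      by (auto simp: Fn_mon dact_def froe_Mon)
  qed
qed

lemma Fn_sdiff: "Fn (sdiff A B) = Fn A + Fn B"
proof
  show "Fn (sdiff A B) p = (Fn A + Fn B) p" for p
    by (rule lin_ext_mon[OF lin_Fn lin_plus_fun[OF lin_Fn lin_Fn]])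
      (auto simp: plus_fun_apply Fn_mon sdiff_def of_bool_def)
qed

lemma Fn_xsum:
  assumes "finite T"
  shows "Fn (xsum T) = (\<Sum>A\<in>T. Fn A)"
proof
  fix p
  have lin: "lin (\<Sum>A\<in>T. Fn A)"
    by (simp add: lin_def sum_fun_apply lin_add[OF lin_Fn] sum.distrib)
  show "Fn (xsum T) p = (\<Sum>A\<in>T. Fn A) p"
  proof (rule lin_ext_mon[OF lin_Fn lin])
    fix e
    have "(\<Sum>A\<in>T. Fn A) (mon e) = of_bool (odd (card {A \<in> T. froe e \<in> A}))"
      using bit_sum_card[OF assms, of "\<lambda>A. of_bool (froe e \<in> A)"] by (simp add: sum_fun_apply Fn_mon)
    then show "Fn (xsum T) (mon e) = (\<Sum>A\<in>T. Fn A) (mon e)"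
      by (simp add: Fn_mon xsum_def)
  qed
qed

lemma Fn_inj: "A \<subseteq> L4 \<Longrightarrow> B \<subseteq> L4 \<Longrightarrow> Fn A = Fn B \<Longrightarrow> A = B"
  by (metis setof_Fn)

lemma card_xi: "card {j. j < 4 \<and> P j} = card {j. P (xi j)}"
proof -
  have "{j. j < 4 \<and> P j} = xi ` {j. P (xi j)}" using less_4_xi xi_less by blast
  moreover have "inj_on xi {j. P (xi j)}" by (auto simp: inj_on_def xi_inj)
  ultimately show ?thesis by (simp add: card_image)
qed

lemma GLm_matM:
  assumes "g \<in> GL4"
  shows "GLm (matM g)"
proof -
  obtain h where h: "\<forall>i<4. \<forall>k<4. odd (card {j. j < 4 \<and> g i j \<and> h j k}) = (i = k)"
    using assms by (auto simp: GL4_def)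
  have "odd (card {j. i \<in> matM g j \<and> j \<in> matM h k}) \<longleftrightarrow> i = k" for i k
    using h[rule_format, OF xi_less xi_less, of i k]
    by (simp add: card_xi[of "\<lambda>j. g (xi i) j \<and> h j (xi k)"] matM_def xi_inj)
  then show ?thesis unfolding GLm_def by blast
qed

lemma GLm_ex_GL4:
  assumes "GLm M"
  obtains g where "g \<in> GL4" "matM g = M"
proof -
  obtain N where N: "\<And>i k. odd (card {j. i \<in> M j \<and> j \<in> N k}) \<longleftrightarrow> i = k" using assms by (auto simp: GLm_def)
  define nx where "nx n = (THE i. xi i = n)" for n
  have nx: "nx (xi i) = i" for i unfolding nx_def by (rule the_equality) (auto simp: xi_inj)
  define g where "g a b = (nx a \<in> M (nx b))" for a b
  define h where "h a b = (nx a \<in> N (nx b))" for a b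
  have "odd (card {j. j < 4 \<and> g i j \<and> h j k}) = (i = k)" if ik4: "i < 4" "k < 4" for i k
  proof -
    obtain i' k' where ik: "i = xi i'" "k = xi k'" using less_4_xi[OF ik4(1)] less_4_xi[OF ik4(2)] by blast
    show ?thesis
      unfolding ik card_xi[of "\<lambda>j. g (xi i') j \<and> h j (xi k')"] using N[of i' k'] by (simp add: g_def h_def nx xi_inj)
  qed
  then have "g \<in> GL4" by (auto simp: GL4_def)
  moreover have "matM g = M" by (auto simp: fun_eq_iff matM_def g_def nx)
  ultimately show ?thesis by (rule that)
qed

definition gens :: "nat \<Rightarrow> vec2 set" where
  "gens n = {sdiff (dact n g f) f | f g. f \<in> PA n \<and> g \<in> GL4}"

lemma Rel_gens: "Rel n = span2 (gens n)"
  by (simp add: Rel_def gens_def)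

lemma PA_Mon: "f \<in> PA n \<Longrightarrow> f \<subseteq> Mon n"
  by (simp add: PA_def)

lemma gens_Mon: "A \<in> gens n \<Longrightarrow> A \<subseteq> Mon n"
  using PA_Mon by (auto simp: gens_def sdiff_def dact_def)

lemma Rel_Mon:
  assumes "A \<in> Rel n"
  shows "A \<subseteq> Mon n"
proof -
  obtain T where T: "A = xsum T" "finite T" "T \<subseteq> gens n" using assms by (auto simp: Rel_gens span2_def)
  show ?thesis
  proof
    fix x assume "x \<in> A"
    then have "odd (card {A \<in> T. x \<in> A})" by (simp add: T(1) xsum_def)
    then have "{A \<in> T. x \<in> A} \<noteq> {}" by (metis card.empty even_zero)
    then show "x \<in> Mon n" using T(3) gens_Mon by blast
  qed
qed

lemma Fn_gens: "A \<in> gens n \<Longrightarrow> \<exists>G\<in>pa n. \<exists>M. GLm M \<and> Fn A = (\<lambda>p. G (lsub M p)) + G"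
proof -
  assume "A \<in> gens n"
  then obtain f g where fg: "A = sdiff (dact n g f) f" "f \<in> PA n" "g \<in> GL4" by (auto simp: gens_def)
  then show ?thesis
    using Fn_pa[OF fg(2)] GLm_matM[OF fg(3)] Fn_sdiff Fn_dact[OF PA_Mon[OF fg(2)]] by metis
qed

lemma Fn_Rel:
  assumes "A \<in> Rel n"
  shows "Fn A \<in> relf n"
proof -
  obtain T where T: "A = xsum T" "finite T" "T \<subseteq> gens n" using assms by (auto simp: Rel_gens span2_def)
  have "Fn B \<in> relf n" if B: "B \<in> gens n" for B
  proof -
    obtain G M where "G \<in> pa n" "GLm M" "Fn B = (\<lambda>p. G (lsub M p)) + G" using Fn_gens[OF B] by blast
    then show ?thesis using relf_gen by simp
  qed
  then show ?thesis unfolding T(1) Fn_xsum[OF T(2)] using T(3) by (intro relf_sum) auto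
qed

lemma relf_ex_Rel: "F \<in> relf n \<Longrightarrow> \<exists>A\<in>Rel n. Fn A = F"
proof (induction rule: relf.induct)
  case zero
  have "xsum {} \<in> Rel n" unfolding Rel_gens span2_def by blast
  moreover have "Fn (xsum {}) = 0" by (simp add: Fn_xsum)
  ultimately show ?case by blast
next
  case (add F G M)
  then obtain T where T: "Fn (xsum T) = F" "finite T" "T \<subseteq> gens n" by (auto simp: Rel_gens span2_def)
  obtain g where g: "g \<in> GL4" "matM g = M" using GLm_ex_GL4[OF add.hyps(3)] by blast
  let ?f = "setof G"
  let ?B = "sdiff (dact n g ?f) ?f"
  have f: "?f \<in> PA n" by (rule setof_PA[OF add.hyps(2)])
  have FB: "Fn ?B = (\<lambda>p. G (lsub M p)) + G"
    by (simp add: Fn_sdiff Fn_dact[OF PA_Mon[OF f]] Fn_setof[OF paD(1)[OF add.hyps(2)]] g(2))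
  have B: "?B \<in> gens n" using f g(1) by (auto simp: gens_def)
  let ?T = "if ?B \<in> T then T - {?B} else insert ?B T"
  have "xsum ?T \<in> Rel n" unfolding Rel_gens span2_def using T B by fastforce
  moreover have "Fn (xsum ?T) = F + Fn ?B"
  proof (cases "?B \<in> T")
    case True
    then have "F = Fn ?B + Fn (xsum (T - {?B}))"
      using T(1,2) sum.remove[of T ?B Fn] by (simp add: Fn_xsum)
    then show ?thesis using True by (simp add: add.commute)
  next
    case False
    then show ?thesis using T(1,2) by (simp add: Fn_xsum add.commute)
  qed
  ultimately show ?case using FB by metis
qed

lemma relf_Rel:
  assumes "f \<subseteq> Mon n" "Fn f \<in> relf n"
  shows "f \<in> Rel n"
proof -
  obtain A where "A \<in> Rel n" "Fn A = Fn f" using relf_ex_Rel[OF assms(2)] by blast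
  moreover from this have "A = f" using assms(1) Rel_Mon Mon_L4 by (intro Fn_inj) blast+
  ultimately show ?thesis by simp
qed

lemma degN_nd: "degN s = nd 7 s"
proof -
  have "2 ^ (s + 3) + 2 ^ (s + 1) = 2 ^ s * (10::nat)" by (simp add: power_add)
  then show ?thesis by (simp add: degN_def nd_def)
qed

lemma E1_mon: "E1 v h (mon e) = (\<Sum>i\<in>UNIV. if {j. odd (e j)} = - {i} then (if i \<in> v then h else 0) (mon (\<lambda>j. e j div 2)) else 0)"
  unfolding E1_def cons_def lift_mon ..

lemma Fn_wgen: "Fn (wgen s) = flagE s {I0} {I3}"
proof
  fix p
  show "Fn (wgen s) p = flagE s {I0} {I3} p"
  proof (rule lin_ext_mon[OF lin_Fn])
    show "lin (flagE s {I0} {I3})" unfolding flagE_def by (rule lin_EE[OF lin_pt])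
    have "flagE s {I0} {I3} (mon e) = of_bool (e I0 = 0 \<and> e I1 = 2 ^ s - 1 \<and> e I2 = 2 ^ s - 1 \<and> e I3 = 2 ^ (s + 3) - 1)" for e
    proof (induction s arbitrary: e)
      case 0
      show ?case
        by (auto simp: flagE_def pt_mon tot_def sum_UNIV_ix subset_iff all_ix of_bool_def)
    next
      case (Suc s)
      have odd_set: "{j. odd (e j)} = - {I0} \<longleftrightarrow> even (e I0) \<and> odd (e I1) \<and> odd (e I2) \<and> odd (e I3)"
        by (auto simp: set_eq_iff all_ix)
      have "flagE (Suc s) {I0} {I3} (mon e) = (\<Sum>i\<in>UNIV. if {j. odd (e j)} = - {i} then (if i \<in> {I0} then flagE s {I0} {I3} else 0) (mon (\<lambda>j. e j div 2)) else 0)"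
        unfolding flagE_def EE_Suc by (rule E1_mon)
      also have "\<dots> = (if {j. odd (e j)} = - {I0} then flagE s {I0} {I3} (mon (\<lambda>j. e j div 2)) else 0)"
        by (simp add: sum_UNIV_ix zero_fun_apply)
      also have "\<dots> = of_bool (e I0 = 0 \<and> e I1 = 2 ^ Suc s - 1 \<and> e I2 = 2 ^ Suc s - 1 \<and> e I3 = 2 ^ (Suc s + 3) - 1)"
      proof -
        have half: "odd x \<and> x div 2 = 2 ^ k - 1 \<longleftrightarrow> x = 2 ^ Suc k - 1" for x k :: nat
        proof -
          have "(1::nat) \<le> 2 ^ k" by simp
          then have "2 ^ Suc k - 1 = Suc (2 * (2 ^ k - 1 :: nat))" unfolding power_Suc by arith
          then show ?thesis by presburger
        qed
        have half0: "even x \<and> x div 2 = 0 \<longleftrightarrow> x = 0" for x :: nat by presburger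
        have "{j. odd (e j)} = - {I0} \<and> e I0 div 2 = 0 \<and> e I1 div 2 = 2 ^ s - 1 \<and> e I2 div 2 = 2 ^ s - 1 \<and> e I3 div 2 = 2 ^ (s + 3) - 1
          \<longleftrightarrow> e I0 = 0 \<and> e I1 = 2 ^ Suc s - 1 \<and> e I2 = 2 ^ Suc s - 1 \<and> e I3 = 2 ^ (Suc s + 3) - 1"
          unfolding odd_set add_Suc using half0[of "e I0"] half[of "e I1" s] half[of "e I2" s] half[of "e I3" "s + 3"] by argo
        then show ?thesis unfolding Suc.IH by (simp only: of_bool_def if_if_eq_conj)
      qed
      finally show ?case .
    qed
    then show "Fn (wgen s) (mon e) = flagE s {I0} {I3} (mon e)" for e
      by (simp add: Fn_mon wgen_def froe_def)
  qed
qed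

lemma wgen_PA: "wgen s \<in> PA (degN s)"
proof -
  have "flagE s {I0} {I3} \<in> pa (nd 7 s)" unfolding flagE_def by (intro EE_pa pt_7_KK) simp
  then have "setof (Fn (wgen s)) \<in> PA (degN s)" unfolding Fn_wgen degN_nd by (rule setof_PA)
  moreover have "wgen s \<subseteq> L4" by (simp add: wgen_def L4_def)
  ultimately show ?thesis by (simp add: setof_Fn)
qed

lemma sdiff_Mon: "A \<subseteq> Mon n \<Longrightarrow> B \<subseteq> Mon n \<Longrightarrow> sdiff A B \<subseteq> Mon n"
  by (auto simp: sdiff_def)

lemma rep_Rel:
  assumes f: "f \<in> PA (degN s)" and rep: "rep s (Fn f) b"
  shows "f \<in> Rel (degN s) \<or> sdiff f (wgen s) \<in> Rel (degN s)"
proof -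
  have "Fn f + sc b (Fn (wgen s)) \<in> relf (nd 7 s)"
    unfolding Fn_wgen by (rule rep_relf[OF rep]) simp_all
  then show ?thesis
    using relf_Rel[OF PA_Mon[OF f]] relf_Rel[OF sdiff_Mon[OF PA_Mon[OF f] PA_Mon[OF wgen_PA]]]
    by (cases b) (simp_all add: Fn_sdiff degN_nd)
qed

lemma rep_Rel_wgen:
  assumes f: "f \<in> PA (degN s)" and rep: "rep s (Fn f) b" and w: "flagE s {I0} {I3} \<in> relf (nd 7 s)"
  shows "f \<in> Rel (degN s)"
proof -
  have "Fn f + sc b (flagE s {I0} {I3}) \<in> relf (nd 7 s)"
    by (rule rep_relf[OF rep]) simp_all
  moreover have "sc b (flagE s {I0} {I3}) \<in> relf (nd 7 s)" using w by (cases b) (simp_all add: relf.zero)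
  ultimately have "Fn f \<in> relf (nd 7 s)" by (rule relf_cancel)
  then show ?thesis using relf_Rel[OF PA_Mon[OF f]] by (simp add: degN_nd)
qed

lemma coinv_wgen:
  assumes s: "3 \<le> s"
  shows "coinv_spanned_by (degN s) (wgen s)"
  unfolding coinv_spanned_by_def
proof (intro conjI ballI)
  show "wgen s \<in> PA (degN s)" by (rule wgen_PA)
  show "wgen s \<notin> Rel (degN s)"
    using flagE_notin_relf[OF s] Fn_Rel[of "wgen s" "degN s"] by (auto simp: Fn_wgen degN_nd)
  fix f assume f: "f \<in> PA (degN s)"
  then have "Fn f \<in> SS 7 s" using Fn_pa pa_SS by (simp add: degN_nd)
  then obtain b where "rep s (Fn f) b" using SS_7_rep[OF _ s] by blast
  then show "f \<in> Rel (degN s) \<or> sdiff f (wgen s) \<in> Rel (degN s)" by (rule rep_Rel[OF f])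
qed

lemma coinv_zero_2: "coinv_zero (degN (Suc (Suc 0)))"
  unfolding coinv_zero_def
proof
  fix f assume f: "f \<in> PA (degN (Suc (Suc 0)))"
  then have "Fn f \<in> SS 7 (Suc (Suc 0))" using Fn_pa pa_SS by (simp add: degN_nd)
  then obtain b where "rep (Suc (Suc 0)) (Fn f) b" using SS_7_2_rep by blast
  then show "f \<in> Rel (degN (Suc (Suc 0)))" by (rule rep_Rel_wgen[OF f _ flagE_2_relf])
qed

lemma coinv_alpha:
  assumes z: "z \<in> PA (degN (Suc 0))" and alpha: "alpha (Fn z) = 1"
  shows "coinv_spanned_by (degN (Suc 0)) z"
  unfolding coinv_spanned_by_def
proof (intro conjI ballI)
  show "z \<in> PA (degN (Suc 0))" by (rule z)
  show "z \<notin> Rel (degN (Suc 0))"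
    using relf_1_alpha[of "Fn z"] Fn_Rel[of z "degN (Suc 0)"] alpha by (auto simp: degN_nd)
  fix f assume f: "f \<in> PA (degN (Suc 0))"
  have Rel: "g \<in> Rel (degN (Suc 0))" if g: "g \<in> PA (degN (Suc 0))" "alpha (Fn g) = 0" for g
  proof -
    have "Fn g \<in> SS 7 (Suc 0)" using Fn_pa[OF g(1)] pa_SS by (simp add: degN_nd)
    then obtain b where "rep (Suc 0) (Fn g) b" using SS_7_1_rep g(2) by blast
    then show ?thesis by (rule rep_Rel_wgen[OF g(1) _ flagE_1_relf])
  qed
  show "f \<in> Rel (degN (Suc 0)) \<or> sdiff f z \<in> Rel (degN (Suc 0))"
  proof (cases "alpha (Fn f) = 0")
    case False
    have "Fn (sdiff f z) \<in> pa (degN (Suc 0))" unfolding Fn_sdiff by (intro pa_add Fn_pa f z)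
    then have "setof (Fn (sdiff f z)) \<in> PA (degN (Suc 0))" by (rule setof_PA)
    then have "sdiff f z \<in> PA (degN (Suc 0))"
      using sdiff_Mon[OF PA_Mon[OF f] PA_Mon[OF z]] Mon_L4 by (subst (asm) setof_Fn) blast+
    moreover have "alpha (Fn (sdiff f z)) = 0" using False alpha by (simp add: Fn_sdiff alpha_add)
    ultimately show ?thesis using Rel by blast
  qed (use Rel[OF f] in blast)
qed

section \<open>The element of degree seventeen\<close>

definition zeta_list :: "expv list" where
  "zeta_list = [[5,5,5,2], [5,5,6,1], [3,5,8,1], [5,3,8,1], [3,6,7,1], [5,7,4,1], [7,5,4,1],
    [3,9,4,1], [9,3,4,1], [3,9,3,2], [9,3,3,2], [5,9,2,1], [9,5,2,1], [5,10,1,1], [9,6,1,1],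
    [3,11,2,1], [11,3,2,1], [5,5,3,4], [5,3,5,4], [3,5,5,4], [3,12,1,1], [11,4,1,1], [7,8,1,1],
    [7,7,1,2], [13,2,1,1], [14,1,1,1], [6,5,3,3], [5,3,6,3], [3,6,5,3], [6,3,3,5], [3,3,6,5],
    [3,6,3,5], [5,3,3,6], [3,5,3,6], [3,3,5,6], [3,3,3,8], [3,3,4,7], [3,5,2,7], [3,6,1,7],
    [3,3,9,2], [3,3,10,1], [5,3,7,2], [5,7,3,2], [7,5,3,2]]"

lemma zeta_list: "zeta = set zeta_list"
  by (simp add: zeta_def zeta_list_def)

definition adm :: "nat \<Rightarrow> nat \<Rightarrow> bool" where
  "adm x y \<longleftrightarrow> x \<le> y \<and> odd (x choose (y - x))"

definition bin_table :: "(nat \<times> nat list) list" where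
  "bin_table = [(0, [0]), (1, [1, 2]), (2, [2, 4]), (3, [3, 4, 5, 6]), (4, [4, 8]), (5, [5, 6, 9, 10]),
    (6, [6, 8, 10, 12]), (7, [7, 8, 9, 10, 11, 12, 13, 14]), (8, [8]), (9, [9, 10]), (10, [10, 12]),
    (11, [11, 12, 13, 14]), (12, [12]), (13, [13, 14]), (14, [14])]"

text \<open>Determines the parity for all exponent vectors \<open>b\<close> at once, by branching on the successive entries of \<open>b\<close>;
  only those of degree 17, on which \<open>Sq\<^sup>0\<close> acts, may occur an odd number of times.\<close>

fun check_even :: "nat \<Rightarrow> nat \<Rightarrow> expv list \<Rightarrow> bool" where
  "check_even k s [] = True"
| "check_even 0 s (e # es) = (s = 17 \<or> odd (length es))"
| "check_even (Suc k) s (e # es) = 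
    list_all (\<lambda>(x, us). check_even k (s + x) (map tl (filter (\<lambda>e. hd e \<in> set us) (e # es)))) bin_table"

lemma bin_table: "\<forall>(x, us)\<in>set bin_table. \<forall>y\<in>set [0..<15]. y \<in> set us \<longleftrightarrow> adm x y"
  by (simp add: adm_def bin_table_def upt_rec numeral_eq_Suc even_Suc_Suc_iff[unfolded numeral_2_eq_2])

lemma fst_bin_table: "map fst bin_table = [0..<15]"
  by code_simp

lemma zeta_list_props:
  "distinct zeta_list" "\<forall>e\<in>set zeta_list. length e = 4 \<and> sum_list e = 17 \<and> (\<forall>y\<in>set e. y < 15)"
  by (simp_all add: zeta_list_def)

lemma check_even_zeta: "check_even (Suc (Suc (Suc (Suc 0)))) 0 zeta_list"
  by (simp add: zeta_list_def bin_table_def)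

lemma check_even_sound:
  assumes "\<forall>e\<in>set es. length e = k \<and> (\<forall>y\<in>set e. y < 15)" "length b = k" "check_even k s es"
  shows "s + sum_list b = 17 \<or> even (length (filter (list_all2 adm b) es))"
  using assms
proof (induction k arbitrary: s es b)
  case 0
  then have "filter (list_all2 adm b) es = es" by (auto simp: filter_id_conv)
  then show ?case using 0 by (cases es) auto
next
  case (Suc k)
  then obtain x b' where b: "b = x # b'" "length b' = k" by (cases b) auto
  have es: "e \<noteq> []" "length (tl e) = k" "hd e < 15" "y \<in> set (tl e) \<Longrightarrow> y < 15" if e: "e \<in> set es" for e y
  proof -
    have "length e = Suc k" "\<forall>y\<in>set e. y < 15" using Suc.prems(1) e by auto
    then show "e \<noteq> []" "length (tl e) = k" "hd e < 15" "y \<in> set (tl e) \<Longrightarrow> y < 15" by (cases e; auto)+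
  qed
  have split: "list_all2 adm b e \<longleftrightarrow> adm x (hd e) \<and> list_all2 adm b' (tl e)" if "e \<in> set es" for e
    using es(1)[OF that] by (cases e) (auto simp: b(1))
  show ?case
  proof (cases "x < 15 \<and> es \<noteq> []")
    case False
    have "\<not> list_all2 adm b e" if e: "e \<in> set es" for e
      using False es(3)[OF e] e by (auto simp: split[OF e] adm_def)
    then have none: "filter (list_all2 adm b) es = []" by (simp add: filter_empty_conv)
    show ?thesis unfolding none by simp
  next
    case True
    then have "x \<in> fst ` set bin_table"
      unfolding set_map[symmetric] fst_bin_table by simp
    then obtain us where us: "(x, us) \<in> set bin_table" by force
    let ?es = "map tl (filter (\<lambda>e. hd e \<in> set us) es)"
    have "check_even k (s + x) ?es"
      using Suc.prems(3) True us by (cases es) (auto simp: list_all_iff)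
    moreover have "\<forall>e\<in>set ?es. length e = k \<and> (\<forall>y\<in>set e. y < 15)" using es by auto
    ultimately have "s + x + sum_list b' = 17 \<or> even (length (filter (list_all2 adm b') ?es))"
      using b(2) by (intro Suc.IH)
    moreover have "filter (\<lambda>e. hd e \<in> set us \<and> list_all2 adm b' (tl e)) es = filter (list_all2 adm b) es"
    proof (rule filter_cong[OF refl])
      fix e assume e: "e \<in> set es"
      then have "hd e \<in> set us \<longleftrightarrow> adm x (hd e)" using bin_table us es(3)[OF e] by (fastforce simp: adm_def)
      then show "(hd e \<in> set us \<and> list_all2 adm b' (tl e)) = list_all2 adm b e" by (simp add: split[OF e])
    qed
    ultimately show ?thesis by (simp add: b(1) filter_map comp_def conj_commute add.assoc)
  qed
qed

lemma zeta_PA: "zeta \<in> PA (degN (Suc 0))"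
proof -
  have N: "degN (Suc 0) = 17" by (simp add: degN_def)
  have "even (card (zeta \<inter> sq_mon i b))" if "0 < i" "i \<le> 17" "b \<in> Mon (17 - i)" for i b
  proof -
    have b: "length b = 4" "sum_list b + i = 17" using that by (auto simp: Mon_def)
    have "e \<in> sq_mon i b \<longleftrightarrow> list_all2 adm b e" if "e \<in> zeta" for e
    proof -
      have e: "length e = 4" "sum_list e = 17" using zeta_list_props(2) that by (auto simp: zeta_list)
      show ?thesis
        using b e by (auto simp: sq_mon_def Mon_def adm_def even_prod_iff list_all2_conv_all_nth)
    qed
    then have "zeta \<inter> sq_mon i b = set (filter (list_all2 adm b) zeta_list)" by (auto simp: zeta_list)
    then have "card (zeta \<inter> sq_mon i b) = length (filter (list_all2 adm b) zeta_list)"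
      using distinct_card[OF distinct_filter[OF zeta_list_props(1)]] by simp
    moreover have "0 + sum_list b = 17 \<or> even (length (filter (list_all2 adm b) zeta_list))"
      using zeta_list_props(2) b(1) check_even_zeta by (intro check_even_sound[of _ "Suc (Suc (Suc (Suc 0)))"]) auto
    ultimately show ?thesis using b that(1) by simp
  qed
  moreover have "zeta \<subseteq> Mon 17" using zeta_list_props(2) by (auto simp: zeta_list Mon_def)
  ultimately show ?thesis by (auto simp: N PA_def dsq_def)
qed

lemma mU_UNIV: "mU UNIV = mon (\<lambda>j. if j = I0 then 1 else 2)"
proof -
  have compl: "X I1 * X I2 * X I3 = xs (- {I0})"
    by (simp add: xs_def Compl_eq_Diff_UNIV UNIV_ix prod.insert_remove insert_Diff_if mult.assoc)
  have "xs (- {I0}) = mon (\<lambda>j. of_bool (j \<noteq> I0))"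
    using xs_square_mon[of "- {I0}" 0] by (simp add: zero_fun_apply)
  moreover have "mU UNIV = xs {I0} * (X I1 * X I2 * X I3)^2" by (simp add: mU_def xs_def)
  ultimately have "mU UNIV = mon (\<lambda>j. of_bool (j = I0) + 2 * of_bool (j \<noteq> I0))"
    by (simp add: compl xs_square_mon)
  moreover have "(\<lambda>j. of_bool (j = I0) + 2 * of_bool (j \<noteq> I0)) = (\<lambda>j. if j = I0 then 1 else 2 :: nat)"
    by (simp add: fun_eq_iff)
  ultimately show ?thesis by (simp only:)
qed

lemma alpha_zeta: "alpha (Fn zeta) = 1"
  by (simp add: alpha_def comp_def mU_UNIV xs_square_mon Fn_mon froe_def sum_UNIV_ix zeta_def)

theorem theorem2p1p4:
  fixes s :: nat
  assumes "1 \<le> s"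
  shows "(s = 1 \<longrightarrow> coinv_spanned_by (degN s) zeta)
       \<and> (s = 2 \<longrightarrow> coinv_zero (degN s))
       \<and> (3 \<le> s \<longrightarrow> coinv_spanned_by (degN s) (wgen s))"
  using coinv_alpha[OF zeta_PA alpha_zeta] coinv_zero_2 coinv_wgen[of s] by (simp add: numeral_2_eq_2)

end
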